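(* In the setting described in the context, let $X$ be the semi-Markov process given by the first component of the unique strong solution $(X,Y,N)$ of $$X_t=X_0+\int_{0+}^t\int_{\mathbb{R}}h_\Lambda(X_{u-},Y_{u-},N_{u-},v)\,\wp(du,dv),$$ $$Y_t=Y_0+t-\int_{0+}^t (Y_{u-})\int_{\mathbb{R}}g_\Lambda(X_{u-},Y_{u-},N_{u-},v)\,\wp(du,dv),$$ $$N_t=\int_{0+}^t\int_{\mathbb{R}}g_\Lambda(X_{u-},Y_{u-},N_{u-},v)\,\wp(du,dv),\qquad t\ge0.$$ Then $\lambda(y,n)$ is the instantaneous transition rate matrix of $X$.
   Context: Meaning of the rate: with $T_1<T_2<\cdots$ the successive jump times of $X$, the rate of transition from state $i$ to state $j\neq i$ at age $y$ (after the $n$-th transition) is $$\lim_{h\to0}\frac1h\,P\big(X_{T_{n+1}}=j,\,T_{n+1}-T_n\in(y,y+h]\,\big|\,X_{T_n}=i,\,\{T_{n+1}-T_n>y\}\big),$$ and the assertion is that this equals $\lambda_{ij}(y,n)$. Setting. $(\Omega,\mathcal{F},\{\mathcal{F}_t\}_{t\ge0},P)$ is a filtered probability space satisfying the usual hypothesis; $\mathcal{X}=\{1,2,\dots\}$ is the state space, embedded in $\mathbb{R}$; $\mathbb{N}_0=\{0,1,2,\dots\}$, $\mathbb{R}_+=[0,\infty)$; $m_d$ is Lebesgue measure on $\mathbb{R}^d$. $\mathcal{X}$ is endowed with a total order $\prec_1$, which induces a total order $\prec_2$ on $\mathcal{X}_2:=\{(i,j)\in\mathcal{X}^2: i\ne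 j\}$ by the lexicographic order. For each $(i,j)\in\mathcal{X}_2$, $\lambda_{ij}:\mathbb{R}_+\times\mathbb{N}_0\to\mathbb{R}_+$ is a bounded measurable function; $\lambda_i(y,n):=\sum_{j\in\mathcal{X}\setminus\{i\}}\lambda_{ij}(y,n)$, and $\lambda(y,n)$ is the matrix with off-diagonal entries $\lambda_{ij}(y,n)$ and $i$-th diagonal entry $-\lambda_i(y,n)$. These satisfy: (A1) with $c_i:=\sum_{j\in\mathcal{X}\setminus\{i\}}\|\lambda_{ij}\|_{L^\infty(\mathbb{R}_+\times\mathbb{N}_0)}$, one has $c:=\sup_i c_i<\infty$; (A2) for each $n\in\mathbb{N}_0$ and $i\in\mathcal{X}$, $\lim_{y\to\infty}\gamma_i(y,n)=\infty$, where $\gamma_i(y,n):=\int_0^y\lambda_i(y',n)\,dy'$. For each $(i,j)\in\mathcal{X}_2$, $\tilde\lambda_{ij}:\mathbb{R}_+\times\mathbb{N}_0\to\mathbb{R}_+$ is a measurable function such that $\lambda_{ij}(y,n)\le\tilde\lambda_{ij}(y,n)$ for each $y\in\mathbb{R}_+$, $n\in\mathbb{N}_0$, and $\tilde\lambda_{ij}(y,n)\le\|\lambda_{ij}\|_{L^\infty(\mathbb{R}_+\times\mathbb{N}_0)}$ for almost every $y\in\mathbb{R}_+$ and $n\in\mathbb{N}_0$. For each $y,n$ a disjoint collection of intervals is defined by $$\Lambda_{ij}(y,n)=\Big(\sum_{(i',j')\prec_2(i,j)}\tilde\lambda_{i'j'}(y,n)\Big)+[0,\lambda_{ij}(y,n)),\qquad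 (i,j)\in\mathcal{X}_2,$$ where $a+B=\{a+b: b\in B\}$. The functions $h_\Lambda,g_\Lambda:\mathcal{X}\times\mathbb{R}_+\times\mathbb{N}_0\times\mathbb{R}\to\mathbb{R}$ are $$h_\Lambda(i,y,n,v):=\sum_{j\in\mathcal{X}\setminus\{i\}}(j-i)\mathbf{1}_{\Lambda_{ij}(y,n)}(v),\qquad g_\Lambda(i,y,n,v):=\sum_{j\in\mathcal{X}\setminus\{i\}}\mathbf{1}_{\Lambda_{ij}(y,n)}(v).$$ $\wp(du,dv)$ is a Poisson random measure on $\mathbb{R}_+\times\mathbb{R}$ with intensity $m_2(du,dv)$, defined on $(\Omega,\mathcal{F},P)$, and $\{\wp((0,t]\times dv)\}_{t\ge0}$ is adapted to $\{\mathcal{F}_t\}_{t\ge0}$. The initial values are $X_0\in\mathcal{X}$, $Y_0\in\mathbb{R}_+$, $N_0=0$. $\int_{0+}^t$ denotes integration over $(0,t]$.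
   Formalization: The rate equals λ_ij(y,n) for almost every age y and at every y where λ_ij(·,n) is right-continuous (at every y it is false: alter λ at one age), if the conditioning event has positive probability; for n=0, T_0=-Y_0 and one also conditions on Y_0≤y. *)

theory Defs
  imports "HOL-Probability.Probability"
begin

section \<open>Filtered probability spaces and Poisson random measures\<close>

text \<open>Time is indexed by \<^typ>\<open>real\<close>; only the indices \<open>t \<ge> 0\<close> are constrained.\<close>

definition usual_filtration :: "'a measure \<Rightarrow> (real \<Rightarrow> 'a measure) \<Rightarrow> bool" where
  "usual_filtration M F \<longleftrightarrow>
     complete_measure M \<and> null_sets M \<subseteq> sets (F 0) \<and>
     (\<forall>t\<ge>0. subalgebra M (F t)) \<and>
     (\<forall>s\<ge>0. \<forall>t\<ge>s. sets (F s) \<subseteq> sets (F t)) \<and>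
     (\<forall>t\<ge>0. sets (F t) = (\<Inter>s\<in>{t<..}. sets (F s)))"

text \<open>The Poisson weights are written out because \<^const>\<open>poisson_pmf\<close> is specified for positive rates
  only, whereas \<open>I\<close> may assign measure 0 to \<open>A\<close>.\<close>

definition poisson_random_measure ::
    "'a measure \<Rightarrow> 'b measure \<Rightarrow> ('a \<Rightarrow> 'b measure) \<Rightarrow> bool" where
  "poisson_random_measure M I \<phi> \<longleftrightarrow>
     (\<forall>\<omega>\<in>space M. sets (\<phi> \<omega>) = sets I) \<and>
     (\<forall>A\<in>sets I. (\<lambda>\<omega>. emeasure (\<phi> \<omega>) A) \<in> borel_measurable M) \<and>
     (\<forall>A\<in>sets I. emeasure I A < \<infinity> \<longrightarrow>
        (\<forall>k::nat. \<P>(\<omega> in M. emeasure (\<phi> \<omega>) A = of_nat k) =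
                   measure I A ^ k / fact k * exp (- measure I A))) \<and>
     (\<forall>A\<in>sets I. emeasure I A = \<infinity> \<longrightarrow> (AE \<omega> in M. emeasure (\<phi> \<omega>) A = \<infinity>)) \<and>
     (\<forall>(A :: nat \<Rightarrow> 'b set) m. A ` {..<m} \<subseteq> sets I \<and> disjoint_family_on A {..<m} \<longrightarrow>
        prob_space.indep_vars M (\<lambda>_. borel) (\<lambda>k \<omega>. emeasure (\<phi> \<omega>) (A k)) {..<m})"

definition random_measure_events :: "'a measure \<Rightarrow> 'b measure \<Rightarrow> ('a \<Rightarrow> 'b measure) \<Rightarrow> 'a set set" where
  "random_measure_events M I \<phi> =
     sets (vimage_algebra (space M) (\<lambda>\<omega>. \<lambda>A\<in>sets I. emeasure (\<phi> \<omega>) A) (\<Pi>\<^sub>M A\<in>sets I. borel))"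

text \<open>Lebesgue measure on \<open>[0,\<infinity>) \<times> \<real>\<close>, the intensity of the driving random measure.\<close>

definition half_plane :: "(real \<times> real) measure" where
  "half_plane = restrict_space lborel ({0..} \<times> UNIV)"

section \<open>Transition rates\<close>

text \<open>Functions on \<open>[0,\<infinity>) \<times> \<nat>\<close> are curried functions of type \<^typ>\<open>real \<Rightarrow> nat \<Rightarrow> real\<close>,
  of which only the values at nonnegative ages matter.\<close>

definition states :: "nat set" where
  "states = {1..}"

definition state_pairs :: "(nat \<times> nat) set" where
  "state_pairs = {(i, j). i \<in> states \<and> j \<in> states \<and> i \<noteq> j}"

definition age_count :: "(real \<times> nat) measure" where
  "age_count = restrict_space lborel {0..} \<Otimes>\<^sub>M count_space UNIV"

definition Linf_norm :: "(real \<Rightarrow> nat \<Rightarrow> real) \<Rightarrow> ennreal" where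
  "Linf_norm f = esssup age_count (\<lambda>(y, n). ennreal \<bar>f y n\<bar>)"

type_synonym rates = "nat \<Rightarrow> nat \<Rightarrow> real \<Rightarrow> nat \<Rightarrow> real"

definition exit_rate :: "rates \<Rightarrow> nat \<Rightarrow> real \<Rightarrow> nat \<Rightarrow> real" where
  "exit_rate lam i y n = (\<Sum>\<^sub>\<infinity>j\<in>states - {i}. lam i j y n)"

definition rate_matrix :: "rates \<Rightarrow> real \<Rightarrow> nat \<Rightarrow> nat \<Rightarrow> nat \<Rightarrow> real" where
  "rate_matrix lam y n i j = (if i = j then - exit_rate lam i y n else lam i j y n)"

definition exit_bound :: "rates \<Rightarrow> nat \<Rightarrow> ennreal" where
  "exit_bound lam i = (\<Sum>\<^sub>\<infinity>j\<in>states - {i}. Linf_norm (lam i j))"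

definition cumulative_exit_rate :: "rates \<Rightarrow> nat \<Rightarrow> real \<Rightarrow> nat \<Rightarrow> real" where
  "cumulative_exit_rate lam i y n = (LINT y':{0..y}|lborel. exit_rate lam i y' n)"

section \<open>The coefficients of the stochastic equation\<close>

text \<open>The strict order \<open>prec\<close> on the states induces the order \<open>prec <*lex*> prec\<close> on pairs.
  The offset of the interval \<open>Lam\<close> is an infinite sum in general; \<open>infsum\<close> is 0 for a divergent sum, so
  the intervals are the intended ones only where the sum converges.\<close>

definition pair_predecessors :: "nat rel \<Rightarrow> nat \<Rightarrow> nat \<Rightarrow> (nat \<times> nat) set" where
  "pair_predecessors prec i j = {p \<in> state_pairs. (p, (i, j)) \<in> prec <*lex*> prec}"

definition Lam :: "nat rel \<Rightarrow> rates \<Rightarrow> rates \<Rightarrow> nat \<Rightarrow> nat \<Rightarrow> real \<Rightarrow> nat \<Rightarrow> real set" where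
  "Lam prec lam lamt i j y n =
     (\<lambda>b. (\<Sum>\<^sub>\<infinity>(i', j')\<in>pair_predecessors prec i j. lamt i' j' y n) + b) ` {0..<lam i j y n}"

definition h_Lam :: "nat rel \<Rightarrow> rates \<Rightarrow> rates \<Rightarrow> nat \<Rightarrow> real \<Rightarrow> nat \<Rightarrow> real \<Rightarrow> real" where
  "h_Lam prec lam lamt i y n v =
     (\<Sum>\<^sub>\<infinity>j\<in>states - {i}. (real j - real i) * indicator (Lam prec lam lamt i j y n) v)"

definition g_Lam :: "nat rel \<Rightarrow> rates \<Rightarrow> rates \<Rightarrow> nat \<Rightarrow> real \<Rightarrow> nat \<Rightarrow> real \<Rightarrow> real" where
  "g_Lam prec lam lamt i y n v =
     (\<Sum>\<^sub>\<infinity>j\<in>states - {i}. indicator (Lam prec lam lamt i j y n) v)"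

section \<open>Strong solutions\<close>

definition rcll_path :: "(real \<Rightarrow> 'b::topological_space) \<Rightarrow> bool" where
  "rcll_path f \<longleftrightarrow> (\<forall>t\<ge>0. (f \<longlongrightarrow> f t) (at_right t)) \<and> (\<forall>t>0. \<exists>l. (f \<longlongrightarrow> l) (at_left t))"

definition left_lim :: "(real \<Rightarrow> 'b::t2_space) \<Rightarrow> real \<Rightarrow> 'b" where
  "left_lim f t = Lim (at_left t) f"

text \<open>For one path: the equation at time \<open>t\<close> driven by the measure \<open>\<mu>\<close>. The Bochner integral of a
  non-integrable function is 0, so integrability has to be part of the equation.\<close>

definition solves_at ::
    "nat rel \<Rightarrow> rates \<Rightarrow> rates \<Rightarrow> (real \<times> real) measure \<Rightarrow> nat \<Rightarrow> real \<Rightarrow>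
     (real \<Rightarrow> nat) \<Rightarrow> (real \<Rightarrow> real) \<Rightarrow> (real \<Rightarrow> nat) \<Rightarrow> real \<Rightarrow> bool" where
  "solves_at prec lam lamt \<mu> x0 y0 x y n t \<longleftrightarrow>
     (let h = (\<lambda>(u, v). h_Lam prec lam lamt (left_lim x u) (left_lim y u) (left_lim n u) v);
          g = (\<lambda>(u, v). g_Lam prec lam lamt (left_lim x u) (left_lim y u) (left_lim n u) v);
          yg = (\<lambda>(u, v). left_lim y u *
                 g_Lam prec lam lamt (left_lim x u) (left_lim y u) (left_lim n u) v);
          D = {0<..t} \<times> UNIV
      in set_integrable \<mu> D h \<and> set_integrable \<mu> D g \<and> set_integrable \<mu> D yg \<and>
         real (x t) = real x0 + set_lebesgue_integral \<mu> D h \<and>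
         y t = y0 + t - set_lebesgue_integral \<mu> D yg \<and>
         real (n t) = set_lebesgue_integral \<mu> D g)"

definition strong_solution ::
    "'a measure \<Rightarrow> (real \<Rightarrow> 'a measure) \<Rightarrow> nat rel \<Rightarrow> rates \<Rightarrow> rates \<Rightarrow>
     ('a \<Rightarrow> (real \<times> real) measure) \<Rightarrow> ('a \<Rightarrow> nat) \<Rightarrow> ('a \<Rightarrow> real) \<Rightarrow>
     (real \<Rightarrow> 'a \<Rightarrow> nat) \<Rightarrow> (real \<Rightarrow> 'a \<Rightarrow> real) \<Rightarrow> (real \<Rightarrow> 'a \<Rightarrow> nat) \<Rightarrow> bool" where
  "strong_solution M F prec lam lamt \<phi> X0 Y0 X Y N \<longleftrightarrow>
     (\<forall>t\<ge>0. X t \<in> F t \<rightarrow>\<^sub>M count_space UNIV \<and> Y t \<in> borel_measurable (F t) \<and>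
            N t \<in> F t \<rightarrow>\<^sub>M count_space UNIV) \<and>
     (AE \<omega> in M.
        (\<forall>t\<ge>0. X t \<omega> \<in> states \<and> 0 \<le> Y t \<omega>) \<and>
        rcll_path (\<lambda>t. X t \<omega>) \<and> rcll_path (\<lambda>t. Y t \<omega>) \<and> rcll_path (\<lambda>t. N t \<omega>) \<and>
        (\<forall>t\<ge>0. solves_at prec lam lamt (\<phi> \<omega>) (X0 \<omega>) (Y0 \<omega>)
                   (\<lambda>s. X s \<omega>) (\<lambda>s. Y s \<omega>) (\<lambda>s. N s \<omega>) t))"

section \<open>Jump times and rates of transition\<close>

text \<open>For \<open>n \<ge> 1\<close> this is the \<open>n\<close>-th jump time, which is \<open>\<infinity>\<close> if there are fewer than \<open>n\<close> jumps.
  The convention \<open>T\<^sub>0 = - Y\<^sub>0\<close> makes \<open>t - T\<^sub>n\<close> the age at every time \<open>t\<close> of \<open>[T\<^sub>n, T\<^sub>n\<^sub>+\<^sub>1)\<close> also for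
  \<open>n = 0\<close>: the sojourn in progress at time 0 already has age \<open>Y\<^sub>0\<close>.\<close>

primrec jump_time :: "(real \<Rightarrow> 'a \<Rightarrow> nat) \<Rightarrow> ('a \<Rightarrow> real) \<Rightarrow> nat \<Rightarrow> 'a \<Rightarrow> ereal" where
  "jump_time X Y0 0 \<omega> = - ereal (Y0 \<omega>)"
| "jump_time X Y0 (Suc n) \<omega> =
     Inf {ereal t |t. 0 < t \<and> jump_time X Y0 n \<omega> < ereal t \<and> X t \<omega> \<noteq> left_lim (\<lambda>s. X s \<omega>) t}"

text \<open>The event that the state at \<open>T\<^sub>n\<close> is \<open>i\<close>; since \<open>T\<^sub>0 \<le> 0\<close>, the state at \<open>T\<^sub>0\<close> is read as the
  one at time 0.\<close>

definition state_at_jump ::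
    "(real \<Rightarrow> 'a \<Rightarrow> nat) \<Rightarrow> ('a \<Rightarrow> real) \<Rightarrow> nat \<Rightarrow> nat \<Rightarrow> 'a \<Rightarrow> bool" where
  "state_at_jump X Y0 n i \<omega> \<longleftrightarrow>
     jump_time X Y0 n \<omega> < \<infinity> \<and> X (max 0 (real_of_ereal (jump_time X Y0 n \<omega>))) \<omega> = i"

definition holding_time :: "(real \<Rightarrow> 'a \<Rightarrow> nat) \<Rightarrow> ('a \<Rightarrow> real) \<Rightarrow> nat \<Rightarrow> 'a \<Rightarrow> ereal" where
  "holding_time X Y0 n \<omega> = jump_time X Y0 (Suc n) \<omega> - jump_time X Y0 n \<omega>"

text \<open>The conditioning event. For \<open>n \<ge> 1\<close> the last conjunct is void. The sojourn in progress at
  time 0 takes only ages \<open>\<ge> Y\<^sub>0\<close> on the time axis \<open>[0,\<infinity>)\<close>, so that it can be observed at age \<open>y\<close> only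
  if \<open>Y\<^sub>0 \<le> y\<close>.\<close>

definition at_age ::
    "(real \<Rightarrow> 'a \<Rightarrow> nat) \<Rightarrow> ('a \<Rightarrow> real) \<Rightarrow> nat \<Rightarrow> nat \<Rightarrow> real \<Rightarrow> 'a \<Rightarrow> bool" where
  "at_age X Y0 n i y \<omega> \<longleftrightarrow>
     state_at_jump X Y0 n i \<omega> \<and> ereal y < holding_time X Y0 n \<omega> \<and> (n = 0 \<longrightarrow> Y0 \<omega> \<le> y)"

text \<open>The elementary conditional probability is meaningful only for a non-null conditioning event.
  The quotient below is an average of the rate over \<open>(y, y + h]\<close> up to a factor tending to 1. For rates
  that are merely measurable in the age, the limit can therefore be asserted for almost every \<open>y\<close>, and
  for every \<open>y\<close> at which the rate is right-continuous.\<close>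

definition has_transition_rate ::
    "'a measure \<Rightarrow> (real \<Rightarrow> 'a \<Rightarrow> nat) \<Rightarrow> ('a \<Rightarrow> real) \<Rightarrow> nat \<Rightarrow> nat \<Rightarrow> nat \<Rightarrow> real \<Rightarrow> real \<Rightarrow> bool" where
  "has_transition_rate M X Y0 n i j y r \<longleftrightarrow>
     (0 < \<P>(\<omega> in M. at_age X Y0 n i y \<omega>) \<longrightarrow>
      ((\<lambda>h. 1 / h * \<P>(\<omega> in M. state_at_jump X Y0 (Suc n) j \<omega> \<and> ereal y < holding_time X Y0 n \<omega> \<and>
                                holding_time X Y0 n \<omega> \<le> ereal (y + h) \<bar> at_age X Y0 n i y \<omega>))
         \<longlongrightarrow> r) (at_right 0))"

end

theory Submission imports Defs begin

text \<open>Between its jumps the solution is deterministic: after the \<open>n\<close>-th jump, at which the state is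
  \<open>i\<close>, the age is the elapsed time and the count is \<open>n\<close>. Hence the next jump is at the first
  atom \<open>(u, v)\<close> of the random measure with \<open>v\<close> in one of the intervals of state \<open>i\<close> at age
  \<open>u - T\<^sub>n\<close>, and the event "\<open>X\<close> jumps from \<open>i\<close> to \<open>j\<close> at an age in \<open>(y, y + h]\<close>" has as indicator
  the number of atoms in a random set \<open>H\<close>. This set is predictable, by induction on \<open>n\<close>, for the
  filtration \<open>G\<close> generated by the initial values and the past of the random measure. (The given
  filtration \<open>F\<close> cannot be used: the random measure on the future is not assumed to be independent of it.)
  By independence of past and future the expected number of atoms in a predictable set is its expected
  Lebesgue measure, and the measure of \<open>H\<close> lies between \<open>I\<^sub>h\<close> on the event that the sojourn lasts up to
  age \<open>y + h\<close> and \<open>I\<^sub>h\<close> on the conditioning event, where \<open>I\<^sub>h\<close> is the integral of the rate over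
  \<open>(y, y + h]\<close>. The conditional probability divided by \<open>h\<close> therefore has the same limit as
  \<open>I\<^sub>h / h\<close>, which is given by Lebesgue's differentiation theorem or by right-continuity.\<close>

text \<open>The axioms of a Poisson random measure concern fixed disjoint sets and hold almost
  surely, whereas the equation charges lines over random times. So one fact is needed for all times
  at once: every vertical line carries at most one atom, of mass 1; two atoms on a line would add
  their jumps. All almost sure facts are gathered in one event \<open>K\<close>, on which the paths
  are studied one by one without probability. The measurability of the solution is no substitute for
  predictability: adaptedness to \<open>F\<close> says nothing about independence from the future.
  The jump times are therefore recovered from the measure: \<open>T (Suc n) \<le> q\<close> holds
  exactly when the marks that become available at the n-th jump have positive mass up to time q.
  These marks depend only on \<open>T n\<close> and the state there, so predictability passes from n
  to n + 1. The two bounds for the measure of H differ only if the sojourn ends at an age strictly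
  between y and y + h. The probability of this event tends to 0, and its speed does not matter
  because both bounds are multiples of the same integral.\<close>

section \<open>Averages over one-sided intervals\<close>

text \<open>A Vitali covering of the exceptional set \<open>S\<close>, where \<open>f < a\<close> but arbitrarily short averages of \<open>f\<close>
  exceed \<open>b\<close>, by intervals inside an open \<open>T \<supseteq> S\<close>: on each of them \<open>S\<close> has density at most \<open>\<theta> < 1\<close>, so
  \<open>|S| \<le> \<theta> |T|\<close>, with \<open>|T|\<close> arbitrarily close to \<open>|S|\<close>.\<close>

lemma Lebesgue_upper_density_null:
  fixes f :: "real \<Rightarrow> real"
  assumes f: "f \<in> borel_measurable borel" and bd: "\<And>x. \<bar>f x\<bar> \<le> B" and ab: "a < b"
  defines "F \<equiv> \<lambda>x h. LINT z:{x<..x+h}|lborel. f z"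
  shows "AE x in lborel. f x < a \<longrightarrow> (\<exists>d>0. \<forall>h. 0 < h \<and> h < d \<longrightarrow> F x h \<le> b * h)"
proof -
  have int: "set_integrable lborel {x<..x+h} f" for x h
    unfolding set_integrable_def
    by (rule integrableI_bounded_set_indicator[where B=B])
       (use f bd in \<open>auto simp: emeasure_bounded_finite[unfolded infinity_ennreal_def]\<close>)
  \<comment> \<open>\<open>C\<close> dominates f and exceeds b, so that \<open>\<theta>\<close>
    below lies in (0, 1). If f has integral above b h over an interval of length h, is at most C on
    it and below a on S, then b h < C h - (C - a) |S|: S fills less than the fraction
    \<open>\<theta>\<close> of the interval.\<close>
  define C where "C = max B b + 1"
  have C: "\<And>x. \<bar>f x\<bar> \<le> C" "b < C" "a < C" "0 < C"
  proof -
    show "\<bar>f x\<bar> \<le> C" for x using bd[of x] by (simp add: C_def max_def)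
    show "b < C" "a < C" using ab by (auto simp: C_def)
    have "0 \<le> B" using bd[of 0] by linarith
    then show "0 < C" by (simp add: C_def max_def)
  qed
  define \<theta> where "\<theta> = (C - b) / (C - a)"
  have \<theta>: "0 < \<theta>" "\<theta> < 1" using C ab by (auto simp: \<theta>_def)
  \<comment> \<open>Lipschitz dependence on the length later carries the estimate from rational
    lengths to all real ones.\<close>
  have Fdiff: "\<bar>F x h - F x k\<bar> \<le> C * (k - h)" if "0 \<le> h" "h \<le> k" for x h k
  proof -
    have "{x<..x+k} = {x<..x+h} \<union> {x+h<..x+h+(k-h)}" using that by auto
    then have "F x k = F x h + F (x+h) (k-h)"
      unfolding F_def using int[of x h] int[of "x+h" "k-h"]
      by (simp add: set_integral_Un)
    moreover have "\<bar>F (x+h) (k-h)\<bar> \<le> (LINT z:{x+h<..x+h+(k-h)}|lborel. C)"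
    proof -
      have "\<bar>F (x+h) (k-h)\<bar> \<le> (LINT z|lborel. \<bar>indicator {x+h<..x+h+(k-h)} z *\<^sub>R f z\<bar>)"
        unfolding F_def set_lebesgue_integral_def by (rule integral_abs_bound)
      also have "\<dots> \<le> (LINT z|lborel. indicator {x+h<..x+h+(k-h)} z *\<^sub>R C)"
        using int[of "x+h" "k-h"] C(1) that unfolding set_integrable_def
        by (intro integral_mono integrable_abs integrable_scaleR_left integrable_real_indicator) (auto simp: indicator_def)
      finally show ?thesis unfolding set_lebesgue_integral_def .
    qed
    ultimately show ?thesis using that by (simp add: mult.commute set_lebesgue_integral_def)
  qed
  \<comment> \<open>Rational lengths make this set Borel; the bound on x makes its measure finite,
    so that an open superset can be nearly as small.\<close>
  define S where "S m = {x. f x < a \<and> \<bar>x\<bar> < real m \<and> (\<forall>k::nat. \<exists>h\<in>\<rat>. 0 < h \<and> h < 1 / Suc k \<and> F x h > b * h)}" for m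
  have Fmeas: "(\<lambda>x. F x h) \<in> borel_measurable borel" for h
  proof -
    have "(\<lambda>x. LINT z|lborel. indicator {0<..h} z * f (x + z)) \<in> borel_measurable borel"
      using f by measurable
    moreover have "(LINT z|lborel. indicator {0<..h} z * f (x + z)) = F x h" for x
      unfolding F_def set_lebesgue_integral_def
      by (subst (2) lborel_integral_real_affine[where c=1 and t=x])
         (auto intro!: Bochner_Integration.integral_cong simp: indicator_def)
    ultimately show ?thesis by simp
  qed
  have Sm: "S m \<in> sets borel" for m
  proof -
    have "S m = ({x. f x < a} \<inter> {x. \<bar>x\<bar> < real m}) \<inter>
      (\<Inter>k::nat. \<Union>h\<in>\<rat> \<inter> {0<..<1/Suc k}. {x. F x h > b * h})"
      unfolding S_def by (auto simp: Bex_def)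
    also have "\<dots> \<in> sets borel"
    proof -
      have 1: "{x. f x < a} \<inter> {x. \<bar>x\<bar> < real m} \<in> sets borel" 
        using f by measurable
      have 2: "{x. F x h > b * h} \<in> sets borel" for h using Fmeas[of h] by measurable
      have 3: "countable (\<rat> \<inter> {0<..<1/real (Suc k)})" for k
        using countable_rat by (auto intro: countable_subset)
      show ?thesis using 1 2 3
        by (intro sets.Int[OF 1] sets.countable_INT'' sets.countable_UN'' 2 3) auto
    qed
    finally show ?thesis .
  qed
  have Snull: "emeasure lborel (S m) = 0" for m
  proof (rule ccontr)
    assume pos: "emeasure lborel (S m) \<noteq> 0"
    have fin: "emeasure lborel (S m) < \<infinity>"
      by (rule emeasure_bounded_finite) (auto simp: S_def bounded_iff intro!: exI[of _ "real m"])
    let ?\<mu> = "measure lebesgue"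
    have Slm: "S m \<in> lmeasurable"
      using fin Sm by (auto simp: fmeasurable_def)
    have mpos: "?\<mu> (S m) > 0"
      using pos fin Sm by (simp add: measure_def enn2real_positive_iff zero_less_iff_neq_zero top.not_eq_extremum)
    \<comment> \<open>Chosen so that \<open>\<theta>\<close> times (measure of S plus e) is the
      measure of S again, which closes the contradiction.\<close>
    define e where "e = ?\<mu> (S m) / \<theta> - ?\<mu> (S m)"
    have e: "e > 0" using mpos \<theta> by (simp add: e_def field_simps)
    obtain T where T: "open T" "S m \<subseteq> T" "T \<in> lmeasurable" "?\<mu> T < ?\<mu> (S m) + e"
    proof -
      obtain T where T: "open T" "S m \<subseteq> T" "T - S m \<in> lmeasurable" "emeasure lebesgue (T - S m) < ennreal e"
        using sets_lebesgue_outer_open[of "S m" e] Slm e by (auto simp: fmeasurable_def)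
      have "T = S m \<union> (T - S m)" using T by auto
      then have "T \<in> lmeasurable" "?\<mu> T \<le> ?\<mu> (S m) + ?\<mu> (T - S m)"
        using T(3) Slm by (metis fmeasurable.Un, metis measure_Un_le fmeasurableD)
      moreover have "?\<mu> (T - S m) < e"
        using T(3,4) e by (simp add: emeasure_eq_measure2 ennreal_less_iff)
      ultimately show ?thesis using that T by force
    qed
    \<comment> \<open>The covering theorem is about closed balls, so the intervals [x, x + h] are
      recentred at their midpoints. The point x then lies on the boundary of its ball, which the
      theorem permits.\<close>
    define K where "K = {(x,h). x \<in> S m \<and> 0 < h \<and> {x..x+h} \<subseteq> T \<and> F x h > b * h}"
    define cc where "cc = (\<lambda>(x::real,h). x + h/2)"
    define rr where "rr = (\<lambda>(x::real,h::real). h/2)"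
    have cb: "cball (cc p) (rr p) = {fst p..fst p + snd p}" for p
      by (cases p) (auto simp: cc_def rr_def cball_eq_atLeastAtMost)
    obtain D where D: "countable D" "D \<subseteq> K"
      "pairwise (\<lambda>i j. disjnt (cball (cc i) (rr i)) (cball (cc j) (rr j))) D"
      "negligible (S m - (\<Union>i \<in> D. cball (cc i) (rr i)))"
    proof (rule Vitali_covering_theorem_cballs[of K rr "S m" cc])
      show "0 < rr i" if "i \<in> K" for i using that by (auto simp: K_def rr_def)
      fix x d :: real assume x: "x \<in> S m" and d: "0 < d"
      obtain e where e: "e > 0" "ball x e \<subseteq> T" using T x by (meson open_contains_ball subsetD)
      obtain k :: nat where k: "1 / Suc k < min d e" using d e
        by (metis min_less_iff_conj nat_approx_posE)
      obtain h where h: "0 < h" "h < 1 / Suc k" "F x h > b * h" using x unfolding S_def by blast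
      have "{x..x+h} \<subseteq> ball x e" using h k by (auto simp: dist_real_def)
      then have "(x,h) \<in> K" using x h e by (auto simp: K_def)
      then show "\<exists>i. i \<in> K \<and> x \<in> cball (cc i) (rr i) \<and> rr i < d"
        using h k by (intro exI[of _ "(x,h)"]) (simp add: cb del: mem_cball, simp add: rr_def)
    qed blast
    \<comment> \<open>The averages are over half-open intervals. Passing to them from the balls
      loses only the left endpoints, a countable and hence null set.\<close>
    define I where "I p = {fst p<..fst p + snd p}" for p :: "real \<times> real"
    have each: "?\<mu> (S m \<inter> I p) \<le> \<theta> * ?\<mu> (I p)" if "p \<in> K" for p
    proof -
      obtain x h where p: "p = (x,h)" by (cases p)
      have h: "h > 0" "F x h > b * h" using that by (auto simp: K_def p)
      let ?A = "S m \<inter> {x<..x+h}"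
      have "F x h \<le> (LINT z|lborel. indicator {x<..x+h} z * C - indicator ?A z * (C - a))"
        unfolding F_def set_lebesgue_integral_def
      proof (rule integral_mono)
        have "emeasure lborel ?A \<le> emeasure lborel {x<..x+h}" by (intro emeasure_mono) auto
        then have "emeasure lborel ?A < \<infinity>" using h by (auto intro: le_less_trans)
        then show "integrable lborel (\<lambda>z. indicator {x<..x+h} z * C - indicator ?A z * (C - a))"
          using Sm[of m] h by (intro Bochner_Integration.integrable_diff integrable_mult_left) (auto simp: emeasure_lborel_Ioc)
        show "integrable lborel (\<lambda>z. indicator {x<..x+h} z *\<^sub>R f z)"
          using int unfolding set_integrable_def .
        show "indicator {x<..x+h} z *\<^sub>R f z \<le> indicator {x<..x+h} z * C - indicator ?A z * (C - a)" for z
          using C(1)[of z] by (auto simp: indicator_def S_def)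
      qed
      also have "\<dots> = h * C - measure lborel ?A * (C - a)"
      proof -
        have "emeasure lborel ?A \<le> emeasure lborel {x<..x+h}" by (intro emeasure_mono) auto
        then have "emeasure lborel ?A < \<infinity>" using h by (auto intro: le_less_trans)
        then show ?thesis using Sm[of m] h
          by (subst Bochner_Integration.integral_diff) (auto intro!: integrable_mult_left simp: emeasure_lborel_Ioc)
      qed
      finally have "measure lborel ?A * (C - a) \<le> h * (C - b)" using h by (simp add: algebra_simps)
      then have "measure lborel ?A \<le> \<theta> * h" using C by (simp add: \<theta>_def field_simps)
      then show ?thesis using h Sm[of m] by (simp add: p I_def)
    qed
    have disj: "disjoint_family_on I D"
      unfolding disjoint_family_on_def
    proof (intro ballI impI)
      fix p q assume "p \<in> D" "q \<in> D" "p \<noteq> q"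
      then have "disjnt (cball (cc p) (rr p)) (cball (cc q) (rr q))" using D(3) by (auto simp: pairwise_def)
      then show "I p \<inter> I q = {}" unfolding cb disjnt_def I_def by fastforce
    qed
    have Iin: "(\<Union>p\<in>D. I p) \<subseteq> T" using D(2) by (fastforce simp: K_def I_def)
    have ImT: "emeasure lborel (\<Union>p\<in>D. I p) \<le> emeasure lebesgue T"
    proof -
      have "emeasure lborel (\<Union>p\<in>D. I p) = emeasure lebesgue (\<Union>p\<in>D. I p)"
      proof -
        have "(\<Union>p\<in>D. I p) \<in> sets lborel" using D(1) by (intro sets.countable_UN'') (auto simp: I_def)
        then show ?thesis by (simp del: sets_lborel)
      qed
      also have "\<dots> \<le> emeasure lebesgue T" using Iin T(3) by (intro emeasure_mono) (auto simp: fmeasurable_def)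
      finally show ?thesis .
    qed
    have negI: "negligible (S m - (\<Union>p\<in>D. I p))"
    proof -
      have "S m - (\<Union>p\<in>D. I p) \<subseteq> (S m - (\<Union>i \<in> D. cball (cc i) (rr i))) \<union> fst ` D"
        by (force simp: cb I_def)
      moreover have "negligible (fst ` D)" using D(1) by (simp add: negligible_iff_null_sets countable_imp_null_set_lborel null_sets_completionI)
      ultimately show ?thesis using D(4) by (meson negligible_Un negligible_subset)
    qed
    have "emeasure lborel (S m) \<le> emeasure lborel (S m \<inter> (\<Union>p\<in>D. I p)) + emeasure lborel (S m - (\<Union>p\<in>D. I p))"
    proof (rule order_trans[OF emeasure_mono emeasure_subadditive])
      have "(\<Union>p\<in>D. I p) \<in> sets lborel" using D(1) by (intro sets.countable_UN'') (auto simp: I_def)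
      then show "S m \<inter> (\<Union>p\<in>D. I p) \<in> sets lborel" "S m - (\<Union>p\<in>D. I p) \<in> sets lborel"
        "S m \<inter> (\<Union>p\<in>D. I p) \<union> (S m - (\<Union>p\<in>D. I p)) \<in> sets lborel"
        using Sm[of m] by auto
    qed auto
    also have "emeasure lborel (S m - (\<Union>p\<in>D. I p)) = 0"
    proof -
      have "(\<Union>p\<in>D. I p) \<in> sets lborel" using D(1) by (intro sets.countable_UN'') (auto simp: I_def)
      then have 1: "S m - (\<Union>p\<in>D. I p) \<in> sets lborel" using Sm[of m] by auto
      then have "emeasure lebesgue (S m - (\<Union>p\<in>D. I p)) = 0"
        using negI by (subst negligible_iff_emeasure0[symmetric]) (auto intro: sets_completionI_sets)
      then show ?thesis using 1 by (simp del: sets_lborel)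
    qed
    also have "emeasure lborel (S m \<inter> (\<Union>p\<in>D. I p)) = (\<integral>\<^sup>+p. emeasure lborel (S m \<inter> I p) \<partial>count_space D)"
    proof -
      have "S m \<inter> (\<Union>p\<in>D. I p) = (\<Union>p\<in>D. S m \<inter> I p)" by auto
      moreover have "disjoint_family_on (\<lambda>p. S m \<inter> I p) D"
        using disj unfolding disjoint_family_on_def by blast
      moreover have "S m \<inter> I p \<in> sets lborel" for p using Sm[of m] by (auto simp: I_def)
      ultimately show ?thesis using D(1) by (simp only: emeasure_UN_countable)
    qed
    also have "\<dots> \<le> (\<integral>\<^sup>+p. ennreal \<theta> * emeasure lborel (I p) \<partial>count_space D)"
    proof (rule nn_integral_mono)
      fix p assume "p \<in> space (count_space D)"
      then have pK: "p \<in> K" using D(2) by auto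
      have f1: "emeasure lborel (I p) < \<infinity>" by (simp add: I_def emeasure_bounded_finite[unfolded infinity_ennreal_def])
      have f2: "emeasure lborel (S m \<inter> I p) < \<infinity>"
        using emeasure_mono[of "S m \<inter> I p" "I p" lborel] f1 by (auto simp: I_def le_less_trans)
      show "emeasure lborel (S m \<inter> I p) \<le> ennreal \<theta> * emeasure lborel (I p)"
        using each[OF pK] f1 f2 \<theta> Sm[of m]
        by (simp add: emeasure_eq_ennreal_measure ennreal_mult'[symmetric] I_def)
    qed
    also have "\<dots> = ennreal \<theta> * emeasure lborel (\<Union>p\<in>D. I p)"
      using disj D(1) by (subst emeasure_UN_countable) (auto simp: I_def nn_integral_cmult)
    also have "\<dots> \<le> ennreal \<theta> * emeasure lebesgue T" using ImT by (intro mult_left_mono) auto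
    also have "\<dots> = ennreal (\<theta> * ?\<mu> T)"
      using T(3) \<theta> by (simp add: emeasure_eq_measure2 ennreal_mult')
    finally have "?\<mu> (S m) \<le> \<theta> * ?\<mu> T"
      using Slm Sm[of m] \<theta> fin by (simp add: emeasure_eq_ennreal_measure)
    also have "\<dots> < \<theta> * (?\<mu> (S m) + e)" using T(4) \<theta> by simp
    also have "\<dots> = ?\<mu> (S m)" using \<theta> by (simp add: e_def)
    finally show False by simp
  qed
  have "AE x in lborel. \<forall>m. x \<notin> S m"
    unfolding AE_all_countable using Snull Sm by (auto intro!: AE_not_in)
  then show ?thesis
  proof (rule AE_mp, intro AE_I2 impI)
    fix x assume x: "\<forall>m. x \<notin> S m" and fx: "f x < a"
    obtain m :: nat where m: "\<bar>x\<bar> < real m" using reals_Archimedean2 by blast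
    then obtain k :: nat where k: "\<And>h. h \<in> \<rat> \<Longrightarrow> 0 < h \<Longrightarrow> h < 1 / Suc k \<Longrightarrow> F x h \<le> b * h"
      using x[rule_format, of m] fx unfolding S_def by (simp add: not_less) (metis not_less)
    show "\<exists>d>0. \<forall>h. 0 < h \<and> h < d \<longrightarrow> F x h \<le> b * h"
    proof (intro exI[of _ "1 / Suc k"] conjI allI impI)
      fix h :: real assume h: "0 < h \<and> h < 1 / Suc k"
      show "F x h \<le> b * h"
      proof (rule field_le_epsilon)
        fix e :: real assume e: "0 < e"
        \<comment> \<open>Replacing h by a rational q slightly above it costs at most (C + |b|) (q -
          h), which is below e for q < d.\<close>
        define d where "d = min (1 / Suc k) (h + e / (C + \<bar>b\<bar>))"
        have "h < d" using h e C by (auto simp: d_def intro!: divide_pos_pos add_pos_nonneg)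
        then obtain q where q: "q \<in> \<rat>" "h < q" "q < d" using Rats_dense_in_real by blast
        have "F x h \<le> F x q + C * (q - h)" using Fdiff[of h q x] q h by auto
        also have "\<dots> \<le> b * q + C * (q - h)" using k[of q] q h by (auto simp: d_def)
        also have "\<dots> = b * h + (C + b) * (q - h)" by (simp add: algebra_simps)
        also have "\<dots> \<le> b * h + (C + \<bar>b\<bar>) * (q - h)" using q by (intro add_left_mono mult_right_mono) auto
        also have "\<dots> \<le> b * h + e" 
        proof -
          have "C + \<bar>b\<bar> > 0" using C by auto
          moreover have "q - h < e / (C + \<bar>b\<bar>)" using q by (auto simp: d_def)
          ultimately show ?thesis by (simp add: field_simps)
        qed
        finally show "F x h \<le> b * h + e" .
      qed
    qed simp
  qed
qed

text \<open>The preceding lemma bounds the upper limit of the averages by f(x); applied to -f it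
  bounds the lower limit. Taking a and b rational keeps the exceptional set null.\<close>

theorem Lebesgue_differentiation_right:
  fixes f :: "real \<Rightarrow> real"
  assumes f: "f \<in> borel_measurable borel" and bd: "\<And>x. \<bar>f x\<bar> \<le> B"
  shows "AE x in lborel. ((\<lambda>h. (LINT z:{x<..x+h}|lborel. f z) / h) \<longlongrightarrow> f x) (at_right 0)"
proof -
  have "AE x in lborel. \<forall>a\<in>\<rat>. \<forall>b\<in>\<rat>. a < b \<longrightarrow> f x < a \<longrightarrow>
      (\<exists>d>0. \<forall>h. 0 < h \<and> h < d \<longrightarrow> (LINT z:{x<..x+h}|lborel. f z) \<le> b * h)"
    using Lebesgue_upper_density_null[OF f bd] by (auto simp: AE_ball_countable countable_rat)
  moreover have "AE x in lborel. \<forall>a\<in>\<rat>. \<forall>b\<in>\<rat>. a < b \<longrightarrow> - f x < a \<longrightarrow>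
      (\<exists>d>0. \<forall>h. 0 < h \<and> h < d \<longrightarrow> (LINT z:{x<..x+h}|lborel. - f z) \<le> b * h)"
    using Lebesgue_upper_density_null[of "\<lambda>x. - f x" B] f bd by (auto simp: AE_ball_countable countable_rat)
  ultimately show ?thesis
  proof eventually_elim
    case (elim x)
    let ?F = "\<lambda>h. LINT z:{x<..x+h}|lborel. f z"
    show ?case
    proof (rule order_tendstoI)
      fix c assume "c > f x"
      then obtain b where b: "b \<in> \<rat>" "f x < b" "b < c" using Rats_dense_in_real by blast
      then obtain a where a: "a \<in> \<rat>" "f x < a" "a < b" using Rats_dense_in_real by blast
      obtain d where "d > 0" "\<And>h. 0 < h \<Longrightarrow> h < d \<Longrightarrow> ?F h \<le> b * h" using elim(1)[rule_format, OF a(1) b(1) a(3) a(2)] by blast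
      then have "0 < h \<Longrightarrow> h < d \<Longrightarrow> ?F h / h < c" for h
        
      proof -
        assume h: "0 < h" "h < d"
        then have "?F h / h \<le> b" using \<open>0 < h \<Longrightarrow> h < d \<Longrightarrow> ?F h \<le> b * h\<close> by (simp add: divide_le_eq)
        then show "?F h / h < c" using b by simp
      qed
      then show "\<forall>\<^sub>F h in at_right 0. ?F h / h < c" using \<open>d > 0\<close>
        by (auto simp: eventually_at_right_field intro!: exI[of _ d])
    next
      fix c assume "c < f x"
      then obtain b where b: "b \<in> \<rat>" "- f x < b" "b < - c" using Rats_dense_in_real[of "- f x" "- c"] by auto
      then obtain a where a: "a \<in> \<rat>" "- f x < a" "a < b" using Rats_dense_in_real by blast
      obtain d where "d > 0" "\<And>h. 0 < h \<Longrightarrow> h < d \<Longrightarrow> - ?F h \<le> b * h" using elim(2)[rule_format, OF a(1) b(1) a(3) a(2)]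
        by (auto simp: set_lebesgue_integral_def)
      then have "0 < h \<Longrightarrow> h < d \<Longrightarrow> c < ?F h / h" for h
      proof -
        assume h: "0 < h" "h < d"
        have "c * h < (- b) * h" using b h by (intro mult_strict_right_mono) auto
        also have "\<dots> \<le> ?F h" using \<open>0 < h \<Longrightarrow> h < d \<Longrightarrow> - ?F h \<le> b * h\<close> h by simp
        finally show "c < ?F h / h" using h by (simp add: field_simps)
      qed
      then show "\<forall>\<^sub>F h in at_right 0. c < ?F h / h" using \<open>d > 0\<close>
        by (auto simp: eventually_at_right_field intro!: exI[of _ d])
    qed
  qed
qed

lemma right_average_tendsto:
  fixes f :: "real \<Rightarrow> real"
  assumes f: "f \<in> borel_measurable borel" "\<And>x. \<bar>f x\<bar> \<le> B" and lim: "(f \<longlongrightarrow> r) (at_right y)"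
  shows "((\<lambda>h. (LINT z:{y<..y+h}|lborel. f z) / h) \<longlongrightarrow> r) (at_right 0)"
proof (rule tendstoI)
  fix e :: real assume e: "0 < e"
  from tendstoD[OF lim half_gt_zero[OF e]] obtain b where b: "b > y" "\<And>z. y < z \<Longrightarrow> z < b \<Longrightarrow> \<bar>f z - r\<bar> < e / 2"
    by (auto simp: eventually_at_right_field dist_real_def)
  have int: "set_integrable lborel {y<..y+h} f" for h
    unfolding set_integrable_def
    by (rule integrableI_bounded_set_indicator[where B=B])
       (use f in \<open>auto simp: emeasure_bounded_finite[unfolded infinity_ennreal_def]\<close>)
  have intc: "set_integrable lborel {y<..y+h} (\<lambda>_. c)" for h and c :: real
    unfolding set_integrable_def
    by (rule integrableI_bounded_set_indicator[where B="\<bar>c\<bar>"])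
       (auto simp: emeasure_bounded_finite[unfolded infinity_ennreal_def])
  have "dist ((LINT z:{y<..y+h}|lborel. f z) / h) r < e" if h: "0 < h" "h < b - y" for h
  proof -
    have c: "(LINT z:{y<..y+h}|lborel. c) = c * h" for c :: real using h by (simp add: set_lebesgue_integral_def)
    have "(LINT z:{y<..y+h}|lborel. f z) \<le> (LINT z:{y<..y+h}|lborel. r + e / 2)"
    proof (rule set_integral_mono[OF int intc])
      fix z assume "z \<in> {y<..y+h}" then have "\<bar>f z - r\<bar> < e / 2" using b(2)[of z] h by auto
      then show "f z \<le> r + e / 2" by linarith
    qed
    moreover have "(LINT z:{y<..y+h}|lborel. r - e / 2) \<le> (LINT z:{y<..y+h}|lborel. f z)"
    proof (rule set_integral_mono[OF intc int])
      fix z assume "z \<in> {y<..y+h}" then have "\<bar>f z - r\<bar> < e / 2" using b(2)[of z] h by auto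
      then show "r - e / 2 \<le> f z" by linarith
    qed
    ultimately have "(LINT z:{y<..y+h}|lborel. f z) / h \<le> r + e / 2" "r - e / 2 \<le> (LINT z:{y<..y+h}|lborel. f z) / h"
      unfolding c using h by (auto simp: field_simps)
    then show ?thesis using e by (simp add: dist_real_def abs_less_iff)
  qed
  then show "\<forall>\<^sub>F h in at_right 0. dist ((LINT z:{y<..y+h}|lborel. f z) / h) r < e"
    using b(1) by (auto simp: eventually_at_right_field intro!: exI[of _ "b - y"])
qed

section \<open>Paths of the equation\<close>

locale interval_rates =
  fixes prec :: "nat rel" and lam lamt :: rates
  assumes prec_order: "strict_linear_order_on states prec"
    and lam_nonneg: "\<And>i j y n. (i, j) \<in> state_pairs \<Longrightarrow> 0 \<le> y \<Longrightarrow> 0 \<le> lam i j y n"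
    and lam_le_lamt: "\<And>i j y n. (i, j) \<in> state_pairs \<Longrightarrow> 0 \<le> y \<Longrightarrow> lam i j y n \<le> lamt i j y n"
    and lamt_summable: "\<And>i j y n. (i, j) \<in> state_pairs \<Longrightarrow> 0 \<le> y \<Longrightarrow>
          (\<lambda>(i', j'). lamt i' j' y n) summable_on pair_predecessors prec i j"
begin

definition Lams :: "nat \<Rightarrow> real \<Rightarrow> nat \<Rightarrow> real set" where
  "Lams i y n = (\<Union>j\<in>states - {i}. Lam prec lam lamt i j y n)"

lemma lamt_nonneg: "(i, j) \<in> state_pairs \<Longrightarrow> 0 \<le> y \<Longrightarrow> 0 \<le> lamt i j y n"
  using lam_nonneg lam_le_lamt order_trans by blast

text \<open>The predecessors of (i, j') include those of (i, j) and (i, j) itself, so the second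
  interval starts at least \<open>lamt i j\<close> after the first, whose length is only
  \<open>lam i j\<close>. The comparison of offsets rests on summability, since a divergent
  \<open>infsum\<close> is 0.\<close>

lemma Lam_disjoint_ordered:
  assumes "i \<in> states" "j \<in> states - {i}" "j' \<in> states - {i}" "(j, j') \<in> prec" "0 \<le> y"
  shows "Lam prec lam lamt i j y n \<inter> Lam prec lam lamt i j' y n = {}"
proof -
  let ?f = "\<lambda>(i', j'). lamt i' j' y n"
  let ?P = "pair_predecessors prec i"
  have sp: "(i, j) \<in> state_pairs" "(i, j') \<in> state_pairs" using assms by (auto simp: state_pairs_def)
  have irr: "(k, k) \<notin> prec" for k using prec_order by (auto simp: strict_linear_order_on_def irrefl_def)
  have tr: "trans prec" using prec_order by (auto simp: strict_linear_order_on_def)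
  have notin: "(i, j) \<notin> ?P j" using irr by (auto simp: pair_predecessors_def)
  have sub: "insert (i, j) (?P j) \<subseteq> ?P j'"
    using sp assms(4) tr by (auto simp: pair_predecessors_def dest: transD)
  have "infsum ?f (?P j) + lamt i j y n = infsum ?f (insert (i, j) (?P j))"
    using lamt_summable[OF sp(1) assms(5)] notin by (subst infsum_insert) auto
  also have "\<dots> \<le> infsum ?f (?P j')"
    using lamt_summable[OF sp(2) assms(5)] lamt_summable[OF sp(1) assms(5)] sub assms(5)
    by (intro infsum_mono_neutral)
       (auto simp: summable_on_insert_iff pair_predecessors_def intro!: lamt_nonneg)
  finally have "infsum ?f (?P j) + lam i j y n \<le> infsum ?f (?P j')"
    using lam_le_lamt[OF sp(1) assms(5), of n] by linarith
  then show ?thesis unfolding Lam_def by auto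
qed

lemma Lam_disjoint:
  assumes "i \<in> states" "j \<in> states - {i}" "j' \<in> states - {i}" "0 \<le> y"
    and "v \<in> Lam prec lam lamt i j y n" "v \<in> Lam prec lam lamt i j' y n"
  shows "j = j'"
proof (rule ccontr)
  assume "j \<noteq> j'"
  then have "(j, j') \<in> prec \<or> (j', j) \<in> prec"
    using prec_order assms by (auto simp: strict_linear_order_on_def total_on_def)
  then show False using Lam_disjoint_ordered assms by blast
qed

lemma infsum_single_Lam:
  fixes c :: "nat \<Rightarrow> real"
  assumes "i \<in> states" "0 \<le> y" "j \<in> states - {i}" "v \<in> Lam prec lam lamt i j y n"
  shows "(\<Sum>\<^sub>\<infinity>k\<in>states - {i}. c k * indicator (Lam prec lam lamt i k y n) v) = c j"
proof -
  have "(\<Sum>\<^sub>\<infinity>k\<in>states - {i}. c k * indicator (Lam prec lam lamt i k y n) v) =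
      (\<Sum>\<^sub>\<infinity>k\<in>{j}. c k * indicator (Lam prec lam lamt i k y n) v)"
  proof (rule infsum_cong_neutral)
    fix k assume "k \<in> states - {i} - {j}"
    then show "c k * indicator (Lam prec lam lamt i k y n) v = 0"
      using Lam_disjoint[OF assms(1,3) _ assms(2,4), of k] by (auto simp: indicator_def)
  qed (use assms in auto)
  then show ?thesis using assms by simp
qed

lemma h_Lam_eq:
  assumes "i \<in> states" "0 \<le> y" "j \<in> states - {i}" "v \<in> Lam prec lam lamt i j y n"
  shows "h_Lam prec lam lamt i y n v = real j - real i"
  unfolding h_Lam_def using infsum_single_Lam[OF assms, of "\<lambda>j. real j - real i"] .

lemma h_Lam_eq_0: "v \<notin> Lams i y n \<Longrightarrow> h_Lam prec lam lamt i y n v = 0"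
  unfolding h_Lam_def by (rule infsum_0) (auto simp: Lams_def)

lemma g_Lam_eq:
  assumes "i \<in> states" "0 \<le> y"
  shows "g_Lam prec lam lamt i y n v = indicator (Lams i y n) v"
proof (cases "v \<in> Lams i y n")
  case True
  then obtain j where "j \<in> states - {i}" "v \<in> Lam prec lam lamt i j y n" by (auto simp: Lams_def)
  from infsum_single_Lam[OF assms this, of "\<lambda>_. 1"] True show ?thesis by (simp add: g_Lam_def)
next
  case False
  then have "g_Lam prec lam lamt i y n v = 0"
    unfolding g_Lam_def by (intro infsum_0) (auto simp: Lams_def)
  with False show ?thesis by simp
qed

end

lemma rcll_path_right: "rcll_path f \<Longrightarrow> 0 \<le> t \<Longrightarrow> (f \<longlongrightarrow> f t) (at_right t)"
  by (simp add: rcll_path_def)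

lemma rcll_path_left: "rcll_path f \<Longrightarrow> 0 < t \<Longrightarrow> (f \<longlongrightarrow> left_lim f t) (at_left t)"
  unfolding rcll_path_def left_lim_def
  by (metis tendsto_Lim trivial_limit_at_left_real)

lemma left_lim_eqI: "(f \<longlongrightarrow> l) (at_left t) \<Longrightarrow> left_lim f t = l" for t :: real
  unfolding left_lim_def by (simp add: tendsto_Lim)

lemma tendsto_discrete_ev:
  fixes f :: "'a \<Rightarrow> 'b::discrete_topology"
  shows "(f \<longlongrightarrow> l) F \<Longrightarrow> eventually (\<lambda>x. f x = l) F"
  by (simp add: nhds_discrete filterlim_principal)

text \<open>The assumption forbids points of \<open>P\<close> to accumulate from the right at any u
  beyond s, in particular at the infimum itself. An infimum that is not attained would be such an
  accumulation point.\<close>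

lemma Inf_ereal_jumps:
  fixes P :: "real \<Rightarrow> bool"
  assumes s: "\<And>u. s \<le> u \<Longrightarrow> \<exists>e>u. \<forall>w. u < w \<and> w < e \<longrightarrow> \<not> P w"
  shows "(Inf {ereal t |t. s < t \<and> P t} = \<infinity> \<and> (\<forall>t>s. \<not> P t)) \<or>
    (\<exists>t>s. Inf {ereal t |t. s < t \<and> P t} = ereal t \<and> P t \<and> (\<forall>w. s < w \<and> w < t \<longrightarrow> \<not> P w))"
proof (cases "\<exists>t>s. P t")
  case False
  then have "{ereal t |t. s < t \<and> P t} = {}" by auto
  then have "Inf {ereal t |t. s < t \<and> P t} = \<infinity>" by (simp only: Inf_empty top_ereal_def)
  with False show ?thesis by blast
next
  case True
  define A where "A = {t. s < t \<and> P t}"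
  have A: "A \<noteq> {}" "bdd_below A" using True by (auto simp: A_def intro!: bdd_belowI[of _ s])
  define m where "m = Inf A"
  have lb: "m \<le> t" if "t \<in> A" for t using that A(2) unfolding m_def by (rule cInf_lower)
  have "s \<le> m" unfolding m_def using A(1) by (intro cInf_greatest) (auto simp: A_def)
  then obtain e where e: "e > m" "\<And>w. m < w \<Longrightarrow> w < e \<Longrightarrow> \<not> P w" using s by blast
  have "m \<in> A"
  proof (rule ccontr)
    assume "m \<notin> A"
    have "e \<le> t" if "t \<in> A" for t
    proof (rule ccontr)
      assume "\<not> e \<le> t"
      moreover have "m < t" using lb[OF that] \<open>m \<notin> A\<close> that by (cases "m = t") auto
      ultimately show False using e(2)[of t] that by (auto simp: A_def)
    qed
    then have "e \<le> m" unfolding m_def using A(1) by (intro cInf_greatest) auto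
    with e(1) show False by simp
  qed
  have "Inf {ereal t |t. s < t \<and> P t} = ereal m"
    using \<open>m \<in> A\<close> lb by (intro cInf_eq_minimum) (auto simp: A_def)
  moreover have "\<not> P w" if "s < w" "w < m" for w using lb[of w] that by (auto simp: A_def)
  ultimately show ?thesis using \<open>m \<in> A\<close> by (auto simp: A_def)
qed

section \<open>A single path: where it jumps and how it moves in between\<close>

locale path_solution = interval_rates +
  fixes \<mu> :: "(real \<times> real) measure" and x0 :: nat and y0 :: real
    and x :: "real \<Rightarrow> nat" and y :: "real \<Rightarrow> real" and N :: "real \<Rightarrow> nat"
  assumes sets_mu: "sets \<mu> = sets half_plane"
    and line: "\<And>u. 0 < u \<Longrightarrow> emeasure \<mu> ({u} \<times> UNIV) = 0 \<or>
          (\<exists>v. emeasure \<mu> {(u, v)} = 1 \<and> emeasure \<mu> ({u} \<times> (- {v})) = 0)"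
    and x_states: "\<And>t. 0 \<le> t \<Longrightarrow> x t \<in> states" and y_nonneg: "\<And>t. 0 \<le> t \<Longrightarrow> 0 \<le> y t"
    and y0_nonneg: "0 \<le> y0"
    and rcll: "rcll_path x" "rcll_path y" "rcll_path N"
    and solves: "\<And>t. 0 \<le> t \<Longrightarrow> solves_at prec lam lamt \<mu> x0 y0 x y N t"
begin

abbreviation "xl \<equiv> left_lim x"
abbreviation "yl \<equiv> left_lim y"
abbreviation "Nl \<equiv> left_lim N"

text \<open>An atom of the measure makes the path jump exactly if it lies in this set. Left limits
  appear because the coefficients are evaluated just before the jump.\<close>

definition E :: "(real \<times> real) set" where
  "E = {(u, v). 0 < u \<and> v \<in> Lams (xl u) (yl u) (Nl u)}"

definition "hh = (\<lambda>(u, v). h_Lam prec lam lamt (xl u) (yl u) (Nl u) v)"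
definition "gg = (\<lambda>(u, v). g_Lam prec lam lamt (xl u) (yl u) (Nl u) v)"
definition "yg = (\<lambda>(u, v). yl u * g_Lam prec lam lamt (xl u) (yl u) (Nl u) v)"

lemma space_mu: "space \<mu> = {0..} \<times> UNIV"
  using sets_eq_imp_space_eq[OF sets_mu] by (simp add: half_plane_def space_restrict_space)

lemma sets_muI: "A \<in> sets borel \<Longrightarrow> A \<subseteq> {0..} \<times> UNIV \<Longrightarrow> A \<in> sets \<mu>"
proof -
  have "({0..} \<times> UNIV :: (real \<times> real) set) \<in> sets borel"
    by (intro borel_closed closed_Times) auto
  then show "A \<in> sets borel \<Longrightarrow> A \<subseteq> {0..} \<times> UNIV \<Longrightarrow> A \<in> sets \<mu>"
  unfolding sets_mu half_plane_def by (subst sets_restrict_space_iff) auto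
qed

lemma strip_sets: "I \<in> sets borel \<Longrightarrow> I \<subseteq> {0..} \<Longrightarrow> I \<times> UNIV \<in> sets \<mu>"
  by (intro sets_muI) (auto simp: borel_prod[symmetric])

lemma point_sets: "0 \<le> u \<Longrightarrow> {(u, v)} \<in> sets \<mu>"
  by (intro sets_muI) auto

lemma left_limits:
  assumes "0 < u"
  shows "xl u \<in> states" "0 \<le> yl u"
    "\<forall>\<^sub>F s in at_left u. x s = xl u" "\<forall>\<^sub>F s in at_left u. N s = Nl u" "(y \<longlongrightarrow> yl u) (at_left u)"
proof -
  have pos: "\<forall>\<^sub>F s in at_left u. 0 < s" using assms eventually_at_left by blast
  show x: "\<forall>\<^sub>F s in at_left u. x s = xl u" using rcll_path_left[OF rcll(1) assms] by (rule tendsto_discrete_ev)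
  show "\<forall>\<^sub>F s in at_left u. N s = Nl u" using rcll_path_left[OF rcll(3) assms] by (rule tendsto_discrete_ev)
  show y: "(y \<longlongrightarrow> yl u) (at_left u)" using rcll_path_left[OF rcll(2) assms] .
  have "\<forall>\<^sub>F s in at_left u. xl u \<in> states"
    using x pos by eventually_elim (metis x_states less_imp_le)
  then show "xl u \<in> states" by simp
  show "0 \<le> yl u" using y by (rule tendsto_lowerbound) (use pos in \<open>auto elim!: eventually_mono intro: y_nonneg\<close>)
qed

lemma gg_eq: "0 < fst p \<Longrightarrow> gg p = indicator E p"
  using left_limits(1,2)[of "fst p"] by (cases p) (auto simp: gg_def g_Lam_eq E_def indicator_def)

lemma off_E: "0 < fst p \<Longrightarrow> p \<notin> E \<Longrightarrow> hh p = 0 \<and> gg p = 0 \<and> yg p = 0"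
  using left_limits(1,2)[of "fst p"] by (cases p) (auto simp: hh_def gg_def yg_def g_Lam_eq E_def h_Lam_eq_0)

lemma equations:
  assumes "0 \<le> t"
  shows "set_integrable \<mu> ({0<..t} \<times> UNIV) hh" "set_integrable \<mu> ({0<..t} \<times> UNIV) gg"
    "set_integrable \<mu> ({0<..t} \<times> UNIV) yg"
    "real (x t) = real x0 + set_lebesgue_integral \<mu> ({0<..t} \<times> UNIV) hh"
    "y t = y0 + t - set_lebesgue_integral \<mu> ({0<..t} \<times> UNIV) yg"
    "real (N t) = set_lebesgue_integral \<mu> ({0<..t} \<times> UNIV) gg"
  using solves[OF assms] unfolding solves_at_def hh_def gg_def yg_def Let_def by auto

lemma initial_values: "x 0 = x0" "y 0 = y0" "N 0 = 0"
  using equations(4-6)[of 0] by (auto simp: set_lebesgue_integral_def)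

text \<open>At this stage no measurability of the rates is available. Both claims come from the
  integrability of \<open>gg\<close> that is part of \<open>solves_at\<close>, because
  \<open>gg\<close> is the indicator of \<open>E\<close> at positive times.\<close>

lemma E_strip:
  assumes "0 \<le> a"
  shows "E \<inter> ({a<..b} \<times> UNIV) \<in> sets \<mu>" "emeasure \<mu> (E \<inter> ({a<..b} \<times> UNIV)) < \<infinity>"
proof -
  have *: "E \<inter> ({0<..b} \<times> UNIV) \<in> sets \<mu> \<and> emeasure \<mu> (E \<inter> ({0<..b} \<times> UNIV)) < \<infinity>"
  proof (cases "0 \<le> b")
    case True
    have "indicator ({0<..b} \<times> UNIV) p *\<^sub>R gg p = indicator (E \<inter> ({0<..b} \<times> UNIV)) p" for p
      using gg_eq[of p] by (cases p) (auto simp: indicator_def)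
    then have "integrable \<mu> (indicat_real (E \<inter> ({0<..b} \<times> UNIV)))"
      using equations(2)[OF True] by (simp add: set_integrable_def)
    then have *: "E \<inter> ({0<..b} \<times> UNIV) \<inter> space \<mu> \<in> sets \<mu>" "emeasure \<mu> (E \<inter> ({0<..b} \<times> UNIV) \<inter> space \<mu>) < \<infinity>"
      by (simp_all add: integrable_indicator_iff)
    have "E \<inter> ({0<..b} \<times> UNIV) \<inter> space \<mu> = E \<inter> ({0<..b} \<times> UNIV)" by (auto simp: space_mu)
    with * show ?thesis by simp
  qed simp
  have eq: "E \<inter> ({a<..b} \<times> UNIV) = (E \<inter> ({0<..b} \<times> UNIV)) \<inter> ({a<..b} \<times> UNIV)" using assms by auto
  have "{a<..b} \<times> UNIV \<in> sets \<mu>" using assms by (intro strip_sets) auto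
  then show "E \<inter> ({a<..b} \<times> UNIV) \<in> sets \<mu>" using * unfolding eq by blast
  have "emeasure \<mu> (E \<inter> ({a<..b} \<times> UNIV)) \<le> emeasure \<mu> (E \<inter> ({0<..b} \<times> UNIV))"
    using * assms by (intro emeasure_mono) auto
  then show "emeasure \<mu> (E \<inter> ({a<..b} \<times> UNIV)) < \<infinity>" using * by (auto intro: le_less_trans)
qed

lemma strip_diff:
  fixes f :: "real \<times> real \<Rightarrow> real"
  assumes "0 \<le> a" "a \<le> b" "set_integrable \<mu> ({0<..b} \<times> UNIV) f"
  shows "set_integrable \<mu> ({a<..b} \<times> UNIV) f"
    "set_lebesgue_integral \<mu> ({0<..b} \<times> UNIV) f =
      set_lebesgue_integral \<mu> ({0<..a} \<times> UNIV) f + set_lebesgue_integral \<mu> ({a<..b} \<times> UNIV) f"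
proof -
  have i: "set_integrable \<mu> ({a<..b} \<times> UNIV) f" "set_integrable \<mu> ({0<..a} \<times> UNIV) f"
    using assms by (auto intro!: set_integrable_subset[OF assms(3)] strip_sets)
  then show "set_integrable \<mu> ({a<..b} \<times> UNIV) f" by simp
  have "{0<..b} \<times> (UNIV::real set) = {0<..a} \<times> UNIV \<union> {a<..b} \<times> UNIV" using assms by auto
  then show "set_lebesgue_integral \<mu> ({0<..b} \<times> UNIV) f =
      set_lebesgue_integral \<mu> ({0<..a} \<times> UNIV) f + set_lebesgue_integral \<mu> ({a<..b} \<times> UNIV) f"
    using i by (simp only:) (rule set_integral_Un, auto)
qed

lemma increments:
  assumes "0 \<le> a" "a \<le> b"
  shows "real (x b) = real (x a) + set_lebesgue_integral \<mu> ({a<..b} \<times> UNIV) hh"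
    "y b = y a + (b - a) - set_lebesgue_integral \<mu> ({a<..b} \<times> UNIV) yg"
    "real (N b) = real (N a) + set_lebesgue_integral \<mu> ({a<..b} \<times> UNIV) gg"
    "real (N b) = real (N a) + measure \<mu> (E \<inter> ({a<..b} \<times> UNIV))"
proof -
  have b: "0 \<le> b" using assms by simp
  show "real (x b) = real (x a) + set_lebesgue_integral \<mu> ({a<..b} \<times> UNIV) hh"
    using strip_diff(2)[OF assms equations(1)[OF b]] equations(4)[OF b] equations(4)[OF assms(1)] by simp
  show "y b = y a + (b - a) - set_lebesgue_integral \<mu> ({a<..b} \<times> UNIV) yg"
    using strip_diff(2)[OF assms equations(3)[OF b]] equations(5)[OF b] equations(5)[OF assms(1)] by simp
  show N: "real (N b) = real (N a) + set_lebesgue_integral \<mu> ({a<..b} \<times> UNIV) gg"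
    using strip_diff(2)[OF assms equations(2)[OF b]] equations(6)[OF b] equations(6)[OF assms(1)] by simp
  have "set_lebesgue_integral \<mu> ({a<..b} \<times> UNIV) gg = (LINT p|\<mu>. indicator (E \<inter> ({a<..b} \<times> UNIV)) p)"
    unfolding set_lebesgue_integral_def
    by (intro Bochner_Integration.integral_cong) (use assms gg_eq in \<open>auto simp: indicator_def\<close>)
  also have "\<dots> = measure \<mu> (E \<inter> ({a<..b} \<times> UNIV))"
    using E_strip(1)[OF assms(1), of b] by (simp add: Int_absorb2 sets.sets_into_space)
  finally show "real (N b) = real (N a) + measure \<mu> (E \<inter> ({a<..b} \<times> UNIV))" using N by simp
qed

lemma E_strip_null:
  assumes "0 \<le> a" "a \<le> b" "N b = N a"
  shows "E \<inter> ({a<..b} \<times> UNIV) \<in> null_sets \<mu>"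
  using increments(4)[OF assms(1,2)] assms(3) E_strip[OF assms(1), of b]
  by (intro null_setsI) (auto simp: emeasure_eq_ennreal_measure)

definition atom :: "real \<Rightarrow> real \<Rightarrow> bool" where
  "atom u v \<longleftrightarrow> emeasure \<mu> {(u, v)} = 1 \<and> emeasure \<mu> ({u} \<times> (- {v})) = 0"

lemma line_integral:
  fixes f :: "real \<times> real \<Rightarrow> real"
  assumes "0 < u" "set_integrable \<mu> ({u} \<times> UNIV) f"
  shows "atom u v \<Longrightarrow> set_lebesgue_integral \<mu> ({u} \<times> UNIV) f = f (u, v)"
    "emeasure \<mu> ({u} \<times> UNIV) = 0 \<Longrightarrow> set_lebesgue_integral \<mu> ({u} \<times> UNIV) f = 0"
proof -
  have m: "(\<lambda>p. indicator ({u} \<times> UNIV) p *\<^sub>R f p) \<in> borel_measurable \<mu>"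
    using assms(2) by (auto simp: set_integrable_def)
  show "set_lebesgue_integral \<mu> ({u} \<times> UNIV) f = f (u, v)" if "atom u v"
  proof -
    have s: "{u} \<times> (- {v}) \<in> sets \<mu>"
      using assms(1) by (intro sets_muI) (auto simp: borel_prod[symmetric])
    have "AE p in \<mu>. p \<notin> {u} \<times> (- {v})"
      using that s by (intro AE_not_in) (auto simp: atom_def null_sets_def)
    then have "AE p in \<mu>. indicator ({u} \<times> UNIV) p *\<^sub>R f p = indicator {(u, v)} p * f (u, v)"
      by eventually_elim (auto simp: indicator_def split: prod.splits)
    then have "set_lebesgue_integral \<mu> ({u} \<times> UNIV) f = (LINT p|\<mu>. indicator {(u, v)} p * f (u, v))"
      unfolding set_lebesgue_integral_def using m point_sets[of u v] assms(1)
      by (intro integral_cong_AE) auto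
    also have "\<dots> = f (u, v)"
      using point_sets[of u v] assms(1) that
      by (simp add: atom_def measure_def Int_absorb2 sets.sets_into_space)
    finally show ?thesis .
  qed
  show "set_lebesgue_integral \<mu> ({u} \<times> UNIV) f = 0" if "emeasure \<mu> ({u} \<times> UNIV) = 0"
  proof -
    have "AE p in \<mu>. p \<notin> {u} \<times> UNIV"
      using that strip_sets[of "{u}"] assms by (intro AE_not_in) (auto simp: null_sets_def)
    then have "AE p in \<mu>. indicator ({u} \<times> UNIV) p *\<^sub>R f p = 0"
      by eventually_elim (auto simp: indicator_def)
    then show ?thesis unfolding set_lebesgue_integral_def by (rule integral_eq_zero_AE)
  qed
qed

text \<open>Just before u the discrete paths are constant, so the count shows that \<open>E\<close>
  has no mass there. Integrals of functions that vanish off \<open>E\<close> then see only the line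
  over u.\<close>

lemma left_strip:
  assumes "0 < u"
  obtains a where "0 \<le> a" "a < u" "\<And>s. a < s \<Longrightarrow> s < u \<Longrightarrow> x s = xl u"
    "\<And>s. a < s \<Longrightarrow> s < u \<Longrightarrow> N s = Nl u"
    "\<And>s f. a < s \<Longrightarrow> s < u \<Longrightarrow> set_integrable \<mu> ({0<..u} \<times> UNIV) f \<Longrightarrow> (\<And>p. 0 < fst p \<Longrightarrow> p \<notin> E \<Longrightarrow> f p = (0::real)) \<Longrightarrow>
       set_lebesgue_integral \<mu> ({s<..u} \<times> UNIV) f = set_lebesgue_integral \<mu> ({u} \<times> UNIV) f"
proof -
  obtain b where b: "b < u" "\<And>s. b < s \<Longrightarrow> s < u \<Longrightarrow> x s = xl u \<and> N s = Nl u"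
    using eventually_conj[OF left_limits(3,4)[OF assms]] by (auto simp: eventually_at_left_field)
  define a where "a = max 0 b"
  show thesis
  proof
    show "0 \<le> a" "a < u" using b assms by (auto simp: a_def)
    show "x s = xl u" "N s = Nl u" if "a < s" "s < u" for s using b(2)[of s] that by (auto simp: a_def)
    then have Nc: "\<And>s. a < s \<Longrightarrow> s < u \<Longrightarrow> N s = Nl u" by blast
    fix s and f :: "real \<times> real \<Rightarrow> real"
    assume s: "a < s" "s < u" and f: "set_integrable \<mu> ({0<..u} \<times> UNIV) f" and off: "\<And>p. 0 < fst p \<Longrightarrow> p \<notin> E \<Longrightarrow> f p = 0"
    have s0: "0 \<le> s" using s by (simp add: a_def)
    define w where "w k = u - (u - s) / (real k + 1)" for k
    have w: "s \<le> w k" "w k < u" for k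
      using s mult_right_mono[of s u "real k"] by (auto simp: w_def field_simps)
    have "E \<inter> ({s<..w k} \<times> UNIV) \<in> null_sets \<mu>" for k
      using w[of k] s s0 Nc[of s] Nc[of "w k"] by (intro E_strip_null) auto
    then have "(\<Union>k. E \<inter> ({s<..w k} \<times> UNIV)) \<in> null_sets \<mu>" by blast
    then have "AE p in \<mu>. p \<notin> (\<Union>k. E \<inter> ({s<..w k} \<times> UNIV))" by (rule AE_not_in)
    then have "AE p in \<mu>. indicator ({s<..u} \<times> UNIV) p *\<^sub>R f p = indicator ({u} \<times> UNIV) p *\<^sub>R f p"
    proof eventually_elim
      case (elim p)
      obtain q v where p: "p = (q, v)" by (cases p)
      show ?case
      proof (cases "s < q \<and> q < u")
        case True
        have "\<exists>k. q \<le> w k"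
        proof -
          have "(\<lambda>k. u - (u - s) / (real k + 1)) \<longlonglongrightarrow> u - 0"
            by (intro tendsto_diff tendsto_const) (rule tendsto_divide_0[OF tendsto_const], 
               auto intro!: filterlim_at_top_imp_at_infinity filterlim_tendsto_add_at_top[of "\<lambda>_. 1" 1, simplified add.commute] filterlim_real_sequentially simp: add.commute)
          then have "\<forall>\<^sub>F k in sequentially. q < w k" using True unfolding w_def by (intro order_tendstoD(1)) auto
          then show ?thesis by (auto simp: eventually_sequentially intro: less_imp_le)
        qed
        then have "p \<notin> E" using elim True p by auto
        then show ?thesis using off[of p] True s0 p by auto
      next
        case False
        then show ?thesis using s by (cases "q = u") (auto simp: p indicator_def)
      qed
    qed
    moreover have "set_integrable \<mu> ({s<..u} \<times> UNIV) f" "set_integrable \<mu> ({u} \<times> UNIV) f"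
      using s s0 by (auto intro!: set_integrable_subset[OF f] strip_sets)
    ultimately show "set_lebesgue_integral \<mu> ({s<..u} \<times> UNIV) f = set_lebesgue_integral \<mu> ({u} \<times> UNIV) f"
      unfolding set_lebesgue_integral_def set_integrable_def
      by (intro integral_cong_AE) auto
  qed
qed

text \<open>The increment of each component at u is the integral over the line, that is, the value
  of its coefficient at the only atom. On \<open>E\<close> this moves the state by j - i, removes
  the whole age and adds 1 to the count; off \<open>E\<close>, or without an atom, nothing
  changes.\<close>

lemma jump_cases:
  assumes "0 < u"
  shows "(x u = xl u \<and> y u = yl u \<and> N u = Nl u) \<or>
    (\<exists>v j. j \<in> states - {xl u} \<and> v \<in> Lam prec lam lamt (xl u) j (yl u) (Nl u) \<and> atom u v \<and>
       x u = j \<and> y u = 0 \<and> N u = Suc (Nl u))"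
proof -
  obtain a where a: "0 \<le> a" "a < u" and xa: "\<And>s. a < s \<Longrightarrow> s < u \<Longrightarrow> x s = xl u"
    and Na: "\<And>s. a < s \<Longrightarrow> s < u \<Longrightarrow> N s = Nl u"
    and int: "\<And>s f. a < s \<Longrightarrow> s < u \<Longrightarrow> set_integrable \<mu> ({0<..u} \<times> UNIV) f \<Longrightarrow> (\<And>p. 0 < fst p \<Longrightarrow> p \<notin> E \<Longrightarrow> f p = (0::real)) \<Longrightarrow>
       set_lebesgue_integral \<mu> ({s<..u} \<times> UNIV) f = set_lebesgue_integral \<mu> ({u} \<times> UNIV) f"
    using left_strip[OF assms] by blast
  have u: "0 \<le> u" using assms by simp
  let ?I = "\<lambda>f. set_lebesgue_integral \<mu> ({u} \<times> UNIV) f"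
  obtain s where s: "a < s" "s < u" using a dense by blast
  have s0: "0 \<le> s" "s \<le> u" using s a by auto
  have X: "real (x u) = real (xl u) + ?I hh" and NN: "real (N u) = real (Nl u) + ?I gg"
    using increments(1,3)[OF s0] int[OF s equations(1)[OF u]] int[OF s equations(2)[OF u]] xa[OF s] Na[OF s] off_E by auto
  \<comment> \<open>The age is not constant before u but grows with slope 1, so its left limit is
    taken along all r close to u.\<close>
  have Ys: "y r = y u - (u - r) + ?I yg" if "a < r" "r < u" for r
    using increments(2)[of r u] int[OF that equations(3)[OF u]] that a off_E by auto
  have "((\<lambda>r. y u - (u - r) + ?I yg) \<longlongrightarrow> y u - (u - u) + ?I yg) (at_left u)"
    by (intro tendsto_intros)
  moreover have "\<forall>\<^sub>F r in at_left u. y u - (u - r) + ?I yg = y r"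
    using Ys a by (auto simp: eventually_at_left_field intro!: exI[of _ a])
  ultimately have "(y \<longlongrightarrow> y u + ?I yg) (at_left u)"
    by (simp cong: filterlim_cong)
  then have Y: "yl u = y u + ?I yg" by (rule left_lim_eqI)
  have si: "set_integrable \<mu> ({u} \<times> UNIV) hh" "set_integrable \<mu> ({u} \<times> UNIV) gg" "set_integrable \<mu> ({u} \<times> UNIV) yg"
    using equations(1-3)[OF u] assms by (auto elim!: set_integrable_subset intro!: strip_sets)
  consider "emeasure \<mu> ({u} \<times> UNIV) = 0" | v where "atom u v"
    using line[OF assms] unfolding atom_def by blast
  then show ?thesis
  proof cases
    case 1
    then show ?thesis using X Y NN line_integral(2)[OF assms si(1)] line_integral(2)[OF assms si(2)] line_integral(2)[OF assms si(3)] by simp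
  next
    case 2
    note I = line_integral(1)[OF assms si(1) 2] line_integral(1)[OF assms si(2) 2] line_integral(1)[OF assms si(3) 2]
    show ?thesis
    proof (cases "(u, v) \<in> E")
      case False
      then show ?thesis using X Y NN I off_E[of "(u, v)"] assms by simp
    next
      case True
      then obtain j where j: "j \<in> states - {xl u}" "v \<in> Lam prec lam lamt (xl u) j (yl u) (Nl u)"
        by (auto simp: E_def Lams_def)
      have "hh (u, v) = real j - real (xl u)" using h_Lam_eq left_limits(1,2)[OF assms] j by (auto simp: hh_def)
      then have "x u = j" using X I by simp
      moreover have "gg (u, v) = 1" using gg_eq[of "(u, v)"] True assms by simp
      then have "yg (u, v) = yl u" "N u = Suc (Nl u)" using NN I by (auto simp: gg_def yg_def)
      ultimately show ?thesis using j 2 Y I by auto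
    qed
  qed
qed

text \<open>A discrete path that agrees with its limits from both sides is locally constant, and the
  Bolzano bisection principle makes it constant on the interval. The count is then constant too, so
  \<open>E\<close> is null there and only the drift of the age remains.\<close>

lemma no_jump_constant:
  assumes "0 \<le> s" "s \<le> u" "\<And>w. s < w \<Longrightarrow> w \<le> u \<Longrightarrow> x w = xl w"
  shows "x u = x s" "N u = N s" "y u = y s + (u - s)" "E \<inter> ({s<..u} \<times> UNIV) \<in> null_sets \<mu>"
proof -
  have nj: "x w = xl w" "N w = Nl w" if "s < w" "w \<le> u" for w
    using jump_cases[of w] assms(3)[OF that] that assms(1) by auto
  \<comment> \<open>Bisection tests all short intervals around a point, also those that leave
    [s, u]; on these \<open>P\<close> is vacuous.\<close>
  define P where "P a b \<longleftrightarrow> (s \<le> a \<longrightarrow> b \<le> u \<longrightarrow> x a = x b \<and> N a = N b)" for a b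
  have "P s u" using assms(2)
  proof (induction rule: Bolzano)
    case (trans a b c)
    then show ?case by (auto simp: P_def)
  next
    case (local w)
    have w0: "0 \<le> w" using local assms by simp
    have "\<forall>\<^sub>F r in at_right w. x r = x w \<and> N r = N w"
      using tendsto_discrete_ev[OF rcll_path_right[OF rcll(1) w0]] tendsto_discrete_ev[OF rcll_path_right[OF rcll(3) w0]]
      by (rule eventually_conj)
    then obtain b where b: "b > w" "\<And>r. w < r \<Longrightarrow> r < b \<Longrightarrow> x r = x w \<and> N r = N w"
      by (auto simp: eventually_at_right_field)
    have "\<exists>a<w. \<forall>r. s \<le> r \<and> a < r \<and> r < w \<longrightarrow> x r = x w \<and> N r = N w"
    proof (cases "s < w")
      case True
      then have "\<forall>\<^sub>F r in at_left w. x r = x w \<and> N r = N w"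
        using left_limits(3,4)[of w] nj[OF True local(2)] assms(1) by (auto intro: eventually_conj)
      then show ?thesis by (auto simp: eventually_at_left_field)
    next
      case False
      then show ?thesis by (intro exI[of _ "w - 1"]) auto
    qed
    then obtain a where a: "a < w" "\<And>r. s \<le> r \<Longrightarrow> a < r \<Longrightarrow> r < w \<Longrightarrow> x r = x w \<and> N r = N w" by blast
    show ?case
    proof (intro exI[of _ "min (b - w) (w - a)"] conjI allI impI)
      fix p q assume pq: "p \<le> w \<and> w \<le> q \<and> q - p < min (b - w) (w - a)"
      show "P p q" unfolding P_def
      proof (intro impI)
        assume "s \<le> p" "q \<le> u"
        have "x p = x w \<and> N p = N w" using a(2)[of p] pq \<open>s \<le> p\<close> by (cases "p = w") auto
        moreover have "x q = x w \<and> N q = N w" using b(2)[of q] pq by (cases "q = w") auto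
        ultimately show "x p = x q \<and> N p = N q" by simp
      qed
    qed (use a b in auto)
  qed
  then show eq: "x u = x s" "N u = N s" by (auto simp: P_def)
  show null: "E \<inter> ({s<..u} \<times> UNIV) \<in> null_sets \<mu>" using E_strip_null[OF assms(1,2) eq(2)] .
  have "AE p in \<mu>. p \<notin> E \<inter> ({s<..u} \<times> UNIV)" using null by (rule AE_not_in)
  then have "AE p in \<mu>. indicator ({s<..u} \<times> UNIV) p *\<^sub>R yg p = 0"
    by eventually_elim (use off_E assms(1) in \<open>auto simp: indicator_def\<close>)
  then have "set_lebesgue_integral \<mu> ({s<..u} \<times> UNIV) yg = 0"
    unfolding set_lebesgue_integral_def by (rule integral_eq_zero_AE)
  then show "y u = y s + (u - s)" using increments(2)[OF assms(1,2)] by simp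
qed

text \<open>The fixed path is regarded as a process on a one-point space, so that the definition for
  processes applies.\<close>

definition T :: "nat \<Rightarrow> ereal" where
  "T n = jump_time (\<lambda>t _. x t) (\<lambda>_. y0) n ()"

text \<open>Right-continuity in a discrete space leaves every time a right neighbourhood free of
  jumps, so a first jump after s exists whenever there is any jump.\<close>

lemma next_jump:
  assumes "0 \<le> s"
  shows "(Inf {ereal t |t. s < t \<and> x t \<noteq> xl t} = \<infinity> \<and> (\<forall>t>s. x t = xl t)) \<or>
    (\<exists>t>s. Inf {ereal t |t. s < t \<and> x t \<noteq> xl t} = ereal t \<and> x t \<noteq> xl t \<and> (\<forall>w. s < w \<and> w < t \<longrightarrow> x w = xl w))"
proof -
  have "\<exists>e>u. \<forall>w. u < w \<and> w < e \<longrightarrow> \<not> (x w \<noteq> xl w)" if "s \<le> u" for u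
  proof -
    have u: "0 \<le> u" using that assms by simp
    obtain b where b: "b > u" "\<And>r. u < r \<Longrightarrow> r < b \<Longrightarrow> x r = x u"
      using tendsto_discrete_ev[OF rcll_path_right[OF rcll(1) u]] by (auto simp: eventually_at_right_field)
    have "x w = xl w" if w: "u < w" "w < b" for w
    proof -
      have "\<forall>\<^sub>F r in at_left w. x r = x u" using b(2) w by (auto simp: eventually_at_left_field intro!: exI[of _ u])
      then have "(x \<longlongrightarrow> x u) (at_left w)" by (rule tendsto_eventually)
      then have "xl w = x u" by (rule left_lim_eqI)
      then show ?thesis using b(2)[OF w] by simp
    qed
    then show ?thesis using b(1) by blast
  qed
  from Inf_ereal_jumps[of s "\<lambda>t. x t \<noteq> xl t", OF this] show ?thesis by simp
qed

lemma T_Suc: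
  assumes "T n = ereal t"
  shows "T (Suc n) = Inf {ereal r |r. max 0 t < r \<and> x r \<noteq> xl r}"
  using assms unfolding T_def by (auto intro!: arg_cong[where f=Inf])

text \<open>For n = 0 the time t is -y0 and may be negative, so the sojourn is followed only from s
  = max 0 t on; w - t is its age in all cases. The left limits are included because the coefficients
  are evaluated at them.\<close>

lemma sojourn_values:
  assumes "T n = ereal t" "s = max 0 t" "N s = n" "y s = s - t" "s < w" "ereal w < T (Suc n)"
  shows "x w = x s" "N w = n" "y w = w - t" "xl w = x s" "Nl w = n" "yl w = w - t"
    "E \<inter> ({s<..w} \<times> UNIV) \<in> null_sets \<mu>"
proof -
  have s: "0 \<le> s" using assms by simp
  have nj: "x r = xl r" if "s < r" "r \<le> w" for r
    using next_jump[OF s] T_Suc[OF assms(1)] assms(2,6) that by (auto simp: not_less)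
  note c = no_jump_constant[OF s less_imp_le[OF assms(5)] nj]
  then show 1: "x w = x s" "N w = n" "y w = w - t" "E \<inter> ({s<..w} \<times> UNIV) \<in> null_sets \<mu>"
    using assms by auto
  have "x w = xl w \<and> y w = yl w \<and> N w = Nl w" using jump_cases[of w] nj[of w] assms(5) s by auto
  then show "xl w = x s" "Nl w = n" "yl w = w - t" using 1 by auto
qed

lemma jump_values:
  assumes "T n = ereal t" "s = max 0 t" "N s = n" "y s = s - t" "T (Suc n) = ereal t'"
  shows "s < t'" "\<exists>v j. j \<in> states - {x s} \<and> v \<in> Lam prec lam lamt (x s) j (t' - t) n \<and> atom t' v \<and>
       x t' = j \<and> y t' = 0 \<and> N t' = Suc n"
proof -
  have s: "0 \<le> s" using assms by simp
  have t': "s < t'" "x t' \<noteq> xl t'"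
    using next_jump[OF s] T_Suc[OF assms(1)] assms(2,5) by auto
  then show "s < t'" by simp
  have ev: "\<forall>\<^sub>F w in at_left t'. s < w \<and> w < t'"
    using t' by (auto simp: eventually_at_left_field intro!: exI[of _ s])
  have vals: "x w = x s \<and> N w = n \<and> y w = w - t" if "s < w \<and> w < t'" for w
    using sojourn_values(1-3)[OF assms(1-4), of w] that assms(5) by auto
  have "xl t' = x s"
    by (intro left_lim_eqI tendsto_eventually eventually_mono[OF ev]) (use vals in auto)
  moreover have "Nl t' = n"
    by (intro left_lim_eqI tendsto_eventually eventually_mono[OF ev]) (use vals in auto)
  moreover have "yl t' = t' - t"
  proof (rule left_lim_eqI)
    have "((\<lambda>w. w - t) \<longlongrightarrow> t' - t) (at_left t')" by (intro tendsto_intros)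
    then show "(y \<longlongrightarrow> t' - t) (at_left t')"
      by (rule Lim_transform_eventually) (use ev vals in \<open>auto elim: eventually_mono\<close>)
  qed
  ultimately show "\<exists>v j. j \<in> states - {x s} \<and> v \<in> Lam prec lam lamt (x s) j (t' - t) n \<and> atom t' v \<and>
       x t' = j \<and> y t' = 0 \<and> N t' = Suc n"
    using jump_cases[of t'] t' s by auto
qed

text \<open>A hit interval always has a target different from the current state, so the count
  increases exactly at the jumps of x. This is why n can stand for the count throughout the n-th
  sojourn.\<close>

lemma at_jump_time:
  "T n = \<infinity> \<or> (\<exists>t. T n = ereal t \<and> (n = 0 \<and> t = - y0 \<or> 0 < n \<and> 0 < t) \<and> N (max 0 t) = n \<and> y (max 0 t) = max 0 t - t)"
proof (induction n)
  case 0
  have "T 0 = ereal (- y0)" by (simp add: T_def)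
  then show ?case using initial_values y0_nonneg by simp
next
  case (Suc n)
  show ?case
  proof (cases "T n = \<infinity>")
    case True
    then have "T (Suc n) = Inf {}" unfolding T_def by (auto intro!: arg_cong[where f=Inf])
    then show ?thesis by (simp add: top_ereal_def)
  next
    case False
    then obtain t where t: "T n = ereal t" "N (max 0 t) = n" "y (max 0 t) = max 0 t - t" using Suc by blast
    have s: "0 \<le> max 0 t" by simp
    show ?thesis
    proof (cases "T (Suc n) = \<infinity>")
      case False
      then obtain t' where t': "T (Suc n) = ereal t'"
        using next_jump[OF s] T_Suc[OF t(1)] by auto
      then show ?thesis using jump_values[OF t(1) refl t(2,3) t'] by force
    qed simp
  qed
qed

text \<open>This is all that the probabilistic part needs of a path: with state, start and count
  frozen at the n-th jump, the measure has no mass on the intervals before the next jump and an atom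
  in one of them at that jump. The left limits of the solution have disappeared.\<close>

lemma sojourn:
  assumes "T n = ereal t" "s = max 0 t"
  shows "{(u, v). s < u \<and> ereal u < T (Suc n) \<and> v \<in> Lams (x s) (u - t) n} \<in> null_sets \<mu>"
    and "T (Suc n) = ereal t' \<Longrightarrow> s < t' \<and> (\<exists>v. x t' \<in> states - {x s} \<and>
       v \<in> Lam prec lam lamt (x s) (x t') (t' - t) n \<and> atom t' v)"
    and "T (Suc n) = \<infinity> \<or> (\<exists>t'>s. T (Suc n) = ereal t')"
proof -
  have s: "0 \<le> s" and v: "N s = n" "y s = s - t" using at_jump_time[of n] assms by auto
  note jv = jump_values[OF assms v]
  note sv = sojourn_values[OF assms v]
  show "T (Suc n) = \<infinity> \<or> (\<exists>t'>s. T (Suc n) = ereal t')"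
    using next_jump[OF s] T_Suc[OF assms(1)] assms(2) by auto
  show "s < t' \<and> (\<exists>v. x t' \<in> states - {x s} \<and> v \<in> Lam prec lam lamt (x s) (x t') (t' - t) n \<and> atom t' v)" if "T (Suc n) = ereal t'"
    using jv[OF that] by auto
  \<comment> \<open>Each strip up to a rational time before the next jump is null; countably many of
    them exhaust the open sojourn, which may be infinite.\<close>
  have "{(u, v). s < u \<and> ereal u < T (Suc n) \<and> v \<in> Lams (x s) (u - t) n} =
    (\<Union>w\<in>{w\<in>\<rat>. s < w \<and> ereal w < T (Suc n)}. E \<inter> ({s<..w} \<times> UNIV))" (is "?L = ?R")
  proof (rule Set.set_eqI, rule iffI)
    fix p assume "p \<in> ?L"
    then obtain u v where p: "p = (u, v)" "s < u" "ereal u < T (Suc n)" "v \<in> Lams (x s) (u - t) n" by auto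
    then have "p \<in> E" using sv(4-6)[of u] s by (auto simp: E_def)
    obtain r where r: "ereal u < ereal r" "ereal r < T (Suc n)" using p(3) ereal_dense2 by blast
    then obtain w where w: "w \<in> \<rat>" "u < w" "w < r" using Rats_dense_in_real[of u r] by auto
    then have "ereal w < T (Suc n)" using r by (meson ereal_less_eq(3) less_ereal.simps(1) less_trans)
    then show "p \<in> ?R" using w \<open>p \<in> E\<close> p by auto
  next
    fix p assume "p \<in> ?R"
    then obtain w where w: "s < w" "ereal w < T (Suc n)" "p \<in> E" "s < fst p" "fst p \<le> w" by auto
    then have "ereal (fst p) < T (Suc n)" by (meson ereal_less_eq(3) le_less_trans)
    then show "p \<in> ?L" using w sv(4-6)[of "fst p"] by (auto simp: E_def)
  qed
  also have "\<dots> \<in> null_sets \<mu>"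
    using sv(7) by (intro null_sets_UN') (auto intro: countable_subset[OF _ countable_rat])
  finally show "?L \<in> null_sets \<mu>" .
qed

end

section \<open>Atoms and independence of the Poisson random measure\<close>

lemma sets_half_plane_iff: "A \<in> sets half_plane \<longleftrightarrow> A \<in> sets borel \<and> A \<subseteq> {0..} \<times> UNIV"
proof -
  have "({0..} \<times> UNIV :: (real \<times> real) set) \<in> sets borel"
    by (intro borel_closed closed_Times) auto
  then show ?thesis unfolding half_plane_def by (subst sets_restrict_space_iff) auto
qed

lemma emeasure_half_plane: "A \<in> sets half_plane \<Longrightarrow> emeasure half_plane A = emeasure lborel A"
proof -
  have "({0..} \<times> UNIV :: (real \<times> real) set) \<in> sets borel"
    by (intro borel_closed closed_Times) auto
  then show "A \<in> sets half_plane \<Longrightarrow> emeasure half_plane A = emeasure lborel A"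
    unfolding sets_half_plane_iff unfolding half_plane_def by (intro emeasure_restrict_space) auto
qed

lemma Times_sets_borel [intro]:
  fixes A B :: "real set"
  shows "A \<in> sets borel \<Longrightarrow> B \<in> sets borel \<Longrightarrow> A \<times> B \<in> sets borel"
  by (auto simp: borel_prod[symmetric])

lemma emeasure_lborel_Times:
  fixes A B :: "real set"
  shows "A \<in> sets borel \<Longrightarrow> B \<in> sets borel \<Longrightarrow> emeasure lborel (A \<times> B) = emeasure lborel A * emeasure lborel B"
  unfolding lborel_prod[symmetric] by (rule lborel.emeasure_pair_measure_Times) auto

lemma emeasure_half_plane_finite: "A \<in> sets half_plane \<Longrightarrow> bounded A \<Longrightarrow> emeasure half_plane A < \<infinity>"
  by (simp add: emeasure_half_plane emeasure_bounded_finite[unfolded infinity_ennreal_def])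

section \<open>Poisson masses: integer values, first moments, atoms on lines\<close>

locale poisson_half_plane = prob_space M for M :: "'a measure" +
  fixes \<phi> :: "'a \<Rightarrow> (real \<times> real) measure"
  assumes poisson: "poisson_random_measure M half_plane \<phi>"
begin

lemma sets_phi: "\<omega> \<in> space M \<Longrightarrow> sets (\<phi> \<omega>) = sets half_plane"
  using poisson by (simp add: poisson_random_measure_def)

lemma phi_measurable: "A \<in> sets half_plane \<Longrightarrow> (\<lambda>\<omega>. emeasure (\<phi> \<omega>) A) \<in> borel_measurable M"
  using poisson by (simp add: poisson_random_measure_def)

lemma phi_distr:
  "A \<in> sets half_plane \<Longrightarrow> emeasure half_plane A < \<infinity> \<Longrightarrow>
    \<P>(\<omega> in M. emeasure (\<phi> \<omega>) A = of_nat k) = measure half_plane A ^ k / fact k * exp (- measure half_plane A)"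
  using poisson by (simp add: poisson_random_measure_def)

lemma phi_indep: "A ` {..<m} \<subseteq> sets half_plane \<Longrightarrow> disjoint_family_on A {..<m} \<Longrightarrow>
    indep_vars (\<lambda>_. borel) (\<lambda>k \<omega>. emeasure (\<phi> \<omega>) (A k)) {..<m::nat}"
  using poisson by (simp add: poisson_random_measure_def)

lemma exp_sums: "(\<lambda>k. p ^ k / fact k * exp (- p)) sums 1" for p :: real
proof -
  have "(\<lambda>k. p ^ k / fact k) sums exp p" using exp_converges[of p] by (simp add: divide_inverse mult.commute)
  from sums_mult2[OF this, of "exp (- p)"] show ?thesis by (simp add: exp_add[symmetric])
qed

text \<open>The Poisson weights already add up to 1, which leaves no probability for other
  values.\<close>

lemma phi_nat:
  assumes "A \<in> sets half_plane" "emeasure half_plane A < \<infinity>"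
  shows "AE \<omega> in M. \<exists>k::nat. emeasure (\<phi> \<omega>) A = of_nat k"
proof -
  let ?E = "\<lambda>k::nat. {\<omega> \<in> space M. emeasure (\<phi> \<omega>) A = of_nat k}"
  have [measurable]: "(\<lambda>\<omega>. emeasure (\<phi> \<omega>) A) \<in> borel_measurable M" using phi_measurable[OF assms(1)] .
  have "(\<lambda>k. prob (?E k)) sums prob (\<Union>k. ?E k)"
    by (rule finite_measure_UNION) (auto simp: disjoint_family_on_def)
  moreover have "(\<lambda>k. prob (?E k)) sums 1"
    using exp_sums[of "measure half_plane A"] by (simp add: phi_distr[OF assms])
  ultimately have "prob (\<Union>k. ?E k) = 1" by (rule sums_unique2)
  then have "AE \<omega> in M. \<omega> \<in> (\<Union>k. ?E k)" by (rule AE_prob_1)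
  then show ?thesis by eventually_elim auto
qed

lemma phi_finite:
  assumes "A \<in> sets half_plane" "emeasure half_plane A < \<infinity>"
  shows "AE \<omega> in M. emeasure (\<phi> \<omega>) A < \<infinity>"
  using phi_nat[OF assms] by eventually_elim (auto simp: of_nat_less_top)

text \<open>Independence factors each summand of the expectation over the values k, and the mean of
  the Poisson weights is the intensity. Only the events that the mass equals k are used, so
  \<open>Z\<close> may come from any source.\<close>

lemma nn_integral_indep_phi:
  assumes C: "C \<in> sets half_plane" "emeasure half_plane C < \<infinity>" and Z: "Z \<in> events"
    and ind: "\<And>k::nat. prob (Z \<inter> {\<omega> \<in> space M. emeasure (\<phi> \<omega>) C = of_nat k}) =
       prob Z * prob {\<omega> \<in> space M. emeasure (\<phi> \<omega>) C = of_nat k}"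
  shows "(\<integral>\<^sup>+\<omega>. indicator Z \<omega> * emeasure (\<phi> \<omega>) C \<partial>M) = emeasure M Z * emeasure half_plane C"
proof -
  let ?E = "\<lambda>k::nat. {\<omega> \<in> space M. emeasure (\<phi> \<omega>) C = of_nat k}"
  define p where "p = measure half_plane C"
  have [measurable]: "(\<lambda>\<omega>. emeasure (\<phi> \<omega>) C) \<in> borel_measurable M" "Z \<in> events" using phi_measurable[OF C(1)] Z by auto
  have "(\<integral>\<^sup>+\<omega>. indicator Z \<omega> * emeasure (\<phi> \<omega>) C \<partial>M) = (\<integral>\<^sup>+\<omega>. (\<Sum>k. of_nat k * indicator (Z \<inter> ?E k) \<omega>) \<partial>M)"
  proof (rule nn_integral_cong_AE)
    show "AE \<omega> in M. indicator Z \<omega> * emeasure (\<phi> \<omega>) C = (\<Sum>k. of_nat k * indicator (Z \<inter> ?E k) \<omega>)"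
      using phi_nat[OF C] AE_space
    proof eventually_elim
      case (elim \<omega>)
      then obtain m :: nat where m: "emeasure (\<phi> \<omega>) C = of_nat m" by blast
      have "(\<Sum>k. of_nat k * indicator (Z \<inter> ?E k) \<omega>) = (\<Sum>k\<in>{m}. of_nat k * indicator (Z \<inter> ?E k) \<omega> :: ennreal)"
        by (rule suminf_finite) (use m elim in auto)
      then show ?case using m elim by (auto simp: indicator_def)
    qed
  qed
  also have "\<dots> = (\<Sum>k. \<integral>\<^sup>+\<omega>. of_nat k * indicator (Z \<inter> ?E k) \<omega> \<partial>M)"
    by (rule nn_integral_suminf) measurable
  also have "\<dots> = (\<Sum>k. ennreal (prob Z * (real k * (p ^ k / fact k * exp (- p)))))"
  proof (intro suminf_cong)
    fix k
    have "(\<integral>\<^sup>+\<omega>. of_nat k * indicator (Z \<inter> ?E k) \<omega> \<partial>M) = of_nat k * emeasure M (Z \<inter> ?E k)"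
      by (rule nn_integral_cmult_indicator) measurable
    also have "\<dots> = ennreal (real k) * ennreal (prob Z * (p ^ k / fact k * exp (- p)))"
      using ind[of k] unfolding phi_distr[OF C] emeasure_eq_measure p_def by (simp add: ennreal_of_nat_eq_real_of_nat)
    also have "\<dots> = ennreal (prob Z * (real k * (p ^ k / fact k * exp (- p))))"
      by (subst ennreal_mult'[symmetric]) (auto simp: mult_ac)
    finally show "(\<integral>\<^sup>+\<omega>. of_nat k * indicator (Z \<inter> ?E k) \<omega> \<partial>M) = ennreal (prob Z * (real k * (p ^ k / fact k * exp (- p))))" .
  qed
  also have "\<dots> = ennreal (prob Z * p)"
  proof (rule suminf_ennreal_eq)
    have "(\<lambda>k. p * (p ^ k / fact k * exp (- p))) sums (p * 1)" by (intro sums_mult exp_sums)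
    \<comment> \<open>The weights satisfy k p_k = p p_(k-1); the term k = 0 vanishes, so the mean
      becomes p times the total weight.\<close>
    moreover have "real (Suc k) * (p ^ Suc k / fact (Suc k) * exp (- p)) = p * (p ^ k / fact k * exp (- p))" for k
    proof -
      have "real (Suc k) / fact (Suc k) = 1 / fact k" by (simp add: field_simps del: of_nat_Suc)
      then have "real (Suc k) * (p ^ Suc k / fact (Suc k) * exp (- p)) = (1 / fact k) * (p ^ Suc k * exp (- p))"
        by (metis (no_types, lifting) mult.assoc mult.commute times_divide_eq_left)
      then show ?thesis by simp
    qed
    ultimately have "(\<lambda>k. real (Suc k) * (p ^ Suc k / fact (Suc k) * exp (- p))) sums p" by (simp only: mult_1_right)
    then have "(\<lambda>k. real k * (p ^ k / fact k * exp (- p))) sums p" by (subst (asm) sums_Suc_iff) simp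
    then show "(\<lambda>k. prob Z * (real k * (p ^ k / fact k * exp (- p)))) sums (prob Z * p)" by (rule sums_mult)
  qed (simp add: p_def)
  also have "\<dots> = emeasure M Z * emeasure half_plane C"
    using C(2) by (simp add: emeasure_eq_measure p_def ennreal_mult' emeasure_eq_ennreal_measure)
  finally show ?thesis .
qed

text \<open>Since exp(-p) is at least 1 - p, the probability is at most 1 - (1 + p)(1 - p). The
  quadratic order is what beats the number of columns in the next lemma.\<close>

lemma prob_phi_multiple:
  assumes "A \<in> sets half_plane" "emeasure half_plane A < \<infinity>"
  shows "prob {\<omega> \<in> space M. emeasure (\<phi> \<omega>) A \<notin> {0, 1}} \<le> (measure half_plane A)\<^sup>2"
proof -
  define p where "p = measure half_plane A"
  have p: "0 \<le> p" by (simp add: p_def)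
  have [measurable]: "(\<lambda>\<omega>. emeasure (\<phi> \<omega>) A) \<in> borel_measurable M" using phi_measurable[OF assms(1)] .
  let ?E = "\<lambda>k::nat. {\<omega> \<in> space M. emeasure (\<phi> \<omega>) A = of_nat k}"
  have "prob (?E 0 \<union> ?E 1) = prob (?E 0) + prob (?E 1)"
    by (rule finite_measure_Union) auto
  also have "\<dots> = exp (- p) + p * exp (- p)"
    using phi_distr[OF assms, of 0] phi_distr[OF assms, of 1] by (simp add: p_def)
  finally have E: "prob (?E 0 \<union> ?E 1) = (1 + p) * exp (- p)" by (simp add: algebra_simps)
  have "{\<omega> \<in> space M. emeasure (\<phi> \<omega>) A \<notin> {0, 1}} = space M - (?E 0 \<union> ?E 1)" by auto
  then have "prob {\<omega> \<in> space M. emeasure (\<phi> \<omega>) A \<notin> {0, 1}} = 1 - prob (?E 0 \<union> ?E 1)"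
    by (simp only:, intro prob_compl) measurable
  also have "\<dots> = 1 - (1 + p) * exp (- p)" using E by simp
  also have "\<dots> \<le> 1 - (1 + p) * (1 - p)"
    using p exp_ge_add_one_self[of "- p"] by (intro diff_left_mono mult_left_mono) auto
  also have "\<dots> = p\<^sup>2" by (simp add: power2_eq_square algebra_simps)
  finally show ?thesis by (simp add: p_def)
qed

text \<open>The probability that one of the \<open>2\<^sup>r\<close> columns of width \<open>b / 2\<^sup>r\<close> contains several atoms is of order
  \<open>2\<^sup>-\<^sup>r\<close>. This controls all the uncountably many vertical lines at once.\<close>

lemma line_strip:
  fixes b :: real and S :: "real set"
  assumes b: "0 < b" and S: "S \<in> sets borel" "bounded S"
  shows "AE \<omega> in M. \<forall>u. 0 < u \<and> u \<le> b \<longrightarrow> emeasure (\<phi> \<omega>) ({u} \<times> S) \<in> {0, 1}"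
proof -
  define d where "d r = b / 2 ^ r" for r :: nat
  have dlim: "d \<longlonglongrightarrow> 0"
    unfolding d_def[abs_def] by (rule LIMSEQ_divide_realpow_zero) simp
  define C where "C r l = {real l * d r<..real (Suc l) * d r} \<times> S" for r l :: nat
  define L where "L = measure lborel S"
  have b2: "0 < d r" "2 ^ r * d r = b" for r using b by (auto simp: d_def)
  have Cs: "C r l \<in> sets half_plane" for r l
    proof -
    have "0 \<le> real l * d r" using b2(1)[of r] by simp
    then show ?thesis using S(1) unfolding sets_half_plane_iff C_def by auto
  qed
  have Cf: "emeasure half_plane (C r l) < \<infinity>" for r l
    using Cs by (rule emeasure_half_plane_finite) (use S(2) in \<open>auto simp: C_def intro!: bounded_Times\<close>)
  have Sf: "emeasure lborel S < \<infinity>" using S(2) by (rule emeasure_bounded_finite)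
  have Cm: "measure half_plane (C r l) = d r * L" for r l
  proof -
    have "emeasure half_plane (C r l) = ennreal (real (Suc l) * d r - real l * d r) * emeasure lborel S"
      unfolding emeasure_half_plane[OF Cs] unfolding C_def using S(1) b2(1)[of r]
      by (subst emeasure_lborel_Times, simp, simp, subst emeasure_lborel_Ioc) (auto simp: mult_right_mono)
    also have "real (Suc l) * d r - real l * d r = d r" by (simp add: algebra_simps)
    finally have "emeasure half_plane (C r l) = ennreal (d r * L)"
      using Sf b2(1)[of r] by (subst ennreal_mult) (auto simp: L_def emeasure_eq_ennreal_measure)
    moreover have "0 \<le> d r * L" using b2(1)[of r] by (simp add: L_def)
    ultimately show ?thesis by (simp add: measure_def)
  qed
  have [measurable]: "(\<lambda>\<omega>. emeasure (\<phi> \<omega>) (C r l)) \<in> borel_measurable M" for r l using phi_measurable[OF Cs] .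
  define bad where "bad r = {\<omega> \<in> space M. \<exists>l<2^r. emeasure (\<phi> \<omega>) (C r l) \<notin> {0, 1}}" for r :: nat
  have [measurable]: "bad r \<in> events" for r unfolding bad_def by measurable
  have badp: "prob (bad r) \<le> (b * L)\<^sup>2 / 2 ^ r" for r
  proof -
    have "bad r = (\<Union>l<2^r. {\<omega> \<in> space M. emeasure (\<phi> \<omega>) (C r l) \<notin> {0, 1}})" by (auto simp: bad_def)
    also have "prob \<dots> \<le> (\<Sum>l<2^r. prob {\<omega> \<in> space M. emeasure (\<phi> \<omega>) (C r l) \<notin> {0, 1}})"
      by (rule finite_measure_subadditive_finite) auto
    also have "\<dots> \<le> (\<Sum>l<(2::nat)^r. (d r * L)\<^sup>2)"
      using prob_phi_multiple[OF Cs Cf] by (intro sum_mono) (simp add: Cm)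
    also have "\<dots> = (b * L)\<^sup>2 / 2 ^ r" by (simp add: power2_eq_square field_simps d_def)
    finally show ?thesis .
  qed
  \<comment> \<open>Infinitely many good levels r suffice: along them the column masses lie in the
    closed set {0, 1}, and so does their limit.\<close>
  have "AE \<omega> in M. \<forall>R. \<exists>r\<ge>R. \<omega> \<notin> bad r"
    unfolding AE_all_countable
  proof
    fix R
    have "prob (\<Inter>r\<in>{R..}. bad r) \<le> 0"
    proof (rule LIMSEQ_le_const)
      show "(\<lambda>r. (b * L)\<^sup>2 / 2 ^ r) \<longlonglongrightarrow> 0" by (rule LIMSEQ_divide_realpow_zero) simp
      have "prob (\<Inter>r\<in>{R..}. bad r) \<le> (b * L)\<^sup>2 / 2 ^ r" if "r \<ge> R" for r
        using that by (intro order_trans[OF finite_measure_mono badp]) auto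
      then show "\<exists>N. \<forall>n\<ge>N. prob (\<Inter>r\<in>{R..}. bad r) \<le> (b * L)\<^sup>2 / 2 ^ n" by blast
    qed
    then have "prob (\<Inter>r\<in>{R..}. bad r) = 0" using measure_nonneg[of M] by (meson order_antisym)
    moreover have "(\<Inter>r\<in>{R..}. bad r) \<in> events" by (intro sets.countable_INT') auto
    ultimately have "AE \<omega> in M. \<omega> \<notin> (\<Inter>r\<in>{R..}. bad r)" by (intro AE_not_in) (auto simp: emeasure_eq_measure null_sets_def)
    then show "AE \<omega> in M. \<exists>r\<ge>R. \<omega> \<notin> bad r" by eventually_elim auto
  qed
  moreover have "AE \<omega> in M. emeasure (\<phi> \<omega>) (C 0 0) < \<infinity>" by (intro phi_finite Cs Cf)
  ultimately show ?thesis using AE_space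
  proof eventually_elim
    case (elim \<omega>)
    note sets = sets_phi[OF elim(3)]
    show ?case
    proof (intro allI impI)
      fix u assume u: "0 < u \<and> u \<le> b"
      \<comment> \<open>These sets contain the column of u at level r and shrink to the line over u,
        so the column masses are squeezed towards the mass of the line.\<close>
      define W where "W r = ({u - d r<..<u + d r} \<inter> {0<..b}) \<times> S" for r :: nat
      have Ws: "W r \<in> sets (\<phi> \<omega>)" for r using S(1) by (auto simp: sets sets_half_plane_iff W_def)
      have us: "{u} \<times> S \<in> sets (\<phi> \<omega>)" using S(1) u by (auto simp: sets sets_half_plane_iff)
      have W: "(\<Inter>r. W r) = {u} \<times> S"
      proof -
        have "w = u" if "\<And>r. u - d r < w \<and> w < u + d r" for w
        proof -
          have "\<bar>w - u\<bar> \<le> d r" for r using that[of r] by (auto simp: abs_le_iff)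
          then have "\<bar>w - u\<bar> \<le> 0" using LIMSEQ_le_const[OF dlim] by blast
          then show ?thesis by simp
        qed
        then show ?thesis using u b2(1) by (auto simp: W_def)
      qed
      have "decseq W"
      proof (rule decseq_SucI)
        fix r have "d (Suc r) \<le> d r" using b by (auto simp: d_def field_simps)
        then show "W (Suc r) \<subseteq> W r" unfolding W_def by auto
      qed
      moreover have "emeasure (\<phi> \<omega>) (W r) \<noteq> \<infinity>" for r
      proof -
        have "emeasure (\<phi> \<omega>) (W r) \<le> emeasure (\<phi> \<omega>) (C 0 0)"
          using Cs[of 0 0] by (intro emeasure_mono) (auto simp: sets C_def W_def d_def)
        then show ?thesis using elim(2) by (auto simp: top_unique)
      qed
      ultimately have lim2: "(\<lambda>r. emeasure (\<phi> \<omega>) (W r)) \<longlonglongrightarrow> emeasure (\<phi> \<omega>) ({u} \<times> S)"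
        using Ws unfolding W[symmetric] by (intro Lim_emeasure_decseq) auto
      \<comment> \<open>The index of the column that contains u. The columns are open on the left
        and closed on the right, hence ceiling minus 1.\<close>
      define l where "l r = nat (\<lceil>u / d r\<rceil> - 1)" for r :: nat
      have l: "real (l r) * d r < u" "u \<le> real (Suc (l r)) * d r" "l r < 2 ^ r" for r
      proof -
        have pos: "0 < u / d r" using u b2(1)[of r] by simp
        then have c: "1 \<le> \<lceil>u / d r\<rceil>" by (simp add: one_le_ceiling)
        then have lr: "real (l r) = of_int \<lceil>u / d r\<rceil> - 1" by (simp add: l_def)
        then have "real (l r) < u / d r" "u / d r \<le> real (Suc (l r))" by linarith+
        then show "real (l r) * d r < u" "u \<le> real (Suc (l r)) * d r"
          using b2(1)[of r] by (auto simp: field_simps)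
        have "u / d r \<le> 2 ^ r" using u b2[of r] by (simp add: divide_le_eq)
        then have "real (l r) < 2 ^ r" using \<open>real (l r) < u / d r\<close> by linarith
        then show "l r < 2 ^ r" by (metis of_nat_less_iff of_nat_power of_nat_numeral)
      qed
      have "(\<lambda>r. emeasure (\<phi> \<omega>) (C r (l r))) \<longlonglongrightarrow> emeasure (\<phi> \<omega>) ({u} \<times> S)"
      proof (rule tendsto_sandwich[OF _ _ tendsto_const lim2])
        show "\<forall>\<^sub>F r in sequentially. emeasure (\<phi> \<omega>) ({u} \<times> S) \<le> emeasure (\<phi> \<omega>) (C r (l r))"
          using l Cs by (intro always_eventually allI emeasure_mono) (auto simp: C_def sets)
        have "C r (l r) \<subseteq> W r" for r
        proof -
          have "real (Suc (l r)) * d r = real (l r) * d r + d r" by (simp add: algebra_simps)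
          moreover have "real (Suc (l r)) * d r \<le> 2 ^ r * d r"
            proof (intro mult_right_mono)
              have "real (Suc (l r)) \<le> real (2 ^ r)" using l(3)[of r] by (intro of_nat_mono) simp
              then show "real (Suc (l r)) \<le> 2 ^ r" by simp
            qed (use b2(1)[of r] in simp)
          moreover have nn: "0 < a" if "real (l r) * d r < a" for a
            using that b2(1)[of r] by (intro le_less_trans[OF _ that]) simp
          ultimately show ?thesis using l(1,2)[of r] b2(2)[of r] unfolding C_def W_def by (auto intro: nn)
        qed
        then show "\<forall>\<^sub>F r in sequentially. emeasure (\<phi> \<omega>) (C r (l r)) \<le> emeasure (\<phi> \<omega>) (W r)"
          using Ws by (intro always_eventually allI emeasure_mono) auto
      qed
      moreover have "\<exists>r\<ge>R. emeasure (\<phi> \<omega>) (C r (l r)) \<in> {0, 1}" for R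
      proof -
        obtain r where "r \<ge> R" "\<omega> \<notin> bad r" using elim(1) by blast
        then show ?thesis using l(3)[of r] elim(3) unfolding bad_def by blast
      qed
      ultimately show "emeasure (\<phi> \<omega>) ({u} \<times> S) \<in> {0, 1}"
      proof -
        assume conv: "(\<lambda>r. emeasure (\<phi> \<omega>) (C r (l r))) \<longlonglongrightarrow> emeasure (\<phi> \<omega>) ({u} \<times> S)"
          and fr: "\<And>R. \<exists>r\<ge>R. emeasure (\<phi> \<omega>) (C r (l r)) \<in> {0, 1}"
        show ?thesis
        proof (rule ccontr)
          assume "emeasure (\<phi> \<omega>) ({u} \<times> S) \<notin> {0, 1}"
          then have "\<forall>\<^sub>F r in sequentially. emeasure (\<phi> \<omega>) (C r (l r)) \<in> - {0, 1}"
            by (intro topological_tendstoD[OF conv]) auto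
          then show False using fr by (auto simp: eventually_sequentially)
        qed
      qed
    qed
  qed
qed

text \<open>On each line the distribution function takes only the values 0 and 1 at rational points.
  Such a measure is 0 or a unit mass at the place where the function switches.\<close>

lemma line_atoms:
  "AE \<omega> in M. \<forall>u>0. emeasure (\<phi> \<omega>) ({u} \<times> UNIV) = 0 \<or>
     (\<exists>v. emeasure (\<phi> \<omega>) {(u, v)} = 1 \<and> emeasure (\<phi> \<omega>) ({u} \<times> (- {v})) = 0)"
proof -
  \<comment> \<open>Bounded sets are required by the preceding lemma, and a countable supply keeps
    one null set for all lines; letting m grow yields the half-lines up to q and every u.\<close>
  have "AE \<omega> in M. \<forall>m::nat. \<forall>q\<in>\<rat>. \<forall>u. 0 < u \<and> u \<le> real (Suc m) \<longrightarrow> emeasure (\<phi> \<omega>) ({u} \<times> {- real m<..q}) \<in> {0, 1}"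
    unfolding AE_all_countable AE_ball_countable[OF countable_rat]
    by (intro allI ballI line_strip) auto
  then show ?thesis using AE_space
  proof eventually_elim
    case (elim \<omega>)
    note sets = sets_phi[OF elim(2)]
    show ?case
    proof (intro allI impI)
      fix u :: real assume u: "0 < u"
      define \<nu> where "\<nu> B = emeasure (\<phi> \<omega>) ({u} \<times> B)" for B
      have s: "{u} \<times> B \<in> sets (\<phi> \<omega>)" if "B \<in> sets borel" for B
        using that u by (auto simp: sets sets_half_plane_iff)
      have mono: "\<nu> A \<le> \<nu> B" if "A \<subseteq> B" "B \<in> sets borel" for A B
        unfolding \<nu>_def using that s by (intro emeasure_mono) auto
      have closed01: "closed {0, 1 :: ennreal}" by simp
      have incl: "(\<lambda>k. \<nu> (B k)) \<longlonglongrightarrow> \<nu> (\<Union>k. B k)" if "incseq B" "\<And>k. B k \<in> sets borel" for B :: "nat \<Rightarrow> real set"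
      proof -
        have "(\<lambda>k. emeasure (\<phi> \<omega>) ({u} \<times> B k)) \<longlonglongrightarrow> emeasure (\<phi> \<omega>) (\<Union>k. {u} \<times> B k)"
          using that s by (intro Lim_emeasure_incseq) (auto simp: incseq_def)
        moreover have "(\<Union>k. {u} \<times> B k) = {u} \<times> (\<Union>k. B k)" by auto
        ultimately show ?thesis by (simp add: \<nu>_def)
      qed
      obtain m0 :: nat where m0: "u \<le> real m0" using real_arch_simple by blast
      have half: "\<nu> {..q} \<in> {0, 1}" if q: "q \<in> \<rat>" for q
      proof -
        have "(\<lambda>k. \<nu> {- real (k + m0)<..q}) \<longlonglongrightarrow> \<nu> (\<Union>k. {- real (k + m0)<..q})"
          by (rule incl) (auto simp: incseq_def)
        moreover have "(\<Union>k. {- real (k + m0)<..q}) = {..q}"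
        proof -
          have "\<exists>k. - real (k + m0) < x" for x
          proof -
            obtain k :: nat where "- x < real k" using reals_Archimedean2 by blast
            then show ?thesis by (intro exI[of _ k]) auto
          qed
          then show ?thesis by auto
        qed
        moreover have "\<nu> {- real (k + m0)<..q} \<in> {0, 1}" for k
          using elim(1)[rule_format, OF q, of u "k + m0"] u m0 by (auto simp: \<nu>_def)
        ultimately show ?thesis using closed_sequentially[OF closed01] by (metis (no_types, lifting))
      qed
      have ofnat: "\<nu> {..real k} \<in> {0, 1}" for k :: nat by (intro half) auto
      have top: "(\<lambda>k. \<nu> {..real k}) \<longlonglongrightarrow> \<nu> UNIV"
      proof -
        have "(\<lambda>k. \<nu> {..real k}) \<longlonglongrightarrow> \<nu> (\<Union>k. {..real k})" by (rule incl) (auto simp: incseq_def)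
        moreover have "(\<Union>k. {..real k}) = UNIV" using real_arch_simple by auto
        ultimately show ?thesis by simp
      qed
      show "emeasure (\<phi> \<omega>) ({u} \<times> UNIV) = 0 \<or>
         (\<exists>v. emeasure (\<phi> \<omega>) {(u, v)} = 1 \<and> emeasure (\<phi> \<omega>) ({u} \<times> (- {v})) = 0)"
      proof (cases "\<nu> UNIV = 0")
        case True
        then show ?thesis by (simp add: \<nu>_def)
      next
        case False
        have "\<nu> UNIV \<in> {0, 1}" using closed_sequentially[OF closed01 _ top] ofnat by blast
        then have one: "\<nu> UNIV = 1" using False by simp
        have compl: "\<nu> (- A) = 1 - \<nu> A" if "A \<in> sets borel" for A
        proof -
          have "{u} \<times> (- A) = {u} \<times> UNIV - {u} \<times> A" by auto
          moreover have "\<nu> A \<le> 1" using mono[of A UNIV] one by auto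
          then have "emeasure (\<phi> \<omega>) ({u} \<times> A) \<noteq> \<infinity>" by (auto simp: \<nu>_def top_unique)
          ultimately show ?thesis using s[OF that] s[of UNIV] one unfolding \<nu>_def
            by (simp only:, subst emeasure_Diff) auto
        qed
        \<comment> \<open>The infimum of this set, called \<open>c\<close> below, is the position of
          the atom.\<close>
        define Q where "Q = {q \<in> \<rat>. \<nu> {..q} = 1}"
        have Qne: "Q \<noteq> {}"
        proof
          assume "Q = {}"
          then have "\<nu> {..real k} = 0" for k :: nat using ofnat[of k] by (auto simp: Q_def)
          then have "(\<lambda>k::nat. 0) \<longlonglongrightarrow> \<nu> UNIV" using top by simp
          then show False using False by (simp add: LIMSEQ_const_iff)
        qed
        have Qbd: "bdd_below Q"
        proof (rule ccontr)
          assume nb: "\<not> bdd_below Q"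
          have all1: "\<nu> {..- real k} = 1" for k :: nat
          proof -
            obtain q where "q \<in> Q" "q < - real k" using nb unfolding bdd_below_def by (meson not_le)
            then have "1 \<le> \<nu> {..- real k}" using mono[of "{..q}" "{..- real k}"] by (auto simp: Q_def)
            then show ?thesis using half[of "- real k"] by auto
          qed
          have "(\<lambda>k. \<nu> {- real k<..}) \<longlonglongrightarrow> \<nu> (\<Union>k. {- real k<..})" by (rule incl) (auto simp: incseq_def)
          moreover have "(\<Union>k. {- real k<..}) = UNIV"
          proof -
            have "\<exists>k. - real k < x" for x
            proof -
              obtain k :: nat where "- x < real k" using reals_Archimedean2 by blast
              then show ?thesis by (intro exI[of _ k]) auto
            qed
            then show ?thesis by auto
          qed
          moreover have "\<nu> {- real k<..} = 0" for k
            using compl[of "{..- real k}"] all1[of k] by (simp add: Compl_atMost)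
          ultimately show False using False by (simp add: LIMSEQ_const_iff)
        qed
        define c where "c = Inf Q"
        have above: "\<nu> {q<..} = 0" if cq: "c < q" for q
        proof -
          obtain q' where "q' \<in> Q" "q' < q" using cInf_lessD[OF Qne, of q] cq unfolding c_def by blast
          then have "1 \<le> \<nu> {..q}" using mono[of "{..q'}" "{..q}"] by (auto simp: Q_def)
          moreover have "\<nu> {..q} \<le> 1" using mono[of "{..q}" UNIV] one by auto
          ultimately have "\<nu> {..q} = 1" by simp
          then show ?thesis using compl[of "{..q}"] by (simp add: Compl_atMost)
        qed
        have below: "\<nu> {..q} = 0" if "q < c" "q \<in> \<rat>" for q
          using half[OF that(2)] that cInf_lower[OF _ Qbd, of q] by (auto simp: Q_def c_def)
        have "(\<lambda>k. \<nu> {c + 1 / real (Suc k)<..}) \<longlonglongrightarrow> \<nu> (\<Union>k. {c + 1 / real (Suc k)<..})"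
          by (rule incl) (auto simp: incseq_def intro!: frac_le elim!: le_less_trans[rotated])
        moreover have "(\<Union>k. {c + 1 / real (Suc k)<..}) = {c<..}"
        proof -
          have "\<exists>k. c + 1 / real (Suc k) < x" if "c < x" for x
            using nat_approx_posE[of "x - c"] that by (metis add.commute diff_gt_0_iff_gt less_diff_eq)
          moreover have "c < x" if "c + 1 / real (Suc k) < x" for x k
          proof -
            have "0 < 1 / real (Suc k)" by simp
            with that show ?thesis by linarith
          qed
          ultimately show ?thesis by auto
        qed
        ultimately have gt: "\<nu> {c<..} = 0" using above by (simp add: LIMSEQ_const_iff)
        have lt: "\<nu> {..<c} = 0"
        proof -
          have "{u} \<times> {..<c} = (\<Union>q\<in>{q\<in>\<rat>. q < c}. {u} \<times> {..q})"
          proof -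
            have "\<exists>q\<in>\<rat>. q < c \<and> x \<le> q" if "x < c" for x using Rats_dense_in_real[OF that] by (auto intro: less_imp_le)
            then show ?thesis by (auto simp: Bex_def)
          qed
          also have "\<dots> \<in> null_sets (\<phi> \<omega>)"
            using below s by (intro null_sets_UN') (auto simp: \<nu>_def null_sets_def intro: countable_subset[OF _ countable_rat])
          finally show ?thesis by (auto simp: \<nu>_def null_sets_def)
        qed
        have "\<nu> (- {c}) = 0"
        proof -
          have "{u} \<times> (- {c}) = {u} \<times> {..<c} \<union> {u} \<times> {c<..}" by auto
          then have "\<nu> (- {c}) \<le> \<nu> {..<c} + \<nu> {c<..}"
            using emeasure_subadditive[of "{u} \<times> {..<c}" "\<phi> \<omega>" "{u} \<times> {c<..}"] s by (simp add: \<nu>_def)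
          then show ?thesis using gt lt by simp
        qed
        moreover have "\<nu> {c} = 1" using compl[of "- {c}"] calculation by simp
        ultimately show ?thesis by (intro disjI2 exI[of _ c]) (auto simp: \<nu>_def)
      qed
    qed
  qed
qed

lemma phi_family_indep:
  assumes fin: "finite \<A>" and \<A>: "\<And>A. A \<in> \<A> \<Longrightarrow> A \<in> sets half_plane" and C: "C \<in> sets half_plane"
    and disj: "\<And>A. A \<in> \<A> \<Longrightarrow> A \<inter> C = {}"
    and b: "\<And>A. A \<in> \<A> \<Longrightarrow> b A \<in> sets borel" and D: "D \<in> sets borel"
  shows "prob ({\<omega> \<in> space M. \<forall>A\<in>\<A>. emeasure (\<phi> \<omega>) A \<in> b A} \<inter> {\<omega> \<in> space M. emeasure (\<phi> \<omega>) C \<in> D}) =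
    prob {\<omega> \<in> space M. \<forall>A\<in>\<A>. emeasure (\<phi> \<omega>) A \<in> b A} * prob {\<omega> \<in> space M. emeasure (\<phi> \<omega>) C \<in> D}"
proof -
  \<comment> \<open>the disjoint atoms of the finite algebra generated by \<open>\<A>\<close>; the axioms only cover disjoint families\<close>
  define cell where "cell S = {p \<in> space half_plane. (\<exists>A\<in>\<A>. p \<in> A) \<and> (\<forall>A\<in>\<A>. p \<in> A \<longleftrightarrow> A \<in> S)}" for S
  have cell: "cell S \<in> sets half_plane" for S
  proof -
    have [measurable]: "Measurable.pred half_plane (\<lambda>p. p \<in> A)" if "A \<in> \<A>" for A
      using \<A>[OF that] by simp
    show ?thesis unfolding cell_def using fin
      by (intro sets.sets_Collect_conj sets.sets_Collect_finite_Ex sets.sets_Collect_finite_All)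
         (auto intro!: pred_intros_logic simp: pred_def[symmetric])
  qed
  obtain e where e: "bij_betw e {..<card (Pow \<A>)} (Pow \<A>)"
    using ex_bij_betw_nat_finite[of "Pow \<A>"] fin by (auto simp: atLeast0LessThan)
  define k where "k = card (Pow \<A>)"
  note e = e[folded k_def]
  define F where "F i = (if i = k then C else cell (e i))" for i
  have FA: "A = (\<Union>i\<in>{i. i < k \<and> A \<in> e i}. F i)" if A: "A \<in> \<A>" for A
  proof (rule Set.set_eqI, rule iffI)
    fix p assume p: "p \<in> A"
    define S where "S = {B\<in>\<A>. p \<in> B}"
    then have "S \<in> e ` {..<k}" using e by (auto simp: bij_betw_def)
    then obtain i where "i < k" "e i = S" by blast
    moreover have "p \<in> space half_plane" using sets.sets_into_space[OF \<A>[OF A]] p by auto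
    ultimately show "p \<in> (\<Union>i\<in>{i. i < k \<and> A \<in> e i}. F i)" using p A
      by (auto simp: F_def cell_def S_def intro!: exI[of _ i])
  next
    fix p assume "p \<in> (\<Union>i\<in>{i. i < k \<and> A \<in> e i}. F i)"
    then show "p \<in> A" using A by (auto simp: F_def cell_def split: if_splits)
  qed
  have dF: "disjoint_family_on F {..<Suc k}"
    unfolding disjoint_family_on_def
  proof (intro ballI impI)
    fix i j assume ij: "i \<in> {..<Suc k}" "j \<in> {..<Suc k}" "i \<noteq> j"
    have Ccell: "C \<inter> cell S = {}" for S using disj by (auto simp: cell_def)
    have "cell (e i) \<inter> cell (e j) = {}" if "i < k" "j < k"
    proof (rule ccontr)
      assume "cell (e i) \<inter> cell (e j) \<noteq> {}"
      then obtain p where "p \<in> cell (e i)" "p \<in> cell (e j)" by blast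
      moreover have "e i \<subseteq> \<A>" "e j \<subseteq> \<A>" using e that by (auto simp: bij_betw_def)
      ultimately have "e i = e j" by (auto simp: cell_def)
      then show False using e that ij by (auto simp: bij_betw_def inj_on_def)
    qed
    then show "F i \<inter> F j = {}" using Ccell ij by (auto simp: F_def less_Suc_eq)
  qed
  have Fs: "F i \<in> sets half_plane" for i using C cell by (simp add: F_def)
  have ind: "indep_vars (\<lambda>_. borel) (\<lambda>i \<omega>. emeasure (\<phi> \<omega>) (F i)) {..<Suc k}"
    using Fs dF by (intro phi_indep) auto
  let ?V = "\<lambda>\<omega>. \<lambda>i\<in>{..<k}. emeasure (\<phi> \<omega>) (F i)" and ?W = "\<lambda>\<omega>. \<lambda>i\<in>{k}. emeasure (\<phi> \<omega>) (F i)"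
  have VW: "indep_var (PiM {..<k} (\<lambda>_. borel)) ?V (PiM {k} (\<lambda>_. borel)) ?W"
    by (rule indep_var_restrict[OF ind]) auto
  let ?P = "{f \<in> space (PiM {..<k} (\<lambda>_. borel)). \<forall>A\<in>\<A>. (\<Sum>i\<in>{i. i < k \<and> A \<in> e i}. f i) \<in> b A}"
  let ?R = "{f \<in> space (PiM {k} (\<lambda>_. borel)). f k \<in> D}"
  have P: "?P \<in> sets (PiM {..<k} (\<lambda>_. borel :: ennreal measure))"
  proof (rule sets.sets_Collect_finite_All[OF _ fin])
    fix A assume "A \<in> \<A>"
    then have bA: "b A \<in> sets borel" by (rule b)
    have "(\<lambda>f. \<Sum>i\<in>{i. i < k \<and> A \<in> e i}. f i :: ennreal) \<in> borel_measurable (PiM {..<k} (\<lambda>_. borel))"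
      by (intro borel_measurable_sum measurable_component_singleton) auto
    from measurable_sets[OF this bA] show "{f \<in> space (PiM {..<k} (\<lambda>_. borel)). (\<Sum>i\<in>{i. i < k \<and> A \<in> e i}. f i) \<in> b A} \<in> sets (PiM {..<k} (\<lambda>_. borel))"
      by (simp add: vimage_def Int_def conj_commute)
  qed
  have R: "?R \<in> sets (PiM {k} (\<lambda>_. borel :: ennreal measure))" using D by measurable
  have sumF: "emeasure (\<phi> \<omega>) A = (\<Sum>i\<in>{i. i < k \<and> A \<in> e i}. emeasure (\<phi> \<omega>) (F i))" if "\<omega> \<in> space M" "A \<in> \<A>" for \<omega> A
  proof -
    have "(\<Sum>i\<in>{i. i < k \<and> A \<in> e i}. emeasure (\<phi> \<omega>) (F i)) = emeasure (\<phi> \<omega>) (\<Union>i\<in>{i. i < k \<and> A \<in> e i}. F i)"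
      using Fs sets_phi[OF that(1)] by (intro sum_emeasure disjoint_family_on_mono[OF _ dF]) auto
    then show ?thesis using FA[OF that(2)] by simp
  qed
  have sp: "?V \<omega> \<in> space (PiM {..<k} (\<lambda>_. borel))" "?W \<omega> \<in> space (PiM {k} (\<lambda>_. borel))" for \<omega>
    by (auto simp: space_PiM)
  have e1: "{\<omega> \<in> space M. \<forall>A\<in>\<A>. emeasure (\<phi> \<omega>) A \<in> b A} = ?V -` ?P \<inter> space M"
  proof -
    have "(\<Sum>i\<in>{i. i < k \<and> A \<in> e i}. ?V \<omega> i) = (\<Sum>i\<in>{i. i < k \<and> A \<in> e i}. emeasure (\<phi> \<omega>) (F i))" for A \<omega>
      by (intro sum.cong) auto
    then show ?thesis using sumF sp(1) by auto
  qed
  have e2: "{\<omega> \<in> space M. emeasure (\<phi> \<omega>) C \<in> D} = ?W -` ?R \<inter> space M"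
    using sp(2) by (auto simp: F_def)
  have "prob ((\<lambda>\<omega>. (?V \<omega>, ?W \<omega>)) -` (?P \<times> ?R) \<inter> space M) = prob (?V -` ?P \<inter> space M) * prob (?W -` ?R \<inter> space M)"
    by (rule indep_varD[OF VW P R])
  moreover have "(\<lambda>\<omega>. (?V \<omega>, ?W \<omega>)) -` (?P \<times> ?R) \<inter> space M = (?V -` ?P \<inter> space M) \<inter> (?W -` ?R \<inter> space M)" by auto
  ultimately show ?thesis unfolding e1 e2 by simp
qed

end

section \<open>Predictable sets and the compensation formula\<close>

lemma (in poisson_half_plane) random_measure_eventsI:
  assumes "A \<in> sets half_plane" "D \<in> sets borel"
  shows "{\<omega> \<in> space M. emeasure (\<phi> \<omega>) A \<in> D} \<in> random_measure_events M half_plane \<phi>"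
proof -
  let ?N = "\<Pi>\<^sub>M A\<in>sets half_plane. (borel :: ennreal measure)"
  let ?f = "\<lambda>\<omega>. \<lambda>A\<in>sets half_plane. emeasure (\<phi> \<omega>) A"
  have "?f \<in> vimage_algebra (space M) ?f ?N \<rightarrow>\<^sub>M ?N"
    by (rule measurable_vimage_algebra1) (auto simp: space_PiM)
  from measurable_compose[OF this measurable_component_singleton[OF assms(1)]]
  have "(\<lambda>\<omega>. emeasure (\<phi> \<omega>) A) \<in> borel_measurable (vimage_algebra (space M) ?f ?N)"
    using assms(1) by simp
  from measurable_sets[OF this assms(2)] show ?thesis
    by (simp add: random_measure_events_def vimage_def Int_def conj_commute)
qed

text \<open>\<open>S0\<close> stands for the information in the initial values, \<open>K\<close> for
  the almost sure event on which all pathwise statements will hold.\<close>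

locale poisson_filtration = poisson_half_plane +
  fixes S0 :: "'a set set" and K :: "'a set"
  assumes S0_algebra: "sigma_algebra (space M) S0"
    and S0_indep: "indep_set S0 (random_measure_events M half_plane \<phi>)"
    and K_event: "K \<in> events" and K_prob: "prob K = 1"
    and K_finite: "\<And>\<omega> k. \<omega> \<in> K \<Longrightarrow> emeasure (\<phi> \<omega>) ({0<..real k} \<times> {- real k..real k}) < \<infinity>"
begin

definition fd_events :: "real \<Rightarrow> 'a set set" where
  "fd_events t = {{\<omega> \<in> space M. \<forall>A\<in>\<A>. emeasure (\<phi> \<omega>) A \<in> b A} |\<A> b.
     finite \<A> \<and> \<A> \<subseteq> {A \<in> sets half_plane. A \<subseteq> {..t} \<times> UNIV} \<and> b ` \<A> \<subseteq> sets borel}"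

text \<open>The factor L puts all events of full probability, \<open>K\<close> among them, into
  \<open>G\<close>. It does not affect any probability, so independence of the future survives this
  augmentation.\<close>

definition past_gen :: "real \<Rightarrow> 'a set set" where
  "past_gen t = {Z0 \<inter> Z1 \<inter> L |Z0 Z1 L. Z0 \<in> S0 \<and> Z1 \<in> fd_events t \<and> L \<in> events \<and> prob L = 1}"

definition G :: "real \<Rightarrow> 'a measure" where
  "G t = sigma (space M) (past_gen t)"

lemma S0_events: "S0 \<subseteq> events"
  using S0_indep by (rule indep_setD_ev1)

lemma fd_events_rme: "fd_events t \<subseteq> random_measure_events M half_plane \<phi>"
proof
  fix Z assume "Z \<in> fd_events t"
  then obtain \<A> b where Z: "Z = {\<omega> \<in> space M. \<forall>A\<in>\<A>. emeasure (\<phi> \<omega>) A \<in> b A}"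
    and fin: "finite \<A>" and \<A>: "\<A> \<subseteq> sets half_plane" and b: "b ` \<A> \<subseteq> sets borel" by (auto simp: fd_events_def)
  let ?V = "vimage_algebra (space M) (\<lambda>\<omega>. \<lambda>A\<in>sets half_plane. emeasure (\<phi> \<omega>) A) (\<Pi>\<^sub>M A\<in>sets half_plane. (borel :: ennreal measure))"
  have "{\<omega> \<in> space ?V. \<forall>A\<in>\<A>. emeasure (\<phi> \<omega>) A \<in> b A} \<in> sets ?V"
    using random_measure_eventsI \<A> b by (intro sets.sets_Collect_finite_All fin) (auto simp: random_measure_events_def)
  then show "Z \<in> random_measure_events M half_plane \<phi>" unfolding Z random_measure_events_def by simp
qed

lemma rme_events: "random_measure_events M half_plane \<phi> \<subseteq> events"
  using S0_indep by (rule indep_setD_ev2)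

lemma past_gen_events: "past_gen t \<subseteq> events"
  using S0_events fd_events_rme rme_events by (fastforce simp: past_gen_def)

lemma past_gen_Pow: "past_gen t \<subseteq> Pow (space M)"
  using past_gen_events sets.sets_into_space by blast

lemma space_G [simp]: "space (G t) = space M" and sets_G: "sets (G t) = sigma_sets (space M) (past_gen t)"
  using past_gen_Pow by (simp_all add: G_def)

lemma space_M_S0: "space M \<in> S0"
proof -
  interpret S0: sigma_algebra "space M" S0 by (rule S0_algebra)
  show ?thesis by (rule S0.top)
qed

lemma fd_events_top: "space M \<in> fd_events t"
  unfolding fd_events_def by (intro CollectI exI[of _ "{}"]) auto

lemma past_genI:
  assumes "Z0 \<in> S0" "Z1 \<in> fd_events t" "L \<in> events" "prob L = 1"
  shows "Z0 \<inter> Z1 \<inter> L \<in> sets (G t)"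
  using assms unfolding sets_G past_gen_def by blast

lemma S0_G: "Z \<in> S0 \<Longrightarrow> Z \<in> sets (G t)"
  using past_genI[OF _ fd_events_top sets.top prob_space, of Z t] S0_events sets.sets_into_space[of Z M]
  by (auto simp: Int_absorb2)

lemma full_G: "L \<in> events \<Longrightarrow> prob L = 1 \<Longrightarrow> L \<in> sets (G t)"
  using past_genI[OF space_M_S0 fd_events_top, of L t] sets.sets_into_space[of L M]
  by (auto simp: Int_absorb1)

lemma phi_G:
  assumes "A \<in> sets half_plane" "A \<subseteq> {..t} \<times> UNIV"
  shows "(\<lambda>\<omega>. emeasure (\<phi> \<omega>) A) \<in> borel_measurable (G t)"
proof (rule measurableI)
  fix D :: "ennreal set" assume D: "D \<in> sets borel"
  have "{\<omega> \<in> space M. emeasure (\<phi> \<omega>) A \<in> D} \<in> fd_events t"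
    unfolding fd_events_def using assms D by (intro CollectI exI[of _ "{A}"] exI[of _ "\<lambda>_. D"]) auto
  from past_genI[OF space_M_S0 this sets.top prob_space]
  show "(\<lambda>\<omega>. emeasure (\<phi> \<omega>) A) -` D \<inter> space (G t) \<in> sets (G t)"
    by (simp add: vimage_def Int_def conj_commute)
qed simp

lemma G_mono: "s \<le> t \<Longrightarrow> sets (G s) \<subseteq> sets (G t)"
proof -
  assume st: "s \<le> t"
  have "fd_events s \<subseteq> fd_events t"
  proof
    fix Z assume "Z \<in> fd_events s"
    then obtain \<A> b where Z: "Z = {\<omega> \<in> space M. \<forall>A\<in>\<A>. emeasure (\<phi> \<omega>) A \<in> b A}" "finite \<A>"
      "\<A> \<subseteq> {A \<in> sets half_plane. A \<subseteq> {..s} \<times> UNIV}" "b ` \<A> \<subseteq> sets borel"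
      unfolding fd_events_def by auto
    have "\<A> \<subseteq> {A \<in> sets half_plane. A \<subseteq> {..t} \<times> UNIV}" using Z(3) st by fastforce
    with Z(1,2,4) show "Z \<in> fd_events t" unfolding fd_events_def by auto
  qed
  then have "past_gen s \<subseteq> past_gen t" unfolding past_gen_def by blast
  then show ?thesis unfolding sets_G by (rule sigma_sets_mono')
qed

lemma G_events: "sets (G t) \<subseteq> events"
  unfolding sets_G using past_gen_events by (rule sets.sigma_sets_subset)

lemma Int_stable_past: "Int_stable (past_gen t)"
proof (rule Int_stableI)
  fix X Y assume "X \<in> past_gen t" "Y \<in> past_gen t"
  then obtain X0 X1 XL Y0 Y1 YL where X: "X = X0 \<inter> X1 \<inter> XL" "X0 \<in> S0" "X1 \<in> fd_events t" "XL \<in> events" "prob XL = 1"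
    and Y: "Y = Y0 \<inter> Y1 \<inter> YL" "Y0 \<in> S0" "Y1 \<in> fd_events t" "YL \<in> events" "prob YL = 1"
    by (auto simp: past_gen_def)
  interpret S0: sigma_algebra "space M" S0 by (rule S0_algebra)
  have 0: "X0 \<inter> Y0 \<in> S0" using X Y by (intro S0.Int)
  obtain \<A> b where A: "X1 = {\<omega> \<in> space M. \<forall>A\<in>\<A>. emeasure (\<phi> \<omega>) A \<in> b A}" "finite \<A>"
    "\<A> \<subseteq> {A \<in> sets half_plane. A \<subseteq> {..t} \<times> UNIV}" "b ` \<A> \<subseteq> sets borel"
    using X(3) by (auto simp: fd_events_def)
  obtain \<B> d where B: "Y1 = {\<omega> \<in> space M. \<forall>A\<in>\<B>. emeasure (\<phi> \<omega>) A \<in> d A}" "finite \<B>"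
    "\<B> \<subseteq> {A \<in> sets half_plane. A \<subseteq> {..t} \<times> UNIV}" "d ` \<B> \<subseteq> sets borel"
    using Y(3) by (auto simp: fd_events_def)
  have 1: "X1 \<inter> Y1 \<in> fd_events t"
    unfolding fd_events_def
    by (intro CollectI exI[of _ "\<A> \<union> \<B>"] exI[of _ "\<lambda>A. (if A \<in> \<A> then b A else UNIV) \<inter> (if A \<in> \<B> then d A else UNIV)"])
       (use A B in auto)
  have "AE \<omega> in M. \<omega> \<in> XL" "AE \<omega> in M. \<omega> \<in> YL" using X Y by (auto intro: AE_prob_1)
  then have "AE \<omega> in M. \<omega> \<in> XL \<inter> YL" by eventually_elim simp
  then have 2: "prob (XL \<inter> YL) = 1" using X Y by (subst prob_eq_1) auto
  have "X \<inter> Y = (X0 \<inter> Y0) \<inter> (X1 \<inter> Y1) \<inter> (XL \<inter> YL)" using X Y by auto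
  then show "X \<inter> Y \<in> past_gen t" unfolding past_gen_def using 0 1 2 X Y by blast
qed

text \<open>On generators the event from \<open>S0\<close> splits off by its independence from the
  whole random measure, and the event on the masses up to t by independence over disjoint regions.
  Both classes are stable under intersection, which extends the product rule to
  \<open>G t\<close>.\<close>

lemma past_future_indep:
  assumes Z: "Z \<in> sets (G t)" and C: "C \<in> sets half_plane" "C \<subseteq> {t<..} \<times> UNIV" and D: "D \<in> sets borel"
  shows "prob (Z \<inter> {\<omega> \<in> space M. emeasure (\<phi> \<omega>) C \<in> D}) = prob Z * prob {\<omega> \<in> space M. emeasure (\<phi> \<omega>) C \<in> D}"
proof -
  define \<C> where "\<C> = {{\<omega> \<in> space M. emeasure (\<phi> \<omega>) C \<in> D} |D. D \<in> sets borel}"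
  have rme_Int: "X \<inter> Y \<in> random_measure_events M half_plane \<phi>" if "X \<in> random_measure_events M half_plane \<phi>" "Y \<in> random_measure_events M half_plane \<phi>" for X Y
    using that unfolding random_measure_events_def by blast
  have "indep_set (past_gen t) \<C>"
  proof (rule indep_setI)
    show "past_gen t \<subseteq> events" by (rule past_gen_events)
    show "\<C> \<subseteq> events" using rme_events random_measure_eventsI[OF C(1)] by (auto simp: \<C>_def)
    fix X Y assume "X \<in> past_gen t" "Y \<in> \<C>"
    then obtain Z0 Z1 L D where X: "X = Z0 \<inter> Z1 \<inter> L" "Z0 \<in> S0" "Z1 \<in> fd_events t" "L \<in> events" "prob L = 1"
      and Y: "Y = {\<omega> \<in> space M. emeasure (\<phi> \<omega>) C \<in> D}" "D \<in> sets borel"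
      by (auto simp: past_gen_def \<C>_def)
    obtain \<A> b where A: "Z1 = {\<omega> \<in> space M. \<forall>A\<in>\<A>. emeasure (\<phi> \<omega>) A \<in> b A}" "finite \<A>"
      "\<A> \<subseteq> {A \<in> sets half_plane. A \<subseteq> {..t} \<times> UNIV}" "b ` \<A> \<subseteq> sets borel"
      using X(3) by (auto simp: fd_events_def)
    have Yr: "Y \<in> random_measure_events M half_plane \<phi>" using random_measure_eventsI[OF C(1) Y(2)] Y(1) by simp
    have Z1r: "Z1 \<in> random_measure_events M half_plane \<phi>" using X(3) fd_events_rme by blast
    have ev: "Z0 \<in> events" "Z1 \<in> events" "Y \<in> events" using X(2) S0_events Z1r Yr rme_events by auto
    have AL: "AE \<omega> in M. \<omega> \<in> L" using X by (intro AE_prob_1)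
    have "prob (X \<inter> Y) = prob (Z0 \<inter> (Z1 \<inter> Y))"
      by (rule measure_eq_AE) (use AL X ev in auto)
    also have "\<dots> = prob Z0 * prob (Z1 \<inter> Y)" using indep_setD[OF S0_indep X(2) rme_Int[OF Z1r Yr]] .
    also have "prob (Z1 \<inter> Y) = prob Z1 * prob Y"
      unfolding A(1) Y(1) using A C Y(2) by (intro phi_family_indep) fastforce+
    also have "prob Z0 * (prob Z1 * prob Y) = prob (Z0 \<inter> Z1) * prob Y"
      using indep_setD[OF S0_indep X(2) Z1r] by simp
    also have "prob (Z0 \<inter> Z1) = prob X" by (rule measure_eq_AE) (use AL X ev in auto)
    finally show "prob (X \<inter> Y) = prob X * prob Y" .
  qed
  moreover have "Int_stable \<C>"
  proof (rule Int_stableI)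
    fix X Y assume "X \<in> \<C>" "Y \<in> \<C>"
    then obtain D D' where "X = {\<omega> \<in> space M. emeasure (\<phi> \<omega>) C \<in> D}" "D \<in> sets borel"
      "Y = {\<omega> \<in> space M. emeasure (\<phi> \<omega>) C \<in> D'}" "D' \<in> sets borel" by (auto simp: \<C>_def)
    then show "X \<inter> Y \<in> \<C>" unfolding \<C>_def by (intro CollectI exI[of _ "D \<inter> D'"]) auto
  qed
  ultimately have "indep_set (sigma_sets (space M) (past_gen t)) (sigma_sets (space M) \<C>)"
    using Int_stable_past by (intro indep_set_sigma_sets)
  moreover have "{\<omega> \<in> space M. emeasure (\<phi> \<omega>) C \<in> D} \<in> sigma_sets (space M) \<C>"
    using D by (auto simp: \<C>_def)
  ultimately show ?thesis using Z unfolding sets_G by (intro indep_setD)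
qed

text \<open>Off the event \<open>K\<close> the random measure is replaced by 0, so that it is finite on boxes for every
  outcome; \<open>K\<close> belongs to every \<open>G t\<close>, which contains the events of probability 1.\<close>

definition \<psi> :: "'a \<Rightarrow> (real \<times> real) measure" where
  "\<psi> \<omega> = (if \<omega> \<in> K then \<phi> \<omega> else null_measure half_plane)"

definition window :: "real \<Rightarrow> nat \<Rightarrow> (real \<times> real) set" where
  "window t k = {0<..t} \<times> {- real k..real k}"

definition W :: "('a \<times> real \<times> real) set" where
  "W = space M \<times> {0<..} \<times> UNIV"

text \<open>Predictable rectangles with marks. Rays in time serve as well as bounded intervals,
  which are differences of rays, and they make the class stable under intersection.\<close>

definition pred_gen :: "('a \<times> real \<times> real) set set" where
  "pred_gen = {Z \<times> {s<..} \<times> B |Z s B. 0 \<le> s \<and> Z \<in> sets (G s) \<and> B \<in> sets borel}"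

definition Pred :: "('a \<times> real \<times> real) measure" where
  "Pred = sigma W pred_gen"

lemma sets_psi: "\<omega> \<in> space M \<Longrightarrow> sets (\<psi> \<omega>) = sets half_plane"
  by (simp add: \<psi>_def sets_phi)

lemma psi_G:
  assumes "A \<in> sets half_plane" "A \<subseteq> {..t} \<times> UNIV"
  shows "(\<lambda>\<omega>. emeasure (\<psi> \<omega>) A) \<in> borel_measurable (G t)"
proof -
  have "(\<lambda>\<omega>. indicator K \<omega> * emeasure (\<phi> \<omega>) A) \<in> borel_measurable (G t)"
    using full_G[OF K_event K_prob, of t] phi_G[OF assms] by measurable
  moreover have "indicator K \<omega> * emeasure (\<phi> \<omega>) A = emeasure (\<psi> \<omega>) A" for \<omega>
    by (simp add: \<psi>_def)
  ultimately show ?thesis by simp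
qed

lemma window_half_plane: "window t k \<in> sets half_plane"
  by (auto simp: sets_half_plane_iff window_def)

lemma window_finite: "emeasure lborel (window t k) < \<infinity>"
  by (rule emeasure_bounded_finite) (auto simp: window_def intro!: bounded_Times)

lemma psi_window_finite: 
  assumes "\<omega> \<in> space M" shows "emeasure (\<psi> \<omega>) (window t k) < \<infinity>"
proof (cases "\<omega> \<in> K")
  case True
  obtain m :: nat where m: "max t (real k) \<le> real m" using real_arch_simple by blast
  have "emeasure (\<phi> \<omega>) (window t k) \<le> emeasure (\<phi> \<omega>) ({0<..real m} \<times> {- real m..real m})"
    using m assms by (intro emeasure_mono) (auto simp: window_def sets_phi sets_half_plane_iff)
  then show ?thesis using K_finite[OF True, of m] True by (auto simp: \<psi>_def intro: le_less_trans)
qed (simp add: \<psi>_def)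

lemma G_sub: "A \<in> sets (G t) \<Longrightarrow> A \<in> events"
  using G_events by blast

lemma G_borel_measurable: "f \<in> borel_measurable (G t) \<Longrightarrow> f \<in> borel_measurable M"
  using G_events[of t] by (auto simp: measurable_def)

lemma pred_gen_Pow: "pred_gen \<subseteq> Pow W"
  using G_sub sets.sets_into_space by (fastforce simp: pred_gen_def W_def)

lemma space_Pred [simp]: "space Pred = W" and sets_Pred: "sets Pred = sigma_sets W pred_gen"
  using pred_gen_Pow by (simp_all add: Pred_def)

lemma pred_genI: "0 \<le> s \<Longrightarrow> Z \<in> sets (G s) \<Longrightarrow> B \<in> sets borel \<Longrightarrow> Z \<times> {s<..} \<times> B \<in> sets Pred"
  unfolding sets_Pred pred_gen_def by blast

lemma Int_stable_pred: "Int_stable pred_gen"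
proof (rule Int_stableI)
  fix a b assume "a \<in> pred_gen" "b \<in> pred_gen"
  then obtain Z s B Z' s' B' where a: "a = Z \<times> {s<..} \<times> B" "0 \<le> s" "Z \<in> sets (G s)" "B \<in> sets borel"
    and b: "b = Z' \<times> {s'<..} \<times> B'" "0 \<le> s'" "Z' \<in> sets (G s')" "B' \<in> sets borel" by (auto simp: pred_gen_def)
  have "Z \<inter> Z' \<in> sets (G (max s s'))"
    using a b G_mono[of s "max s s'"] G_mono[of s' "max s s'"] by (intro sets.Int) auto
  moreover have "a \<inter> b = (Z \<inter> Z') \<times> {max s s'<..} \<times> (B \<inter> B')" using a b by auto
  ultimately show "a \<inter> b \<in> pred_gen" unfolding pred_gen_def using a b
    by (intro CollectI exI[of _ "Z \<inter> Z'"] exI[of _ "max s s'"] exI[of _ "B \<inter> B'"]) auto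
qed

lemma W_product: "W \<in> sets (M \<Otimes>\<^sub>M borel)"
proof -
  have "{0<..} \<times> (UNIV::real set) \<in> sets (borel :: (real \<times> real) measure)" by auto
  then show ?thesis unfolding W_def by auto
qed

lemma section_window: "H \<in> sets (M \<Otimes>\<^sub>M borel) \<Longrightarrow> Pair \<omega> -` H \<inter> window t k \<in> sets half_plane"
  using sets_Pair1[of H M borel \<omega>] window_half_plane[of t k]
  by (auto simp: sets_half_plane_iff)

abbreviation (input) mass :: "(real \<times> real) measure \<Rightarrow> ('a \<times> real \<times> real) set \<Rightarrow> real \<Rightarrow> nat \<Rightarrow> 'a \<Rightarrow> ennreal" where
  "mass \<mu> H t k \<omega> \<equiv> emeasure \<mu> (Pair \<omega> -` H \<inter> window t k)"

lemma lborel_section_window_measurable: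
  assumes "H \<in> sets (M \<Otimes>\<^sub>M borel)"
  shows "(\<lambda>\<omega>. mass lborel H t k \<omega>) \<in> borel_measurable M"
proof -
  have "sets (M \<Otimes>\<^sub>M lborel) = sets (M \<Otimes>\<^sub>M borel)" by (intro sets_pair_measure_cong) auto
  moreover have "H \<inter> space M \<times> window t k \<in> sets (M \<Otimes>\<^sub>M borel)"
    using assms window_half_plane[of t k] by (intro sets.Int pair_measureI) (auto simp: sets_half_plane_iff)
  ultimately have "H \<inter> space M \<times> window t k \<in> sets (M \<Otimes>\<^sub>M lborel)" by simp
  from lborel.measurable_emeasure_Pair[OF this] show ?thesis
    by (rule measurable_cong[THEN iffD1, rotated]) (auto intro!: arg_cong2[where f=emeasure])
qed

text \<open>Induction over disjoint unions and complements. The bounded window keeps all masses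
  finite, so that complements turn into differences; adaptedness is carried along to supply the
  measurability for splitting the integrals.\<close>

lemma Pred_window:
  assumes "H \<in> sets Pred"
  shows "H \<in> sets (M \<Otimes>\<^sub>M borel) \<and>
    (\<forall>t\<ge>0. \<forall>k. (\<lambda>\<omega>. mass (\<psi> \<omega>) H t k \<omega>) \<in> borel_measurable (G t) \<and>
      (\<integral>\<^sup>+\<omega>. mass (\<psi> \<omega>) H t k \<omega> \<partial>M) = (\<integral>\<^sup>+\<omega>. mass lborel H t k \<omega> \<partial>M))"
  using Int_stable_pred pred_gen_Pow assms[unfolded sets_Pred]
proof (induction rule: sigma_sets_induct_disjoint)
  case (basic H)
  then obtain Z s B where H: "H = Z \<times> {s<..} \<times> B" "0 \<le> s" "Z \<in> sets (G s)" "B \<in> sets borel" by (auto simp: pred_gen_def)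
  have Z: "Z \<in> events" using H G_sub by blast
  have 1: "H \<in> sets (M \<Otimes>\<^sub>M borel)"
    unfolding H(1) using Z H(4) by (intro pair_measureI) auto
  show ?case
  proof (intro conjI allI impI 1)
    fix t :: real and k assume t: "0 \<le> t"
    \<comment> \<open>Over \<open>Z\<close> the section is a fixed set strictly after s, and
      \<open>Z\<close> belongs to \<open>G s\<close>, so mass and event are independent.\<close>
    define C where "C = {s<..t} \<times> (B \<inter> {- real k..real k})"
    have C: "C \<in> sets half_plane" "C \<subseteq> {..t} \<times> UNIV" "C \<subseteq> {s<..} \<times> UNIV" using H by (auto simp: C_def sets_half_plane_iff)
    have Cf: "emeasure half_plane C < \<infinity>"
      using C(1) by (rule emeasure_half_plane_finite) (auto simp: C_def intro!: bounded_Times bounded_Int)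
    have sec: "Pair \<omega> -` H \<inter> window t k = (if \<omega> \<in> Z then C else {})" for \<omega>
      using H(2) by (auto simp: H(1) window_def C_def)
    have e: "mass N H t k \<omega> = indicator Z \<omega> * emeasure N C" for \<omega> N
      unfolding sec by auto
    show "(\<lambda>\<omega>. mass (\<psi> \<omega>) H t k \<omega>) \<in> borel_measurable (G t)"
    proof (cases "s \<le> t")
      case True
      then have [measurable]: "Z \<in> sets (G t)" using H G_mono by blast
      show ?thesis unfolding e using psi_G[OF C(1,2)] by measurable
    next
      case False
      then have "C = {}" by (auto simp: C_def)
      then show ?thesis unfolding e by simp
    qed
    have "(\<integral>\<^sup>+\<omega>. indicator Z \<omega> * emeasure (\<psi> \<omega>) C \<partial>M) = (\<integral>\<^sup>+\<omega>. indicator Z \<omega> * emeasure (\<phi> \<omega>) C \<partial>M)"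
      by (rule nn_integral_cong_AE) (use AE_prob_1[OF K_prob] in \<open>eventually_elim, simp add: \<psi>_def\<close>)
    also have "\<dots> = emeasure M Z * emeasure half_plane C"
    proof (rule nn_integral_indep_phi[OF C(1) Cf Z])
      fix k :: nat
      show "prob (Z \<inter> {\<omega> \<in> space M. emeasure (\<phi> \<omega>) C = of_nat k}) = prob Z * prob {\<omega> \<in> space M. emeasure (\<phi> \<omega>) C = of_nat k}"
        using past_future_indep[OF H(3) C(1,3), of "{of_nat k}"] by simp
    qed
    also have "\<dots> = (\<integral>\<^sup>+\<omega>. indicator Z \<omega> * emeasure lborel C \<partial>M)"
      using Z emeasure_half_plane[OF C(1)] by (simp add: nn_integral_multc)
    finally show "(\<integral>\<^sup>+\<omega>. mass (\<psi> \<omega>) H t k \<omega> \<partial>M) = (\<integral>\<^sup>+\<omega>. mass lborel H t k \<omega> \<partial>M)"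
      unfolding e .
  qed
next
  case empty
  then show ?case by simp
next
  case (compl H)
  then have IH: "H \<in> sets (M \<Otimes>\<^sub>M borel)"
    "\<And>t k. 0 \<le> t \<Longrightarrow> (\<lambda>\<omega>. mass (\<psi> \<omega>) H t k \<omega>) \<in> borel_measurable (G t)"
    "\<And>t k. 0 \<le> t \<Longrightarrow> (\<integral>\<^sup>+\<omega>. mass (\<psi> \<omega>) H t k \<omega> \<partial>M) = (\<integral>\<^sup>+\<omega>. mass lborel H t k \<omega> \<partial>M)"
    by auto
  show ?case
  proof (intro conjI allI impI)
    show "W - H \<in> sets (M \<Otimes>\<^sub>M borel)" using W_product IH(1) by auto
    fix t :: real and k assume t: "0 \<le> t"
    have sec: "Pair \<omega> -` (W - H) \<inter> window t k = window t k - (Pair \<omega> -` H \<inter> window t k)" if "\<omega> \<in> space M" for \<omega>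
      using that by (auto simp: W_def window_def)
    note sm = section_window[OF IH(1), of _ t k]
    have p: "mass (\<psi> \<omega>) (W - H) t k \<omega> = emeasure (\<psi> \<omega>) (window t k) - mass (\<psi> \<omega>) H t k \<omega>"
      if "\<omega> \<in> space M" for \<omega>
      unfolding sec[OF that] using sm[of \<omega>] window_half_plane[of t k] psi_window_finite[OF that, of t k]
        emeasure_mono[OF Int_lower2, of "window t k" "\<psi> \<omega>" "Pair \<omega> -` H"]
      by (intro emeasure_Diff) (auto simp: sets_psi[OF that] top_unique)
    have l: "mass lborel (W - H) t k \<omega> = emeasure lborel (window t k) - mass lborel H t k \<omega>"
      if "\<omega> \<in> space M" for \<omega>
      unfolding sec[OF that] using sm[of \<omega>] window_half_plane[of t k] window_finite[of t k]
        emeasure_mono[OF Int_lower2, of "window t k" lborel "Pair \<omega> -` H"]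
      by (intro emeasure_Diff) (auto simp: sets_half_plane_iff top_unique)
    have window_t: "window t k \<subseteq> {..t} \<times> UNIV" by (auto simp: window_def)
    have "(\<lambda>\<omega>. emeasure (\<psi> \<omega>) (window t k) - mass (\<psi> \<omega>) H t k \<omega>) \<in> borel_measurable (G t)"
      using psi_G[OF window_half_plane window_t] IH(2)[OF t] by measurable
    then show "(\<lambda>\<omega>. mass (\<psi> \<omega>) (W - H) t k \<omega>) \<in> borel_measurable (G t)"
      by (subst measurable_cong[OF p]) auto
    have mpsi: "(\<lambda>\<omega>. mass (\<psi> \<omega>) H t k \<omega>) \<in> borel_measurable M"
      using IH(2)[OF t] by (rule G_borel_measurable)
    have mpb: "(\<lambda>\<omega>. emeasure (\<psi> \<omega>) (window t k)) \<in> borel_measurable M"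
      using psi_G[OF window_half_plane window_t] by (rule G_borel_measurable)
    note mleb = lborel_section_window_measurable[OF IH(1), of t k]
    have mlebs: "mass lborel H t k \<omega> \<le> emeasure lborel (window t k)" for \<omega>
      using window_half_plane[of t k] by (intro emeasure_mono) (auto simp: sets_half_plane_iff)
    have mpsis: "\<omega> \<in> space M \<Longrightarrow> mass (\<psi> \<omega>) H t k \<omega> \<le> emeasure (\<psi> \<omega>) (window t k)" for \<omega>
      using window_half_plane[of t k] by (intro emeasure_mono) (auto simp: sets_psi)
    have fin: "(\<integral>\<^sup>+\<omega>. mass lborel H t k \<omega> \<partial>M) \<noteq> \<infinity>"
    proof -
      have "(\<integral>\<^sup>+\<omega>. mass lborel H t k \<omega> \<partial>M) \<le> (\<integral>\<^sup>+\<omega>. emeasure lborel (window t k) \<partial>M)"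
        using mlebs by (intro nn_integral_mono) auto
      also have "\<dots> < \<infinity>" using window_finite[of t k] by (simp add: emeasure_space_1)
      finally show ?thesis by simp
    qed
    have full: "(\<integral>\<^sup>+\<omega>. emeasure (\<psi> \<omega>) (window t k) \<partial>M) = (\<integral>\<^sup>+\<omega>. emeasure lborel (window t k) \<partial>M)"
    proof -
      have "(\<integral>\<^sup>+\<omega>. emeasure (\<psi> \<omega>) (window t k) \<partial>M) = (\<integral>\<^sup>+\<omega>. indicator (space M) \<omega> * emeasure (\<phi> \<omega>) (window t k) \<partial>M)"
        by (rule nn_integral_cong_AE) (use AE_prob_1[OF K_prob] AE_space in \<open>eventually_elim, simp add: \<psi>_def\<close>)
      also have "\<dots> = emeasure M (space M) * emeasure half_plane (window t k)"
        using window_finite by (intro nn_integral_indep_phi window_half_plane) (auto simp: emeasure_half_plane[OF window_half_plane] prob_space Int_absorb1)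
      also have "\<dots> = (\<integral>\<^sup>+\<omega>. emeasure lborel (window t k) \<partial>M)" by (simp add: emeasure_half_plane[OF window_half_plane] mult.commute)
      finally show ?thesis .
    qed
    have "(\<integral>\<^sup>+\<omega>. mass (\<psi> \<omega>) (W - H) t k \<omega> \<partial>M) =
        (\<integral>\<^sup>+\<omega>. emeasure (\<psi> \<omega>) (window t k) - mass (\<psi> \<omega>) H t k \<omega> \<partial>M)"
      by (intro nn_integral_cong p)
    also have "\<dots> = (\<integral>\<^sup>+\<omega>. emeasure (\<psi> \<omega>) (window t k) \<partial>M) - (\<integral>\<^sup>+\<omega>. mass (\<psi> \<omega>) H t k \<omega> \<partial>M)"
      using mpsi mpb fin IH(3)[OF t] mpsis by (intro nn_integral_diff) auto
    also have "\<dots> = (\<integral>\<^sup>+\<omega>. emeasure lborel (window t k) \<partial>M) - (\<integral>\<^sup>+\<omega>. mass lborel H t k \<omega> \<partial>M)"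
      using full IH(3)[OF t] by simp
    also have "\<dots> = (\<integral>\<^sup>+\<omega>. emeasure lborel (window t k) - mass lborel H t k \<omega> \<partial>M)"
      using mleb fin mlebs by (intro nn_integral_diff[symmetric]) auto
    also have "\<dots> = (\<integral>\<^sup>+\<omega>. mass lborel (W - H) t k \<omega> \<partial>M)"
      by (intro nn_integral_cong l[symmetric])
    finally show "(\<integral>\<^sup>+\<omega>. mass (\<psi> \<omega>) (W - H) t k \<omega> \<partial>M) = (\<integral>\<^sup>+\<omega>. mass lborel (W - H) t k \<omega> \<partial>M)" .
  qed
next
  case (union H)
  then have IH: "\<And>i. H i \<in> sets (M \<Otimes>\<^sub>M borel)"
    "\<And>i t k. 0 \<le> t \<Longrightarrow> (\<lambda>\<omega>. mass (\<psi> \<omega>) (H i) t k \<omega>) \<in> borel_measurable (G t)"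
    "\<And>i t k. 0 \<le> t \<Longrightarrow> (\<integral>\<^sup>+\<omega>. mass (\<psi> \<omega>) (H i) t k \<omega> \<partial>M) = (\<integral>\<^sup>+\<omega>. mass lborel (H i) t k \<omega> \<partial>M)"
    by auto
  show ?case
  proof (intro conjI allI impI)
    show "(\<Union>i. H i) \<in> sets (M \<Otimes>\<^sub>M borel)" using IH(1) by auto
    fix t :: real and k assume t: "0 \<le> t"
    have disj: "disjoint_family (\<lambda>i. Pair \<omega> -` H i \<inter> window t k)" for \<omega>
      using union(1) unfolding disjoint_family_on_def by blast
    have sec: "Pair \<omega> -` (\<Union>i. H i) \<inter> window t k = (\<Union>i. Pair \<omega> -` H i \<inter> window t k)" for \<omega> by auto
    have p: "mass (\<psi> \<omega>) (\<Union>i. H i) t k \<omega> = (\<Sum>i. mass (\<psi> \<omega>) (H i) t k \<omega>)" if "\<omega> \<in> space M" for \<omega>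
      unfolding sec using section_window[OF IH(1)] disj by (intro suminf_emeasure[symmetric]) (auto simp: sets_psi[OF that])
    have l: "mass lborel (\<Union>i. H i) t k \<omega> = (\<Sum>i. mass lborel (H i) t k \<omega>)" for \<omega>
      unfolding sec using section_window[OF IH(1)] disj by (intro suminf_emeasure[symmetric]) (auto simp: sets_half_plane_iff)
    have mleb: "(\<lambda>\<omega>. mass lborel (H i) t k \<omega>) \<in> borel_measurable M" for i
      by (rule lborel_section_window_measurable[OF IH(1)])
    have "(\<lambda>\<omega>. \<Sum>i. mass (\<psi> \<omega>) (H i) t k \<omega>) \<in> borel_measurable (G t)"
      using IH(2)[OF t] by measurable
    then show "(\<lambda>\<omega>. mass (\<psi> \<omega>) (\<Union>i. H i) t k \<omega>) \<in> borel_measurable (G t)"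
      by (subst measurable_cong[OF p]) auto
    have "(\<integral>\<^sup>+\<omega>. mass (\<psi> \<omega>) (\<Union>i. H i) t k \<omega> \<partial>M) = (\<Sum>i. \<integral>\<^sup>+\<omega>. mass (\<psi> \<omega>) (H i) t k \<omega> \<partial>M)"
      using IH(2)[OF t] by (subst nn_integral_suminf[symmetric]) (auto intro: G_borel_measurable nn_integral_cong p)
    also have "\<dots> = (\<Sum>i. \<integral>\<^sup>+\<omega>. mass lborel (H i) t k \<omega> \<partial>M)"
      using IH(3)[OF t] by simp
    also have "\<dots> = (\<integral>\<^sup>+\<omega>. mass lborel (\<Union>i. H i) t k \<omega> \<partial>M)"
      unfolding l using mleb by (rule nn_integral_suminf[symmetric])
    finally show "(\<integral>\<^sup>+\<omega>. mass (\<psi> \<omega>) (\<Union>i. H i) t k \<omega> \<partial>M) = (\<integral>\<^sup>+\<omega>. mass lborel (\<Union>i. H i) t k \<omega> \<partial>M)" .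
  qed
qed

lemma Pred_product: "H \<in> sets Pred \<Longrightarrow> H \<in> sets (M \<Otimes>\<^sub>M borel)"
  using Pred_window by blast

lemma Pred_section:
  assumes "H \<in> sets Pred"
  shows "Pair \<omega> -` H \<in> sets half_plane"
  using sets_Pair1[OF Pred_product[OF assms], of \<omega>] sets.sets_into_space[OF assms]
  by (auto simp: sets_half_plane_iff W_def)

lemma emeasure_window_SUP:
  assumes "A \<in> sets N" "sets N = sets half_plane \<or> sets N = sets borel" "A \<subseteq> {0<..} \<times> UNIV"
  shows "emeasure N A = (SUP k. emeasure N (A \<inter> window (real k) k))"
proof -
  have "(\<Union>k. A \<inter> window (real k) k) = A"
  proof -
    have "\<exists>k. p \<in> window (real k) k" if "p \<in> A" for p
    proof -
      obtain k :: nat where "max (fst p) \<bar>snd p\<bar> \<le> real k" using real_arch_simple by blast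
      then show ?thesis using that assms(3) by (cases p) (auto simp: window_def abs_le_iff intro!: exI[of _ k])
    qed
    then show ?thesis by blast
  qed
  moreover have "incseq (\<lambda>k. A \<inter> window (real k) k)" by (auto simp: incseq_def window_def)
  moreover have "A \<inter> window (real k) k \<in> sets N" for k
    using assms(1,2) window_half_plane[of "real k" k] by (auto simp: sets_half_plane_iff)
  ultimately show ?thesis using SUP_emeasure_incseq[of "\<lambda>k. A \<inter> window (real k) k" N] by (simp add: image_subset_iff)
qed

lemma Pred_adapted:
  assumes H: "H \<in> sets Pred" and t: "0 \<le> t"
  shows "(\<lambda>\<omega>. emeasure (\<psi> \<omega>) (Pair \<omega> -` H \<inter> {0<..t} \<times> UNIV)) \<in> borel_measurable (G t)"
proof -
  have "emeasure (\<psi> \<omega>) (Pair \<omega> -` H \<inter> {0<..t} \<times> UNIV) = (SUP k. emeasure (\<psi> \<omega>) (Pair \<omega> -` H \<inter> window t k))" if "\<omega> \<in> space M" for \<omega>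
  proof -
    have "(\<Union>k. Pair \<omega> -` H \<inter> window t k) = Pair \<omega> -` H \<inter> {0<..t} \<times> UNIV"
    proof -
      have "\<exists>k. v \<in> {- real k..real k}" for v
      proof -
        obtain k :: nat where "\<bar>v\<bar> \<le> real k" using real_arch_simple by blast
        then show ?thesis by (auto simp: abs_le_iff intro!: exI[of _ k])
      qed
      then show ?thesis by (fastforce simp: window_def)
    qed
    moreover have "incseq (\<lambda>k. Pair \<omega> -` H \<inter> window t k)" by (auto simp: incseq_def window_def)
    moreover have "Pair \<omega> -` H \<inter> window t k \<in> sets (\<psi> \<omega>)" for k
      using section_window[OF Pred_product[OF H]] by (simp add: sets_psi[OF that])
    ultimately show ?thesis using SUP_emeasure_incseq[of "\<lambda>k. Pair \<omega> -` H \<inter> window t k" "\<psi> \<omega>"] by (simp add: image_subset_iff)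
  qed
  moreover have "(\<lambda>\<omega>. SUP k. emeasure (\<psi> \<omega>) (Pair \<omega> -` H \<inter> window t k)) \<in> borel_measurable (G t)"
    using Pred_window[OF H] t by (intro borel_measurable_SUP) auto
  ultimately show ?thesis by (subst measurable_cong) auto
qed

text \<open>The windows increase to the whole open half-plane, and monotone convergence on both
  sides removes the finiteness restriction.\<close>

theorem compensation:
  assumes H: "H \<in> sets Pred"
  shows "(\<integral>\<^sup>+\<omega>. emeasure (\<psi> \<omega>) (Pair \<omega> -` H) \<partial>M) = (\<integral>\<^sup>+\<omega>. emeasure lborel (Pair \<omega> -` H) \<partial>M)"
proof -
  let ?S = "\<lambda>\<omega> k. Pair \<omega> -` H \<inter> window (real k) k"
  note s = Pred_section[OF H]
  have window_mono: "window (real k) k \<subseteq> window (real l) l" if "k \<le> l" for k l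
    using that by (auto simp: window_def)
  have sub: "Pair \<omega> -` H \<subseteq> {0<..} \<times> UNIV" for \<omega> using sets.sets_into_space[OF H] by (auto simp: W_def)
  have "(\<integral>\<^sup>+\<omega>. emeasure (\<psi> \<omega>) (Pair \<omega> -` H) \<partial>M) = (\<integral>\<^sup>+\<omega>. (SUP k. emeasure (\<psi> \<omega>) (?S \<omega> k)) \<partial>M)"
    using s sub by (intro nn_integral_cong emeasure_window_SUP) (auto simp: sets_psi)
  also have "\<dots> = (SUP k. \<integral>\<^sup>+\<omega>. emeasure (\<psi> \<omega>) (?S \<omega> k) \<partial>M)"
  proof (rule nn_integral_monotone_convergence_SUP_AE)
    show "AE \<omega> in M. emeasure (\<psi> \<omega>) (?S \<omega> k) \<le> emeasure (\<psi> \<omega>) (?S \<omega> (Suc k))" for k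
      using section_window[OF Pred_product[OF H]] window_mono[of k "Suc k"]
      by (intro AE_I2 emeasure_mono) (auto simp: sets_psi)
    show "(\<lambda>\<omega>. emeasure (\<psi> \<omega>) (?S \<omega> k)) \<in> borel_measurable M" for k
      using Pred_window[OF H] by (intro G_borel_measurable[of _ "real k"]) auto
  qed
  also have "\<dots> = (SUP k. \<integral>\<^sup>+\<omega>. emeasure lborel (?S \<omega> k) \<partial>M)"
    using Pred_window[OF H] by simp
  also have "\<dots> = (\<integral>\<^sup>+\<omega>. (SUP k. emeasure lborel (?S \<omega> k)) \<partial>M)"
  proof (rule nn_integral_monotone_convergence_SUP_AE[symmetric])
    show "AE \<omega> in M. emeasure lborel (?S \<omega> k) \<le> emeasure lborel (?S \<omega> (Suc k))" for k
      using section_window[OF Pred_product[OF H]] window_mono[of k "Suc k"]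
      by (intro AE_I2 emeasure_mono) (auto simp: sets_half_plane_iff)
    show "(\<lambda>\<omega>. emeasure lborel (?S \<omega> k)) \<in> borel_measurable M" for k
      using Pred_product[OF H] by (rule lborel_section_window_measurable)
  qed
  also have "\<dots> = (\<integral>\<^sup>+\<omega>. emeasure lborel (Pair \<omega> -` H) \<partial>M)"
    using s sub by (intro nn_integral_cong emeasure_window_SUP[symmetric]) (auto simp: sets_half_plane_iff)
  finally show ?thesis .
qed

end

section \<open>Predictability of the jumps\<close>

locale measurable_rates = interval_rates +
  assumes lam_measurable: "\<And>i j. (i, j) \<in> state_pairs \<Longrightarrow> (\<lambda>(y, n). lam i j y n) \<in> borel_measurable age_count"
    and lamt_measurable: "\<And>i j. (i, j) \<in> state_pairs \<Longrightarrow> (\<lambda>(y, n). lamt i j y n) \<in> borel_measurable age_count"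
begin

lemma age_measurable:
  assumes "(\<lambda>(y, n). f y n) \<in> borel_measurable age_count"
  shows "(\<lambda>y. if 0 \<le> y then f y n else 0 :: real) \<in> borel_measurable borel"
proof -
  have "(\<lambda>y. (y, n)) \<in> restrict_space lborel {0..} \<rightarrow>\<^sub>M age_count"
    unfolding age_count_def by (intro measurable_Pair) auto
  from measurable_compose[OF this assms] have "(\<lambda>y. f y n) \<in> borel_measurable (restrict_space lborel {0..})" by simp
  then have "(\<lambda>y. f y n * indicator {0..} y) \<in> borel_measurable lborel"
    by (subst (asm) borel_measurable_restrict_space_iff) (auto simp: mult.commute)
  moreover have "f y n * indicator {0..} y = (if 0 \<le> y then f y n else 0)" for y by simp
  ultimately show ?thesis by simp
qed

definition offset :: "nat \<Rightarrow> nat \<Rightarrow> nat \<Rightarrow> real \<Rightarrow> real" where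
  "offset i j n y = (if 0 \<le> y then \<Sum>\<^sub>\<infinity>(i', j')\<in>pair_predecessors prec i j. lamt i' j' y n else 0)"

text \<open>An infinite sum of nonnegative terms is at most a exactly if all its finite partial sums
  are. Only countably many finite sets of pairs exist, so the sublevel set is a countable
  intersection.\<close>

lemma offset_measurable:
  assumes ij: "(i, j) \<in> state_pairs"
  shows "offset i j n \<in> borel_measurable borel"
proof (rule borel_measurableI_le)
  fix a
  let ?P = "pair_predecessors prec i j"
  define \<F> where "\<F> = {\<A>. finite \<A> \<and> \<A> \<subseteq> ?P}"
  have sp: "p \<in> ?P \<Longrightarrow> p \<in> state_pairs" for p by (auto simp: pair_predecessors_def)
  let ?f = "\<lambda>y p. if 0 \<le> y then lamt (fst p) (snd p) y n else 0"
  have m: "(\<lambda>y. \<Sum>p\<in>\<A>. ?f y p) \<in> borel_measurable borel" if "\<A> \<in> \<F>" for \<A>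
  proof (rule borel_measurable_sum)
    fix p assume "p \<in> \<A>"
    then show "(\<lambda>y. ?f y p) \<in> borel_measurable borel"
      using that sp[of p] age_measurable[OF lamt_measurable[of "fst p" "snd p"]] by (auto simp: \<F>_def)
  qed
  have "offset i j n y \<le> a \<longleftrightarrow> (\<forall>\<A>\<in>\<F>. (\<Sum>p\<in>\<A>. ?f y p) \<le> a)" for y
  proof (cases "0 \<le> y")
    case True
    let ?g = "\<lambda>(i', j'). lamt i' j' y n"
    have su: "?g summable_on ?P" using lamt_summable[OF ij True] .
    have nn: "0 \<le> ?g p" if "p \<in> ?P" for p using lamt_nonneg sp[OF that] True by (cases p) auto
    have eq: "(\<Sum>p\<in>\<A>. ?f y p) = sum ?g \<A>" for \<A> using True by (auto simp: split_beta)
    show ?thesis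
    proof
      assume "offset i j n y \<le> a"
      moreover have "sum ?g \<A> \<le> infsum ?g ?P" if "\<A> \<in> \<F>" for \<A>
        using that nn by (intro finite_sum_le_infsum su) (auto simp: \<F>_def)
      ultimately show "\<forall>\<A>\<in>\<F>. (\<Sum>p\<in>\<A>. ?f y p) \<le> a" unfolding eq using True by (force simp: offset_def)
    next
      assume "\<forall>\<A>\<in>\<F>. (\<Sum>p\<in>\<A>. ?f y p) \<le> a"
      then have "infsum ?g ?P \<le> a" unfolding eq by (intro infsum_le_finite_sums su) (auto simp: \<F>_def)
      then show "offset i j n y \<le> a" using True by (simp add: offset_def)
    qed
  next
    case False
    have "{} \<in> \<F>" by (simp add: \<F>_def)
    then show ?thesis using False by (auto simp: offset_def)
  qed
  then have "{y \<in> space borel. offset i j n y \<le> a} = (\<Inter>\<A>\<in>\<F>. {y. (\<Sum>p\<in>\<A>. ?f y p) \<le> a})" by auto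
  also have "\<dots> \<in> sets borel"
  proof (rule sets.countable_INT'')
    show "UNIV \<in> sets (borel :: real measure)" by simp
    show "countable \<F>" unfolding \<F>_def by (rule countable_Collect_finite_subset) simp
    fix \<A> assume "\<A> \<in> \<F>"
    from m[OF this] show "{y. (\<Sum>p\<in>\<A>. ?f y p) \<le> a} \<in> sets borel" by measurable
  qed
  finally show "{y \<in> space borel. offset i j n y \<le> a} \<in> sets borel" .
qed

definition rate :: "nat \<Rightarrow> nat \<Rightarrow> nat \<Rightarrow> real \<Rightarrow> real" where
  "rate i j n y = (if 0 \<le> y then lam i j y n else 0)"

lemma rate_measurable: "(i, j) \<in> state_pairs \<Longrightarrow> rate i j n \<in> borel_measurable borel"
  unfolding rate_def[abs_def] by (rule age_measurable[OF lam_measurable])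

lemma rate_nonneg: "(i, j) \<in> state_pairs \<Longrightarrow> 0 \<le> rate i j n y"
  using lam_nonneg by (simp add: rate_def)

lemma Lam_eq: "0 \<le> y \<Longrightarrow> Lam prec lam lamt i j y n = {offset i j n y..<offset i j n y + rate i j n y}"
proof -
  have "(\<lambda>b. c + b) ` {0..<d} = {c..<c + d}" for c d :: real
    using image_add_atLeastLessThan[of c 0 d] by (simp add: add.commute)
  then show "0 \<le> y \<Longrightarrow> ?thesis" by (simp add: Lam_def offset_def rate_def)
qed

abbreviation (input) Lam_graph :: "nat \<Rightarrow> nat \<Rightarrow> nat \<Rightarrow> (real \<times> real) set" where
  "Lam_graph i j n \<equiv> {p. 0 \<le> fst p \<and> snd p \<in> Lam prec lam lamt i j (fst p) n}"

lemma Lam_graph_measurable: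
  assumes "(i, j) \<in> state_pairs"
  shows "Lam_graph i j n \<in> sets (borel \<Otimes>\<^sub>M borel)"
proof -
  have [measurable]: "offset i j n \<in> borel_measurable borel" "rate i j n \<in> borel_measurable borel"
    using assms by (auto intro: offset_measurable rate_measurable)
  have "{p \<in> space (borel \<Otimes>\<^sub>M borel). 0 \<le> fst p \<and> offset i j n (fst p) \<le> snd p \<and> snd p < offset i j n (fst p) + rate i j n (fst p)}
    \<in> sets (borel \<Otimes>\<^sub>M borel)" by measurable
  also have "{p \<in> space (borel \<Otimes>\<^sub>M borel). 0 \<le> fst p \<and> offset i j n (fst p) \<le> snd p \<and> snd p < offset i j n (fst p) + rate i j n (fst p)} =
    Lam_graph i j n" by (auto simp: Lam_eq space_pair_measure)
  finally show ?thesis .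
qed

end

section \<open>Jump times, ages and marks as functions of the random measure\<close>

locale semi_markov = poisson_filtration M \<phi> S0 K + measurable_rates prec lam lamt
  for M :: "'a measure" and \<phi> S0 K prec lam lamt +
  fixes X0 :: "'a \<Rightarrow> nat" and Y0 :: "'a \<Rightarrow> real"
    and X :: "real \<Rightarrow> 'a \<Rightarrow> nat" and Y :: "real \<Rightarrow> 'a \<Rightarrow> real" and N :: "real \<Rightarrow> 'a \<Rightarrow> nat"
  assumes path: "\<And>\<omega>. \<omega> \<in> K \<Longrightarrow>
      path_solution prec lam lamt (\<phi> \<omega>) (X0 \<omega>) (Y0 \<omega>) (\<lambda>t. X t \<omega>) (\<lambda>t. Y t \<omega>) (\<lambda>t. N t \<omega>)"
    and X0_S0: "\<And>i. {\<omega> \<in> space M. X0 \<omega> = i} \<in> S0"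
    and Y0_S0: "\<And>a. {\<omega> \<in> space M. a < Y0 \<omega>} \<in> S0"
begin

definition T :: "nat \<Rightarrow> 'a \<Rightarrow> ereal" where
  "T n \<omega> = jump_time X Y0 n \<omega>"

definition J :: "nat \<Rightarrow> 'a \<Rightarrow> nat" where
  "J n \<omega> = X (max 0 (real_of_ereal (T n \<omega>))) \<omega>"

lemma K_space: "\<omega> \<in> K \<Longrightarrow> \<omega> \<in> space M"
  using K_event sets.sets_into_space by blast

lemma psi_K: "\<omega> \<in> K \<Longrightarrow> \<psi> \<omega> = \<phi> \<omega>"
  by (simp add: \<psi>_def)

lemma T_path:
  assumes "\<omega> \<in> K"
  shows "path_solution.T (Y0 \<omega>) (\<lambda>t. X t \<omega>) n = T n \<omega>"
proof -
  interpret P: path_solution prec lam lamt "\<phi> \<omega>" "X0 \<omega>" "Y0 \<omega>" "\<lambda>t. X t \<omega>" "\<lambda>t. Y t \<omega>" "\<lambda>t. N t \<omega>"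
    using path[OF assms] .
  show ?thesis unfolding P.T_def T_def by (induction n) simp_all
qed

lemma T_cases:
  assumes "\<omega> \<in> K"
  obtains "T n \<omega> = \<infinity>" "T (Suc n) \<omega> = \<infinity>" |
    t where "T n \<omega> = ereal t" "n = 0 \<and> t = - Y0 \<omega> \<or> 0 < n \<and> 0 < t" "J n \<omega> = X (max 0 t) \<omega>" "J n \<omega> \<in> states"
proof -
  interpret P: path_solution prec lam lamt "\<phi> \<omega>" "X0 \<omega>" "Y0 \<omega>" "\<lambda>t. X t \<omega>" "\<lambda>t. Y t \<omega>" "\<lambda>t. N t \<omega>"
    using path[OF assms] .
  note at = P.at_jump_time[of n, unfolded T_path[OF assms]]
  show thesis
  proof (cases "T n \<omega> = \<infinity>")
    case True
    then have "T (Suc n) \<omega> = Inf {}" unfolding T_def by (auto intro!: arg_cong[where f=Inf])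
    then show ?thesis using True that(1) by (simp add: top_ereal_def)
  next
    case False
    then obtain t where "T n \<omega> = ereal t" "n = 0 \<and> t = - Y0 \<omega> \<or> 0 < n \<and> 0 < t" using at by blast
    then show ?thesis using that(2) P.x_states[of "max 0 t"] by (simp add: J_def)
  qed
qed

lemma next_jump_cases:
  assumes "\<omega> \<in> K" "T n \<omega> = ereal t"
  obtains "T (Suc n) \<omega> = \<infinity>"
      "{(u, v). max 0 t < u \<and> v \<in> Lams (J n \<omega>) (u - t) n} \<in> null_sets (\<psi> \<omega>)" |
    t' v where "T (Suc n) \<omega> = ereal t'" "max 0 t < t'" "J (Suc n) \<omega> \<in> states - {J n \<omega>}"
      "v \<in> Lam prec lam lamt (J n \<omega>) (J (Suc n) \<omega>) (t' - t) n"
      "emeasure (\<psi> \<omega>) {(t', v)} = 1" "{t'} \<times> (- {v}) \<in> null_sets (\<psi> \<omega>)"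
      "{(u, v). max 0 t < u \<and> u < t' \<and> v \<in> Lams (J n \<omega>) (u - t) n} \<in> null_sets (\<psi> \<omega>)"
proof -
  interpret P: path_solution prec lam lamt "\<phi> \<omega>" "X0 \<omega>" "Y0 \<omega>" "\<lambda>t. X t \<omega>" "\<lambda>t. Y t \<omega>" "\<lambda>t. N t \<omega>"
    using path[OF assms(1)] .
  note so = P.sojourn[of n, unfolded T_path[OF assms(1)], OF assms(2) refl]
  have Jn: "J n \<omega> = X (max 0 t) \<omega>" by (simp add: J_def assms)
  consider "T (Suc n) \<omega> = \<infinity>" | t' where "max 0 t < t'" "T (Suc n) \<omega> = ereal t'" using so(3) by blast
  then show thesis
  proof cases
    case 1
    then show ?thesis using that(1) so(1) by (simp add: Jn psi_K[OF assms(1)])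
  next
    case 2
    then have J': "J (Suc n) \<omega> = X t' \<omega>" by (simp add: J_def)
    from so(2)[OF 2(2)] obtain v where v: "X t' \<omega> \<in> states - {X (max 0 t) \<omega>}"
      "v \<in> Lam prec lam lamt (X (max 0 t) \<omega>) (X t' \<omega>) (t' - t) n" "P.atom t' v" by blast
    have "{t'} \<times> (- {v}) \<in> sets (\<phi> \<omega>)"
      using 2(1) P.sets_mu by (simp add: sets_half_plane_iff) (auto intro!: Times_sets_borel)
    then show ?thesis using that(2)[OF 2(2,1)] v so(1)
      by (simp add: Jn J' psi_K[OF assms(1)] 2 P.atom_def null_sets_def)
  qed
qed

lemma T_Suc_pos: "\<omega> \<in> K \<Longrightarrow> 0 < T (Suc n) \<omega>"
  by (erule T_cases[of _ "Suc n"]) (auto simp: zero_ereal_def[symmetric] simp del: zero_ereal_def)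

text \<open>The value is 0 up to and including \<open>T n\<close>, which makes the function
  left-continuous in time, as predictability demands.\<close>

definition age :: "nat \<Rightarrow> 'a \<times> real \<times> real \<Rightarrow> real" where
  "age n = (\<lambda>(\<omega>, u, v). if \<omega> \<in> K \<and> T n \<omega> < ereal u then u - real_of_ereal (T n \<omega>) else 0)"

definition after :: "nat \<Rightarrow> nat \<Rightarrow> ('a \<times> real \<times> real) set" where
  "after n i = {(\<omega>, u, v). 0 < u \<and> \<omega> \<in> K \<and> T n \<omega> < ereal u \<and> J n \<omega> = i}"

text \<open>Not cut off at the next jump: the predictability of these sets is used to derive that of
  the next jump time, so it must not presuppose it.\<close>

definition marks :: "nat \<Rightarrow> nat \<Rightarrow> nat \<Rightarrow> ('a \<times> real \<times> real) set" where
  "marks n i j = {(\<omega>, u, v). (\<omega>, u, v) \<in> after n i \<and> v \<in> Lam prec lam lamt i j (age n (\<omega>, u, v)) n}"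

text \<open>The next jump time itself is included, so that the atom causing the jump is kept. In
  time the set is a left-open, right-closed interval, and on \<open>K\<close> it says that
  \<open>age (Suc n)\<close> is still 0.\<close>

definition before_next :: "nat \<Rightarrow> ('a \<times> real \<times> real) set" where
  "before_next n = {(\<omega>, u, v). 0 < u \<and> \<omega> \<in> K \<and> ereal u \<le> T (Suc n) \<omega>}"

definition next_marks :: "nat \<Rightarrow> nat \<Rightarrow> nat \<Rightarrow> ('a \<times> real \<times> real) set" where
  "next_marks n i j = marks n i j \<inter> before_next n"

lemma age_nonneg: "0 \<le> age n w"
proof -
  obtain \<omega> u v where w: "w = (\<omega>, u, v)" by (cases w)
  show ?thesis
  proof (cases "\<omega> \<in> K \<and> T n \<omega> < ereal u")
    case True
    then have "\<omega> \<in> K" by simp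
    then show ?thesis by (rule T_cases[of _ n]) (use True in \<open>auto simp: w age_def\<close>)
  qed (auto simp: w age_def)
qed

lemma section_marks:
  assumes "\<omega> \<in> K" "T n \<omega> = ereal t"
  shows "Pair \<omega> -` marks n i j = (if J n \<omega> = i then {(u, v). max 0 t < u \<and> v \<in> Lam prec lam lamt i j (u - t) n} else {})"
  using assms by (auto simp: marks_def after_def age_def)

lemma section_infinite:
  assumes "\<omega> \<in> K" "T n \<omega> = \<infinity>"
  shows "Pair \<omega> -` marks n i j = {}"
  using assms by (auto simp: marks_def after_def)

lemma time_Pred: "(\<lambda>(\<omega>, u, v). u) \<in> borel_measurable Pred"
proof (rule borel_measurableI_greater)
  fix a :: real
  have "{w \<in> space Pred. a < (\<lambda>(\<omega>, u, v). u) w} = space M \<times> {max 0 a<..} \<times> UNIV" by (auto simp: W_def)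
  also have "\<dots> \<in> sets Pred" by (rule pred_genI) (auto intro: sets.top[of "G _", unfolded space_G])
  finally show "{w \<in> space Pred. a < (\<lambda>(\<omega>, u, v). u) w} \<in> sets Pred" .
qed

lemma mark_Pred: "(\<lambda>(\<omega>, u, v). v) \<in> borel_measurable Pred"
proof (rule measurableI)
  fix B :: "real set" assume "B \<in> sets borel"
  then have "space M \<times> {0<..} \<times> B \<in> sets Pred" by (intro pred_genI) (auto intro: sets.top[of "G _", unfolded space_G])
  moreover have "(\<lambda>(\<omega>, u, v). v) -` B \<inter> space Pred = space M \<times> {0<..} \<times> B" by (auto simp: W_def)
  ultimately show "(\<lambda>(\<omega>, u, v). v) -` B \<inter> space Pred \<in> sets Pred" by simp
qed simp

lemma Y0_Pred: "(\<lambda>(\<omega>, u, v). Y0 \<omega>) \<in> borel_measurable Pred"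
proof (rule borel_measurableI_greater)
  fix a :: real
  have "{w \<in> space Pred. a < (\<lambda>(\<omega>, u, v). Y0 \<omega>) w} = {\<omega> \<in> space M. a < Y0 \<omega>} \<times> {0<..} \<times> UNIV" by (auto simp: W_def)
  also have "\<dots> \<in> sets Pred" by (rule pred_genI) (auto intro: S0_G Y0_S0)
  finally show "{w \<in> space Pred. a < (\<lambda>(\<omega>, u, v). Y0 \<omega>) w} \<in> sets Pred" .
qed

lemma K_Pred: "K \<times> {0<..} \<times> UNIV \<in> sets Pred"
  by (rule pred_genI) (auto intro: full_G K_event K_prob)

lemma marks_Pred:
  assumes "age n \<in> borel_measurable Pred" "after n i \<in> sets Pred" "(i, j) \<in> state_pairs"
  shows "marks n i j \<in> sets Pred"
proof -
  have "(\<lambda>w. (age n w, (\<lambda>(\<omega>, u, v). v) w)) \<in> Pred \<rightarrow>\<^sub>M borel \<Otimes>\<^sub>M borel"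
    using assms(1) mark_Pred by (intro measurable_Pair)
  from measurable_sets[OF this Lam_graph_measurable[OF assms(3)]]
  have "(\<lambda>w. (age n w, (\<lambda>(\<omega>, u, v). v) w)) -` Lam_graph i j n \<inter> W \<in> sets Pred" by simp
  moreover have "marks n i j = after n i \<inter> ((\<lambda>w. (age n w, (\<lambda>(\<omega>, u, v). v) w)) -` Lam_graph i j n \<inter> W)"
    using age_nonneg K_space by (auto simp: marks_def after_def W_def)
  ultimately show ?thesis using assms(2) by auto
qed

text \<open>The part of \<open>A\<close> before the next jump is null, and on the line over that
  jump only the atom counts. The mass is therefore decided by whether the atom lies in
  \<open>A\<close>.\<close>

lemma marks_measure:
  assumes "\<omega> \<in> K" "T n \<omega> = ereal t" "A \<in> sets half_plane"
    and A: "A \<subseteq> {(u, v). max 0 t < u \<and> ereal u \<le> T (Suc n) \<omega> \<and> v \<in> Lams (J n \<omega>) (u - t) n}"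
  obtains "T (Suc n) \<omega> = \<infinity>" "emeasure (\<psi> \<omega>) A = 0" |
    t' v where "T (Suc n) \<omega> = ereal t'" "max 0 t < t'" "J (Suc n) \<omega> \<in> states - {J n \<omega>}"
      "v \<in> Lam prec lam lamt (J n \<omega>) (J (Suc n) \<omega>) (t' - t) n"
      "emeasure (\<psi> \<omega>) A = indicator A (t', v)"
  using assms(1,2)
proof (rule next_jump_cases)
  assume n: "T (Suc n) \<omega> = \<infinity>" "{(u, v). max 0 t < u \<and> v \<in> Lams (J n \<omega>) (u - t) n} \<in> null_sets (\<psi> \<omega>)"
  have "A \<subseteq> {(u, v). max 0 t < u \<and> v \<in> Lams (J n \<omega>) (u - t) n}" using A by auto
  from emeasure_mono[OF this, of "\<psi> \<omega>"] have "emeasure (\<psi> \<omega>) A = 0" using n(2) by (auto simp: null_sets_def)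
  then show thesis using that(1) n(1) by simp
next
  fix t' v assume n: "T (Suc n) \<omega> = ereal t'" "max 0 t < t'" "J (Suc n) \<omega> \<in> states - {J n \<omega>}"
      "v \<in> Lam prec lam lamt (J n \<omega>) (J (Suc n) \<omega>) (t' - t) n"
    and one: "emeasure (\<psi> \<omega>) {(t', v)} = 1" and null: "{t'} \<times> (- {v}) \<in> null_sets (\<psi> \<omega>)"
      "{(u, v). max 0 t < u \<and> u < t' \<and> v \<in> Lams (J n \<omega>) (u - t) n} \<in> null_sets (\<psi> \<omega>)" (is "?N \<in> _")
  have As: "A \<in> sets (\<psi> \<omega>)" using assms(3) K_space[OF assms(1)] by (simp add: sets_psi)
  have ps: "{(t', v)} \<in> sets (\<psi> \<omega>)" by (metis emeasure_notin_sets one zero_neq_one)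
  have Nu: "?N \<union> {t'} \<times> (- {v}) \<in> null_sets (\<psi> \<omega>)" using null by (intro null_sets.Un)
  have "A - {(t', v)} \<subseteq> ?N \<union> {t'} \<times> (- {v})"
  proof
    fix p assume p: "p \<in> A - {(t', v)}"
    with A n(1) have "max 0 t < fst p" "fst p \<le> t'" "snd p \<in> Lams (J n \<omega>) (fst p - t) n" by auto
    then show "p \<in> ?N \<union> {t'} \<times> (- {v})" using p by (cases p; cases "fst p = t'") (simp_all add: le_less)
  qed
  then have N: "A - {(t', v)} \<in> null_sets (\<psi> \<omega>)"
    using Nu As ps by (intro null_sets_subset[OF Nu]) auto
  have "emeasure (\<psi> \<omega>) A = indicator A (t', v)"
  proof (cases "(t', v) \<in> A")
    case True
    then have "A = {(t', v)} \<union> (A - {(t', v)})" by auto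
    then have "emeasure (\<psi> \<omega>) A = emeasure (\<psi> \<omega>) {(t', v)}"
      using emeasure_Un_null_set[OF ps N] by simp
    then show ?thesis using one True by simp
  next
    case False
    then show ?thesis using N by (simp add: null_sets_def)
  qed
  then show thesis using that(2)[OF n] by blast
qed

abbreviation (input) all_marks :: "nat \<Rightarrow> ('a \<times> real \<times> real) set" where
  "all_marks n \<equiv> (\<Union>i\<in>states. \<Union>j\<in>states - {i}. marks n i j)"

lemma marks_all_Pred:
  assumes "\<And>i j. (i, j) \<in> state_pairs \<Longrightarrow> marks n i j \<in> sets Pred"
  shows "all_marks n \<in> sets Pred"
  using assms by (intro sets.countable_UN'') (auto simp: state_pairs_def)

lemma section_all_marks:
  assumes "\<omega> \<in> K" "T n \<omega> = ereal t" "J n \<omega> \<in> states"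
  shows "Pair \<omega> -` all_marks n =
    {(u, v). max 0 t < u \<and> v \<in> Lams (J n \<omega>) (u - t) n}"
  using assms(3) by (auto simp: vimage_UN section_marks[OF assms(1,2)] Lams_def split: if_splits)

text \<open>No mark has mass before the next jump, and one has mass 1 at it. As the left-hand side
  is adapted for predictable marks, the next jump time becomes a stopping time of
  \<open>G\<close>.\<close>

lemma next_jump_before:
  assumes K: "\<omega> \<in> K" and m: "\<And>i j. (i, j) \<in> state_pairs \<Longrightarrow> marks n i j \<in> sets Pred"
  shows "0 < emeasure (\<psi> \<omega>) (Pair \<omega> -` all_marks n \<inter> {0<..q} \<times> UNIV)
    \<longleftrightarrow> T (Suc n) \<omega> \<le> ereal q" (is "0 < emeasure _ (?S \<inter> ?Q) \<longleftrightarrow> _")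
  using K
proof (rule T_cases[of _ n])
  assume "T n \<omega> = \<infinity>" "T (Suc n) \<omega> = \<infinity>"
  then show ?thesis using section_infinite[OF K] by (auto simp: vimage_UN)
next
  fix t assume t: "T n \<omega> = ereal t" "J n \<omega> \<in> states"
  note sec = section_all_marks[OF K t]
  have Ss: "?S \<in> sets half_plane" using Pred_section[OF marks_all_Pred[OF m]] by simp
  have strip: "{0<..r} \<times> UNIV \<in> sets half_plane" for r :: real by (auto simp: sets_half_plane_iff)
  have Q: "?S \<inter> ?Q \<in> sets half_plane" using Ss strip by blast
  show ?thesis
  proof (cases "ereal q < T (Suc n) \<omega>")
    case True
    have "?S \<inter> ?Q \<subseteq> {(u, v). max 0 t < u \<and> ereal u \<le> T (Suc n) \<omega> \<and> v \<in> Lams (J n \<omega>) (u - t) n}"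
      unfolding sec using True by (auto intro!: less_imp_le[OF le_less_trans[OF _ True]])
    from marks_measure[OF K t(1) Q this] have "emeasure (\<psi> \<omega>) (?S \<inter> ?Q) = 0"
      by (rule, simp, use True in \<open>auto simp: indicator_def\<close>)
    then show ?thesis using True by simp
  next
    case False
    then obtain t' where t': "T (Suc n) \<omega> = ereal t'" "t' \<le> q"
      using T_Suc_pos[OF K, of n] by (cases "T (Suc n) \<omega>") auto
    \<comment> \<open>Beyond the next jump the marks of the old sojourn may carry further mass, so
      the exact value is computed only up to t' and then used as a lower bound.\<close>
    let ?A = "?S \<inter> {0<..t'} \<times> UNIV"
    have A: "?A \<in> sets half_plane" using Ss strip by blast
    have "?A \<subseteq> {(u, v). max 0 t < u \<and> ereal u \<le> T (Suc n) \<omega> \<and> v \<in> Lams (J n \<omega>) (u - t) n}"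
      unfolding sec using t' by auto
    from marks_measure[OF K t(1) A this] have "emeasure (\<psi> \<omega>) ?A = 1"
    proof cases
      case (2 r v)
      then have "(r, v) \<in> ?A" unfolding sec using t' by (auto simp: Lams_def)
      then show ?thesis using 2 by simp
    qed (use t' in simp)
    moreover have "emeasure (\<psi> \<omega>) ?A \<le> emeasure (\<psi> \<omega>) (?S \<inter> ?Q)"
      using t'(2) Q K_space[OF K] by (intro emeasure_mono) (auto simp: sets_psi)
    ultimately show ?thesis using False by (auto simp: not_less intro: less_le_trans[of 0 1])
  qed
qed

text \<open>Here the cut at the next jump is essential: a later atom may fall into the old interval
  of j without leading to j. Of the marks kept only the jump atom has mass, and disjointness of the
  intervals identifies its target.\<close>

lemma next_state_before:
  assumes K: "\<omega> \<in> K" and j: "j \<in> states" and m: "(\<Union>i\<in>states - {j}. next_marks n i j) \<in> sets Pred"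
  shows "0 < emeasure (\<psi> \<omega>) (Pair \<omega> -` (\<Union>i\<in>states - {j}. next_marks n i j) \<inter> {0<..q} \<times> UNIV)
    \<longleftrightarrow> T (Suc n) \<omega> \<le> ereal q \<and> J (Suc n) \<omega> = j" (is "0 < emeasure _ (?S \<inter> ?Q) \<longleftrightarrow> _")
  using K
proof (rule T_cases[of _ n])
  assume "T n \<omega> = \<infinity>" "T (Suc n) \<omega> = \<infinity>"
  then show ?thesis using section_infinite[OF K] by (auto simp: vimage_UN next_marks_def)
next
  fix t assume t: "T n \<omega> = ereal t" "J n \<omega> \<in> states" "n = 0 \<and> t = - Y0 \<omega> \<or> 0 < n \<and> 0 < t"
  have sec: "?S = (if J n \<omega> = j then {} else {(u, v). max 0 t < u \<and> ereal u \<le> T (Suc n) \<omega> \<and> v \<in> Lam prec lam lamt (J n \<omega>) j (u - t) n})"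
    using t(2) K by (auto simp: vimage_UN next_marks_def section_marks[OF K t(1)] before_next_def split: if_splits)
  have Q: "?S \<inter> ?Q \<in> sets half_plane"
    using Pred_section[OF m, of \<omega>] by (intro sets.Int) (auto simp: sets_half_plane_iff)
  have "?S \<inter> ?Q \<subseteq> {(u, v). max 0 t < u \<and> ereal u \<le> T (Suc n) \<omega> \<and> v \<in> Lams (J n \<omega>) (u - t) n}"
    unfolding sec using j by (auto simp: Lams_def)
  from marks_measure[OF K t(1) Q this] show ?thesis
  proof cases
    case (2 t' v)
    have "0 \<le> t' - t" using 2(2) by simp
    then have "v \<in> Lam prec lam lamt (J n \<omega>) j (t' - t) n \<longleftrightarrow> J (Suc n) \<omega> = j" if "j \<noteq> J n \<omega>"
      using Lam_disjoint[OF t(2) 2(3) _ _ 2(4), of j] 2(4) that j by auto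
    then have "(t', v) \<in> ?S \<inter> ?Q \<longleftrightarrow> t' \<le> q \<and> J (Suc n) \<omega> = j" unfolding sec using 2 by auto
    then show ?thesis using 2 by (auto simp: indicator_def)
  qed simp
qed

lemma G_positive: "H \<in> sets Pred \<Longrightarrow> 0 \<le> q \<Longrightarrow>
    {\<omega> \<in> K. 0 < emeasure (\<psi> \<omega>) (Pair \<omega> -` H \<inter> {0<..q} \<times> UNIV)} \<in> sets (G q)"
proof -
  assume "H \<in> sets Pred" "0 \<le> q"
  from Pred_adapted[OF this] have [measurable]: "(\<lambda>\<omega>. emeasure (\<psi> \<omega>) (Pair \<omega> -` H \<inter> {0<..q} \<times> UNIV)) \<in> borel_measurable (G q)" .
  have "{\<omega> \<in> space (G q). 0 < emeasure (\<psi> \<omega>) (Pair \<omega> -` H \<inter> {0<..q} \<times> UNIV)} \<inter> K \<in> sets (G q)"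
    using full_G[OF K_event K_prob, of q] by (intro sets.Int) measurable
  also have "{\<omega> \<in> space (G q). 0 < emeasure (\<psi> \<omega>) (Pair \<omega> -` H \<inter> {0<..q} \<times> UNIV)} \<inter> K =
    {\<omega> \<in> K. 0 < emeasure (\<psi> \<omega>) (Pair \<omega> -` H \<inter> {0<..q} \<times> UNIV)}" using K_space by auto
  finally show ?thesis .
qed

lemma before_next_Pred:
  assumes "age (Suc n) \<in> borel_measurable Pred"
  shows "before_next n \<in> sets Pred"
proof -
  have "before_next n = {w \<in> space Pred. age (Suc n) w \<le> 0} \<inter> (K \<times> {0<..} \<times> UNIV)"
  proof -
    have "ereal u \<le> T (Suc n) \<omega> \<longleftrightarrow> age (Suc n) (\<omega>, u, v) \<le> 0" if "\<omega> \<in> K" for \<omega> u v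
      using T_Suc_pos[OF that, of n] that by (cases "T (Suc n) \<omega>") (auto simp: age_def)
    then show ?thesis using K_space by (auto simp: before_next_def W_def)
  qed
  also have "\<dots> \<in> sets Pred" using assms K_Pred by (intro sets.Int) measurable
  finally show ?thesis .
qed

text \<open>The order within the induction step is forced: the uncut marks give the time
  \<open>T (Suc n)\<close> and thereby its age, the age gives the cut \<open>before_next n\<close>,
  and only the cut marks give the state \<open>J (Suc n)\<close>.\<close>

lemma predictable:
  "age n \<in> borel_measurable Pred \<and> (\<forall>i\<in>states. after n i \<in> sets Pred)"
proof (induction n)
  case 0
  have T0: "T 0 \<omega> = - ereal (Y0 \<omega>)" for \<omega> by (simp add: T_def)
  have Y0: "0 \<le> Y0 \<omega>" if "\<omega> \<in> K" for \<omega> using path[OF that] by (simp add: path_solution_def path_solution_axioms_def)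
  have X0: "J 0 \<omega> = X0 \<omega>" if "\<omega> \<in> K" for \<omega>
    using path_solution.initial_values(1)[OF path[OF that]] Y0[OF that] by (simp add: J_def T0 max_def)
  show ?case
  proof (intro conjI ballI)
    have "(\<lambda>w. indicator (K \<times> {0<..} \<times> UNIV) w * ((\<lambda>(\<omega>, u, v). u) w + (\<lambda>(\<omega>, u, v). Y0 \<omega>) w)) \<in> borel_measurable Pred"
      using K_Pred time_Pred Y0_Pred by measurable
    then show "age 0 \<in> borel_measurable Pred"
    proof (rule measurable_cong[THEN iffD1, rotated])
      fix w assume "w \<in> space Pred"
      then obtain \<omega> u v where w: "w = (\<omega>, u, v)" "0 < u" "\<omega> \<in> space M" by (auto simp: W_def)
      show "indicator (K \<times> {0<..} \<times> UNIV) w * ((\<lambda>(\<omega>, u, v). u) w + (\<lambda>(\<omega>, u, v). Y0 \<omega>) w) = age 0 w"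
        using Y0[of \<omega>] w by (cases "\<omega> \<in> K") (auto simp: age_def T0)
    qed
    fix i
    have "after 0 i = ({\<omega> \<in> space M. X0 \<omega> = i} \<inter> K) \<times> {0<..} \<times> UNIV"
      using Y0 X0 K_space by (auto simp: after_def T0 intro: le_less_trans[of "- Y0 _" 0])
    also have "\<dots> \<in> sets Pred"
      by (intro pred_genI sets.Int S0_G X0_S0 full_G K_event K_prob) auto
    finally show "after 0 i \<in> sets Pred" .
  qed
next
  case (Suc n)
  have m: "marks n i j \<in> sets Pred" if "(i, j) \<in> state_pairs" for i j
    using Suc that by (intro marks_Pred) (auto simp: state_pairs_def)
  have TG: "{\<omega> \<in> K. T (Suc n) \<omega> \<le> ereal q} \<in> sets (G q)" if "0 \<le> q" for q
    using G_positive[OF marks_all_Pred[OF m] that] next_jump_before[OF _ m] by (simp cong: conj_cong)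
  have age: "age (Suc n) \<in> borel_measurable Pred"
  proof (rule borel_measurableI_greater)
    fix a :: real
    show "{w \<in> space Pred. a < age (Suc n) w} \<in> sets Pred"
    proof (cases "0 \<le> a")
      case True
      \<comment> \<open>A rational q between the jump time and u - a separates the condition on the
        past from that on u. The base then lies in \<open>G q\<close>, hence in
        \<open>G (q + a)\<close>, since a is nonnegative here.\<close>
      have "{w \<in> space Pred. a < age (Suc n) w} =
        (\<Union>q\<in>\<rat> \<inter> {0<..}. {\<omega> \<in> K. T (Suc n) \<omega> \<le> ereal q} \<times> {q + a<..} \<times> UNIV)" (is "?L = ?R")
      proof (rule Set.set_eqI, rule iffI)
        fix w assume "w \<in> ?L"
        then obtain \<omega> u v where w: "w = (\<omega>, u, v)" "\<omega> \<in> K" "T (Suc n) \<omega> < ereal u" "a < u - real_of_ereal (T (Suc n) \<omega>)"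
          using True by (cases w) (auto simp: age_def split: if_splits)
        then obtain t' where t': "T (Suc n) \<omega> = ereal t'" "0 < t'" using T_Suc_pos[of \<omega> n] by (cases "T (Suc n) \<omega>") auto
        then obtain q where "q \<in> \<rat>" "t' < q" "q < u - a" using Rats_dense_in_real[of t' "u - a"] w by auto
        then show "w \<in> ?R" using w t' by (auto intro!: bexI[of _ q])
      next
        fix w assume "w \<in> ?R"
        then obtain \<omega> u v q where w: "w = (\<omega>, u, v)" "\<omega> \<in> K" "T (Suc n) \<omega> \<le> ereal q" "q + a < u" "0 < q" by auto
        then show "w \<in> ?L" using T_Suc_pos[of \<omega> n] True K_space[of \<omega>]
          by (cases "T (Suc n) \<omega>") (auto simp: age_def W_def)
      qed
      also have "\<dots> \<in> sets Pred"
      proof (rule sets.countable_UN'')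
        show "countable (\<rat> \<inter> {0<..} :: real set)" using countable_rat by (rule countable_subset[rotated]) auto
        fix q :: real assume "q \<in> \<rat> \<inter> {0<..}"
        then show "{\<omega> \<in> K. T (Suc n) \<omega> \<le> ereal q} \<times> {q + a<..} \<times> UNIV \<in> sets Pred"
          using TG[of q] G_mono[of q "q + a"] True by (intro pred_genI) auto
      qed
      finally show ?thesis .
    next
      case False
      then have "{w \<in> space Pred. a < age (Suc n) w} = space Pred" using age_nonneg by (auto intro: less_le_trans[of a 0])
      then show ?thesis by (simp only: sets.top)
    qed
  qed
  show ?case
  proof (intro conjI ballI age)
    fix j assume j: "j \<in> states"
    have nm: "(\<Union>i\<in>states - {j}. next_marks n i j) \<in> sets Pred"
      unfolding next_marks_def using m j before_next_Pred[OF age]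
      by (intro sets.countable_UN'') (auto simp: state_pairs_def)
    have JG: "{\<omega> \<in> K. T (Suc n) \<omega> \<le> ereal q \<and> J (Suc n) \<omega> = j} \<in> sets (G q)" if "0 \<le> q" for q
      using G_positive[OF nm that] next_state_before[OF _ j nm] by (simp cong: conj_cong)
    have "after (Suc n) j = (\<Union>q\<in>\<rat> \<inter> {0<..}. {\<omega> \<in> K. T (Suc n) \<omega> \<le> ereal q \<and> J (Suc n) \<omega> = j} \<times> {q<..} \<times> UNIV)" (is "?L = ?R")
    proof (rule Set.set_eqI, rule iffI)
      fix w assume "w \<in> ?L"
      then obtain \<omega> u v where w: "w = (\<omega>, u, v)" "\<omega> \<in> K" "T (Suc n) \<omega> < ereal u" "J (Suc n) \<omega> = j"
        by (auto simp: after_def)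
      then obtain t' where t': "T (Suc n) \<omega> = ereal t'" "0 < t'" using T_Suc_pos[of \<omega> n] by (cases "T (Suc n) \<omega>") auto
      then obtain q where "q \<in> \<rat>" "t' < q" "q < u" using Rats_dense_in_real[of t' u] w by auto
      then show "w \<in> ?R" using w t' by (auto intro!: bexI[of _ q])
    next
      fix w assume "w \<in> ?R"
      then obtain \<omega> u v q where w: "w = (\<omega>, u, v)" "\<omega> \<in> K" "T (Suc n) \<omega> \<le> ereal q" "q < u" "0 < q" "J (Suc n) \<omega> = j" by auto
      then show "w \<in> ?L" by (auto simp: after_def intro: le_less_trans)
    qed
    also have "\<dots> \<in> sets Pred"
    proof (rule sets.countable_UN'')
      show "countable (\<rat> \<inter> {0<..} :: real set)" using countable_rat by (rule countable_subset[rotated]) auto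
      fix q :: real assume "q \<in> \<rat> \<inter> {0<..}"
      then show "{\<omega> \<in> K. T (Suc n) \<omega> \<le> ereal q \<and> J (Suc n) \<omega> = j} \<times> {q<..} \<times> UNIV \<in> sets Pred"
        using JG[of q] by (intro pred_genI) auto
    qed
    finally show "after (Suc n) j \<in> sets Pred" .
  qed
qed

end

section \<open>The rate of transition\<close>

context semi_markov
begin

lemma Y0_measurable: "Y0 \<in> borel_measurable M"
  using Y0_S0 S0_events by (intro borel_measurableI_greater) auto

text \<open>Fixing time and mark in a predictable set leaves an event. The mark 0 is arbitrary since
  \<open>after\<close> does not restrict the mark, and growing integer times exhaust a finite
  \<open>T n\<close>.\<close>

lemma after_events:
  assumes "i \<in> states"
  shows "{\<omega> \<in> K. T n \<omega> < \<infinity> \<and> J n \<omega> = i} \<in> events"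
proof -
  have "{\<omega> \<in> K. T n \<omega> < \<infinity> \<and> J n \<omega> = i} = (\<Union>k::nat. (\<lambda>\<omega>. (\<omega>, (real (Suc k), 0))) -` after n i)" (is "?L = ?R")
  proof (rule Set.set_eqI, rule iffI)
    fix \<omega> assume w: "\<omega> \<in> ?L"
    then have "T n \<omega> \<noteq> \<infinity>" "\<omega> \<in> K" by auto
    from T_cases[OF this(2), of n] this(1) obtain t where t: "T n \<omega> = ereal t" by metis
    obtain k :: nat where "t < real k" using reals_Archimedean2 by blast
    then show "\<omega> \<in> ?R" using w t by (auto simp: after_def intro!: exI[of _ k])
  next
    fix \<omega> assume "\<omega> \<in> ?R"
    then show "\<omega> \<in> ?L" by (auto simp: after_def)
  qed
  also have "\<dots> \<in> events"
    using predictable[of n] assms Pred_product by (intro sets.countable_UN sets_Pair2[of _ M borel] image_subsetI) auto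
  finally show ?thesis .
qed

text \<open>Off \<open>K\<close> nothing is known about the path; a constant value there yields a
  measurable version.\<close>

definition Tm :: "nat \<Rightarrow> 'a \<Rightarrow> ereal" where
  "Tm n \<omega> = (if \<omega> \<in> K then T n \<omega> else \<infinity>)"

text \<open>For n > 0 the event that the jump comes before u is the section at time u of the
  predictable set where the age is positive.\<close>

lemma Tm_measurable: "Tm n \<in> borel_measurable M"
proof (cases n)
  case 0
  have [measurable]: "K \<in> events" "Y0 \<in> borel_measurable M" using K_event Y0_measurable by auto
  have "Tm n = (\<lambda>\<omega>. if \<omega> \<in> K then - ereal (Y0 \<omega>) else \<infinity>)" by (auto simp: Tm_def T_def 0)
  then show ?thesis by simp
next
  case (Suc m)
  have lt: "{\<omega> \<in> space M. Tm n \<omega> < ereal u} \<in> events" for u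
  proof (cases "0 < u")
    case True
    have [measurable]: "age n \<in> borel_measurable Pred" using predictable[of n] by blast
    have "{w \<in> space Pred. 0 < age n w} \<in> sets Pred" by measurable
    from sets_Pair2[OF Pred_product[OF this], of "(u, 0)"]
    have "(\<lambda>\<omega>. (\<omega>, (u, 0))) -` {w \<in> space Pred. 0 < age n w} \<in> events" .
    also have "(\<lambda>\<omega>. (\<omega>, (u, 0))) -` {w \<in> space Pred. 0 < age n w} = {\<omega> \<in> space M. Tm n \<omega> < ereal u}"
    proof -
      have "0 < age n (\<omega>, u, 0) \<longleftrightarrow> T n \<omega> < ereal u" if "\<omega> \<in> K" for \<omega>
        using T_Suc_pos[OF that, of m] that unfolding Suc by (cases "T (Suc m) \<omega>") (auto simp: age_def)
      moreover have "age n (\<omega>, u, 0) = 0" if "\<omega> \<notin> K" for \<omega> using that by (simp add: age_def)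
      ultimately have "0 < age n (\<omega>, u, 0) \<longleftrightarrow> Tm n \<omega> < ereal u" for \<omega>
        by (cases "\<omega> \<in> K") (simp_all add: Tm_def)
      then show ?thesis using True by (auto simp: W_def)
    qed
    finally show ?thesis .
  next
    case False
    then have "\<not> Tm n \<omega> < ereal u" for \<omega>
    proof (cases "\<omega> \<in> K")
      case True
      have "ereal u \<le> 0" using False by simp
      then have "ereal u < T n \<omega>" using T_Suc_pos[OF True, of m] unfolding Suc by (rule le_less_trans)
      then show ?thesis using True by (simp add: Tm_def)
    qed (simp add: Tm_def)
    then show ?thesis by simp
  qed
  show ?thesis
  proof (rule borel_measurableI_less)
    fix y :: ereal
    show "{\<omega> \<in> space M. Tm n \<omega> < y} \<in> events"
    proof (cases y)
      case PInf
      have "{\<omega> \<in> space M. Tm n \<omega> < y} = (\<Union>k::nat. {\<omega> \<in> space M. Tm n \<omega> < ereal (real k)})"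
      proof -
        have "(x::ereal) < \<infinity> \<longleftrightarrow> (\<exists>k::nat. x < ereal (real k))" for x
          using reals_Archimedean2 by (cases x) auto
        then show ?thesis using PInf by auto
      qed
      then show ?thesis using lt by auto
    qed (use lt in auto)
  qed
qed

lemma holding_eq: "\<omega> \<in> K \<Longrightarrow> holding_time X Y0 n \<omega> = Tm (Suc n) \<omega> - Tm n \<omega>"
  by (simp add: holding_time_def Tm_def T_def del: jump_time.simps)

lemma state_eq: "\<omega> \<in> K \<Longrightarrow> state_at_jump X Y0 n i \<omega> \<longleftrightarrow> T n \<omega> < \<infinity> \<and> J n \<omega> = i"
  by (simp add: state_at_jump_def J_def T_def)

abbreviation (input) aged :: "nat \<Rightarrow> nat \<Rightarrow> real \<Rightarrow> 'a set" where
  "aged n i y \<equiv> {\<omega> \<in> K. at_age X Y0 n i y \<omega>}"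

abbreviation (input) surviving :: "nat \<Rightarrow> nat \<Rightarrow> real \<Rightarrow> real \<Rightarrow> 'a set" where
  "surviving n i y z \<equiv> {\<omega> \<in> K. at_age X Y0 n i y \<omega> \<and> ereal z \<le> holding_time X Y0 n \<omega>}"

lemma conditions_measurable:
  assumes "i \<in> states"
  shows "aged n i y \<in> events"
    "surviving n i y z \<in> events"
    "{\<omega> \<in> K. at_age X Y0 n i y \<omega> \<and> holding_time X Y0 n \<omega> \<le> ereal z} \<in> events"
proof -
  have [measurable]: "Tm n \<in> borel_measurable M" for n by (rule Tm_measurable)
  have [measurable]: "Y0 \<in> borel_measurable M" by (rule Y0_measurable)
  have A: "{\<omega> \<in> space M. ereal y < Tm (Suc n) \<omega> - Tm n \<omega> \<and> (n = 0 \<longrightarrow> Y0 \<omega> \<le> y)} \<in> events" by measurable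
  have "aged n i y = {\<omega> \<in> K. T n \<omega> < \<infinity> \<and> J n \<omega> = i} \<inter>
      {\<omega> \<in> space M. ereal y < Tm (Suc n) \<omega> - Tm n \<omega> \<and> (n = 0 \<longrightarrow> Y0 \<omega> \<le> y)}"
    using K_space by (auto simp: at_age_def holding_eq state_eq)
  then show *: "aged n i y \<in> events" using after_events[OF assms, of n] A by (simp only: sets.Int)
  have "{\<omega> \<in> space M. ereal z \<le> Tm (Suc n) \<omega> - Tm n \<omega>} \<in> events" by measurable
  moreover have "surviving n i y z =
    aged n i y \<inter> {\<omega> \<in> space M. ereal z \<le> Tm (Suc n) \<omega> - Tm n \<omega>}"
    using K_space by (auto simp: holding_eq)
  ultimately show "surviving n i y z \<in> events" using * by (simp only: sets.Int)
  have "{\<omega> \<in> space M. Tm (Suc n) \<omega> - Tm n \<omega> \<le> ereal z} \<in> events" by measurable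
  moreover have "{\<omega> \<in> K. at_age X Y0 n i y \<omega> \<and> holding_time X Y0 n \<omega> \<le> ereal z} =
    aged n i y \<inter> {\<omega> \<in> space M. Tm (Suc n) \<omega> - Tm n \<omega> \<le> ereal z}"
    using K_space by (auto simp: holding_eq)
  ultimately show "{\<omega> \<in> K. at_age X Y0 n i y \<omega> \<and> holding_time X Y0 n \<omega> \<le> ereal z} \<in> events" using * by (simp only: sets.Int)
qed

text \<open>The predictable set H of the overview. Its bounds on the age mirror those on the holding
  time, and the clause on \<open>Y0\<close> mirrors the last conjunct of
  \<open>at_age\<close>.\<close>

definition window_marks :: "nat \<Rightarrow> nat \<Rightarrow> nat \<Rightarrow> real \<Rightarrow> real \<Rightarrow> ('a \<times> real \<times> real) set" where
  "window_marks n i j y h = {w \<in> next_marks n i j. y < age n w \<and> age n w \<le> y + h \<and> (n = 0 \<longrightarrow> Y0 (fst w) \<le> y)}"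

lemma next_marks_Pred:
  assumes "(i, j) \<in> state_pairs"
  shows "next_marks n i j \<in> sets Pred"
  unfolding next_marks_def using predictable[of n] predictable[of "Suc n"] assms
  by (intro sets.Int marks_Pred before_next_Pred) (auto simp: state_pairs_def)

lemma window_marks_Pred:
  assumes "(i, j) \<in> state_pairs"
  shows "window_marks n i j y h \<in> sets Pred"
proof -
  have [measurable]: "age n \<in> borel_measurable Pred" "(\<lambda>(\<omega>, u, v). Y0 \<omega>) \<in> borel_measurable Pred"
    using predictable[of n] Y0_Pred by auto
  have "{w \<in> space Pred. y < age n w \<and> age n w \<le> y + h \<and> (n = 0 \<longrightarrow> (\<lambda>(\<omega>, u, v). Y0 \<omega>) w \<le> y)} \<in> sets Pred"
    by measurable
  moreover have "window_marks n i j y h = next_marks n i j \<inter>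
    {w \<in> space Pred. y < age n w \<and> age n w \<le> y + h \<and> (n = 0 \<longrightarrow> (\<lambda>(\<omega>, u, v). Y0 \<omega>) w \<le> y)}"
    using sets.sets_into_space[OF next_marks_Pred[OF assms]] by (auto simp: window_marks_def)
  ultimately show ?thesis using next_marks_Pred[OF assms] by (simp only: sets.Int)
qed

lemma section_window_marks:
  assumes "\<omega> \<in> K" "T n \<omega> = ereal t"
  shows "Pair \<omega> -` window_marks n i j y h = (if J n \<omega> = i \<and> (n = 0 \<longrightarrow> Y0 \<omega> \<le> y) then
    {(u, v). max 0 t < u \<and> ereal u \<le> T (Suc n) \<omega> \<and> y < u - t \<and> u - t \<le> y + h \<and> v \<in> Lam prec lam lamt i j (u - t) n} else {})"
  using assms by (auto simp: window_marks_def next_marks_def marks_def before_next_def after_def age_def)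

definition jump_event :: "nat \<Rightarrow> nat \<Rightarrow> nat \<Rightarrow> real \<Rightarrow> real \<Rightarrow> 'a set" where
  "jump_event n i j y h = {\<omega> \<in> K. (state_at_jump X Y0 (Suc n) j \<omega> \<and> ereal y < holding_time X Y0 n \<omega> \<and>
      holding_time X Y0 n \<omega> \<le> ereal (y + h)) \<and> at_age X Y0 n i y \<omega>}"

lemma jump_event_events:
  assumes "i \<in> states" "j \<in> states"
  shows "jump_event n i j y h \<in> events"
proof -
  have "jump_event n i j y h = {\<omega> \<in> K. T (Suc n) \<omega> < \<infinity> \<and> J (Suc n) \<omega> = j} \<inter>
      {\<omega> \<in> K. at_age X Y0 n i y \<omega> \<and> holding_time X Y0 n \<omega> \<le> ereal (y + h)}"
    by (auto simp: jump_event_def state_eq at_age_def)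
  then show ?thesis using after_events[OF assms(2)] conditions_measurable(3)[OF assms(1)] by (simp only: sets.Int)
qed

lemma at_age_iff:
  assumes "\<omega> \<in> K" "T n \<omega> = ereal t"
  shows "at_age X Y0 n i y \<omega> \<longleftrightarrow> J n \<omega> = i \<and> ereal (t + y) < T (Suc n) \<omega> \<and> (n = 0 \<longrightarrow> Y0 \<omega> \<le> y)"
  using assms by (cases "T (Suc n) \<omega>") (auto simp: at_age_def state_eq holding_eq Tm_def)

lemma not_at_age: "\<omega> \<in> K \<Longrightarrow> T n \<omega> = \<infinity> \<Longrightarrow> \<not> at_age X Y0 n i y \<omega>"
  by (simp add: at_age_def state_eq)

text \<open>Within a sojourn only the atom that ends it has mass, and by disjointness of the
  intervals it lies in that of j exactly if the jump leads to j. Off \<open>K\<close> both sides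
  vanish, since the measure was set to 0 there.\<close>

lemma psi_window_marks:
  assumes ij: "i \<in> states" "j \<in> states - {i}" and \<omega>: "\<omega> \<in> space M"
  shows "emeasure (\<psi> \<omega>) (Pair \<omega> -` window_marks n i j y h) = indicator (jump_event n i j y h) \<omega>"
proof (cases "\<omega> \<in> K")
  case False
  then show ?thesis by (simp add: \<psi>_def jump_event_def)
next
  case K: True
  have sp: "(i, j) \<in> state_pairs" using ij by (auto simp: state_pairs_def)
  show ?thesis
  proof (rule T_cases[OF K, of n])
    assume Tn: "T n \<omega> = \<infinity>"
    then have "Pair \<omega> -` window_marks n i j y h = {}"
      by (auto simp: window_marks_def next_marks_def marks_def after_def)
    moreover have "\<omega> \<notin> jump_event n i j y h" using not_at_age[OF K Tn] by (simp add: jump_event_def)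
    ultimately show ?thesis by simp
  next
    fix t assume t: "T n \<omega> = ereal t" "J n \<omega> \<in> states"
    let ?S = "Pair \<omega> -` window_marks n i j y h"
    note sec = section_window_marks[OF K t(1), of i j y h]
    have S: "?S \<in> sets half_plane" using Pred_section[OF window_marks_Pred[OF sp]] .
    have sub: "?S \<subseteq> {(u, v). max 0 t < u \<and> ereal u \<le> T (Suc n) \<omega> \<and> v \<in> Lams (J n \<omega>) (u - t) n}"
      unfolding sec using ij by (auto simp: Lams_def)
    from marks_measure[OF K t(1) S sub] show ?thesis
    proof cases
      case 1
      then show ?thesis by (simp add: jump_event_def state_eq[OF K] del: holding_time_def)
    next
      case (2 t' v)
      have "0 \<le> t' - t" using 2(2) by simp
      then have v: "v \<in> Lam prec lam lamt i j (t' - t) n \<longleftrightarrow> J (Suc n) \<omega> = j" if "J n \<omega> = i"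
        using Lam_disjoint[OF t(2) 2(3) _ _ 2(4), of j] 2(4) that ij by auto
      have hold: "holding_time X Y0 n \<omega> = ereal (t' - t)" using t 2 K by (simp add: holding_eq Tm_def)
      have "\<omega> \<in> jump_event n i j y h \<longleftrightarrow> J (Suc n) \<omega> = j \<and> y < t' - t \<and> t' - t \<le> y + h \<and> J n \<omega> = i \<and> (n = 0 \<longrightarrow> Y0 \<omega> \<le> y)"
        using K 2(1) by (auto simp: jump_event_def hold state_eq at_age_iff[OF K t(1)])
      also have "\<dots> \<longleftrightarrow> (t', v) \<in> ?S" unfolding sec using 2(1,2) v by auto
      finally show ?thesis using 2(5) by (simp add: indicator_def)
    qed
  qed
qed

text \<open>By Fubini: the vertical section at time u is an interval whose length is the rate at age
  u - t. The unknown offset does not enter, and the start t drops out by translation.\<close>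

lemma emeasure_Lam_strip:
  assumes sp: "(i, j) \<in> state_pairs" and y: "0 \<le> y"
  shows "emeasure lborel {(u, v). y < u - t \<and> u - t \<le> y + h \<and> v \<in> Lam prec lam lamt i j (u - t) n} =
    (\<integral>\<^sup>+z. ennreal (rate i j n z) * indicator {y<..y+h} z \<partial>lborel)" (is "emeasure lborel ?R = _")
    and "{(u, v). y < u - t \<and> u - t \<le> y + h \<and> v \<in> Lam prec lam lamt i j (u - t) n} \<in> sets borel"
proof -
  let ?g = "\<lambda>p::real\<times>real. (fst p - t, snd p)"
  have [measurable]: "?g \<in> borel \<Otimes>\<^sub>M borel \<rightarrow>\<^sub>M borel \<Otimes>\<^sub>M borel" by measurable
  have "{p \<in> space (borel \<Otimes>\<^sub>M borel). y < fst p - t \<and> fst p - t \<le> y + h} \<in> sets (borel \<Otimes>\<^sub>M borel)" by measurable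
  moreover have "?g -` Lam_graph i j n \<inter> space (borel \<Otimes>\<^sub>M borel) \<in> sets (borel \<Otimes>\<^sub>M borel)"
    using Lam_graph_measurable[OF sp] by (rule measurable_sets[rotated]) measurable
  ultimately have "{p \<in> space (borel \<Otimes>\<^sub>M borel). y < fst p - t \<and> fst p - t \<le> y + h} \<inter>
      (?g -` Lam_graph i j n \<inter> space (borel \<Otimes>\<^sub>M borel)) \<in> sets (borel \<Otimes>\<^sub>M borel)" by (rule sets.Int)
  also have "{p \<in> space (borel \<Otimes>\<^sub>M borel). y < fst p - t \<and> fst p - t \<le> y + h} \<inter>
      (?g -` Lam_graph i j n \<inter> space (borel \<Otimes>\<^sub>M borel)) = ?R"
    using y by (auto simp: space_pair_measure)
  finally show R: "?R \<in> sets borel" by (simp only: borel_prod)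
  have [measurable]: "rate i j n \<in> borel_measurable borel" using rate_measurable[OF sp] .
  have "emeasure lborel ?R = (\<integral>\<^sup>+u. emeasure lborel (Pair u -` ?R) \<partial>lborel)"
  proof -
    have "sets (lborel \<Otimes>\<^sub>M lborel) = sets (borel :: (real \<times> real) measure)" by (simp only: lborel_prod sets_lborel)
    then have "?R \<in> sets (lborel \<Otimes>\<^sub>M lborel)" using R by simp
    from lborel.emeasure_pair_measure_alt[OF this] show ?thesis by (simp add: lborel_prod)
  qed
  also have "\<dots> = (\<integral>\<^sup>+u. ennreal (rate i j n (u - t)) * indicator {y<..y+h} (u - t) \<partial>lborel)"
  proof (rule nn_integral_cong)
    fix u
    show "emeasure lborel (Pair u -` ?R) = ennreal (rate i j n (u - t)) * indicator {y<..y+h} (u - t)"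
    proof (cases "y < u - t \<and> u - t \<le> y + h")
      case True
      then have eq: "Pair u -` ?R = {offset i j n (u - t)..<offset i j n (u - t) + rate i j n (u - t)}" using y by (auto simp: Lam_eq)
      show ?thesis unfolding eq using True rate_nonneg[OF sp] by simp
    next
      case False
      then have "Pair u -` ?R = {}" by auto
      then show ?thesis using False by auto
    qed
  qed
  also have "\<dots> = (\<integral>\<^sup>+z. ennreal (rate i j n z) * indicator {y<..y+h} z \<partial>lborel)"
    by (subst nn_integral_real_affine[where c=1 and t=t]) auto
  finally show "emeasure lborel ?R = (\<integral>\<^sup>+z. ennreal (rate i j n z) * indicator {y<..y+h} z \<partial>lborel)" .
qed

text \<open>The section is the strip of ages in (y, y + h] cut off at the next jump. Hence it is
  part of the full strip, it is empty unless the sojourn outlasts age y, and it is the full strip if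
  the sojourn reaches age y + h.\<close>

lemma window_marks_bounds:
  fixes n :: nat and h :: real
  assumes ij: "i \<in> states" "j \<in> states - {i}" and y: "0 \<le> y" and \<omega>: "\<omega> \<in> space M"
  defines "I \<equiv> (\<integral>\<^sup>+z. ennreal (rate i j n z) * indicator {y<..y+h} z \<partial>lborel)"
  shows "emeasure lborel (Pair \<omega> -` window_marks n i j y h) \<le> I * indicator (aged n i y) \<omega>"
    "I * indicator (surviving n i y (y + h)) \<omega>
      \<le> emeasure lborel (Pair \<omega> -` window_marks n i j y h)"
proof -
  have sp: "(i, j) \<in> state_pairs" using ij by (auto simp: state_pairs_def)
  let ?S = "Pair \<omega> -` window_marks n i j y h"
  have "emeasure lborel ?S \<le> I * indicator (aged n i y) \<omega> \<and>
    I * indicator (surviving n i y (y + h)) \<omega> \<le> emeasure lborel ?S"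
  proof (cases "\<omega> \<in> K")
    case False
    then have "?S = {}" by (auto simp: window_marks_def next_marks_def marks_def after_def)
    then show ?thesis using False by simp
  next
    case K: True
    show ?thesis
    proof (rule T_cases[OF K, of n])
      assume Tn: "T n \<omega> = \<infinity>"
      then have "?S = {}" by (auto simp: window_marks_def next_marks_def marks_def after_def)
      then show ?thesis using not_at_age[OF K Tn] by simp
    next
      fix t assume t: "T n \<omega> = ereal t" "J n \<omega> \<in> states" "n = 0 \<and> t = - Y0 \<omega> \<or> 0 < n \<and> 0 < t"
      let ?R = "{(u, v). y < u - t \<and> u - t \<le> y + h \<and> v \<in> Lam prec lam lamt i j (u - t) n}"
      note R = emeasure_Lam_strip[OF sp y, of t h n, folded I_def]
      note sec = section_window_marks[OF K t(1), of i j y h]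
      have S: "?S \<in> sets borel" using Pred_section[OF window_marks_Pred[OF sp]] by (simp add: sets_half_plane_iff)
      have "emeasure lborel ?S \<le> I * indicator (aged n i y) \<omega>"
      proof (cases "at_age X Y0 n i y \<omega>")
        case True
        have "?S \<subseteq> ?R" unfolding sec by auto
        then have "emeasure lborel ?S \<le> emeasure lborel ?R" using R(2) by (intro emeasure_mono) auto
        then show ?thesis using R(1) True K by simp
      next
        case False
        have "?S = {}"
        proof (rule ccontr)
          assume "?S \<noteq> {}"
          then obtain u v where "(u, v) \<in> ?S" by auto
          then have u: "J n \<omega> = i" "n = 0 \<longrightarrow> Y0 \<omega> \<le> y" "ereal u \<le> T (Suc n) \<omega>" "y < u - t" unfolding sec by (auto split: if_splits)
          have "ereal (t + y) < ereal u" using u by simp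
          then have "ereal (t + y) < T (Suc n) \<omega>" using u(3) by (rule less_le_trans)
          then show False using False u by (auto simp: at_age_iff[OF K t(1)])
        qed
        then show ?thesis by simp
      qed
      moreover have "I * indicator (surviving n i y (y + h)) \<omega> \<le> emeasure lborel ?S"
      proof (cases "at_age X Y0 n i y \<omega> \<and> ereal (y + h) \<le> holding_time X Y0 n \<omega>")
        case True
        then have a: "J n \<omega> = i" "n = 0 \<longrightarrow> Y0 \<omega> \<le> y" by (auto simp: at_age_iff[OF K t(1)])
        have h: "ereal (y + h + t) \<le> T (Suc n) \<omega>"
          using True t(1) K by (cases "T (Suc n) \<omega>") (auto simp: holding_eq Tm_def)
        have "?R \<subseteq> ?S"
        proof
          fix p assume "p \<in> ?R"
          then obtain u v where p: "p = (u, v)" "y < u - t" "u - t \<le> y + h" "v \<in> Lam prec lam lamt i j (u - t) n" by auto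
          \<comment> \<open>For n = 0 this is where \<open>Y0 \<le> y\<close> enters: u > t + y = y
            - Y0, which is nonnegative, so the strip lies in positive time. For n > 0 the start t is
            itself positive.\<close>
          have "max 0 t < u" using t(3) p a y by auto
          moreover have "ereal u \<le> ereal (y + h + t)" using p by simp
          then have "ereal u \<le> T (Suc n) \<omega>" using h by (rule order_trans)
          ultimately show "p \<in> ?S" unfolding sec using p a by auto
        qed
        then have "emeasure lborel ?R \<le> emeasure lborel ?S" using S by (intro emeasure_mono) auto
        then show ?thesis using R(1) True K by simp
      qed simp
      ultimately show ?thesis by simp
    qed
  qed
  then show "emeasure lborel ?S \<le> I * indicator (aged n i y) \<omega>"
    "I * indicator (surviving n i y (y + h)) \<omega> \<le> emeasure lborel ?S" by auto
qed

lemma rate_integral: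
  assumes sp: "(i, j) \<in> state_pairs" and bd: "\<forall>z\<ge>0. lam i j z n \<le> B"
  shows "(\<integral>\<^sup>+z. ennreal (rate i j n z) * indicator {y<..y+h} z \<partial>lborel) = ennreal (LINT z:{y<..y+h}|lborel. rate i j n z)"
    and "0 \<le> (LINT z:{y<..y+h}|lborel. rate i j n z)"
proof -
  have [measurable]: "rate i j n \<in> borel_measurable borel" using rate_measurable[OF sp] .
  have nn: "0 \<le> rate i j n z" for z using rate_nonneg[OF sp] .
  have "rate i j n z \<le> max B 0" for z using bd by (auto simp: rate_def intro: max.coboundedI1)
  then have "integrable lborel (\<lambda>z. indicator {y<..y+h} z *\<^sub>R rate i j n z)"
    by (intro integrableI_bounded_set_indicator[where B="max B 0"])
       (auto simp: emeasure_bounded_finite[unfolded infinity_ennreal_def] nn)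
  then have "(\<integral>\<^sup>+z. ennreal (indicator {y<..y+h} z *\<^sub>R rate i j n z) \<partial>lborel) = ennreal (LINT z:{y<..y+h}|lborel. rate i j n z)"
    unfolding set_lebesgue_integral_def using nn by (intro nn_integral_eq_integral) auto
  moreover have "ennreal (indicator {y<..y+h} z *\<^sub>R rate i j n z) = ennreal (rate i j n z) * indicator {y<..y+h} z" for z
    by (simp add: indicator_def)
  ultimately show "(\<integral>\<^sup>+z. ennreal (rate i j n z) * indicator {y<..y+h} z \<partial>lborel) = ennreal (LINT z:{y<..y+h}|lborel. rate i j n z)" by simp
  show "0 \<le> (LINT z:{y<..y+h}|lborel. rate i j n z)"
    unfolding set_lebesgue_integral_def using nn by (intro Bochner_Integration.integral_nonneg) auto
qed

lemma jump_event_bounds: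
  fixes n :: nat and h :: real
  assumes ij: "i \<in> states" "j \<in> states - {i}" and y: "0 \<le> y" and bd: "\<forall>z\<ge>0. lam i j z n \<le> B"
  defines "I \<equiv> (LINT z:{y<..y+h}|lborel. rate i j n z)"
  shows "prob (jump_event n i j y h) \<le> I * prob (aged n i y)"
    "I * prob (surviving n i y (y + h)) \<le> prob (jump_event n i j y h)"
proof -
  have sp: "(i, j) \<in> state_pairs" using ij by (auto simp: state_pairs_def)
  note I = rate_integral[OF sp bd, of y h, folded I_def]
  let ?A = "aged n i y"
  let ?B = "surviving n i y (y + h)"
  let ?S = "\<lambda>\<omega>. emeasure lborel (Pair \<omega> -` window_marks n i j y h)"
  have [measurable]: "?A \<in> events" "?B \<in> events" using conditions_measurable[OF ij(1)] by auto
  have "emeasure M (jump_event n i j y h) = (\<integral>\<^sup>+\<omega>. indicator (jump_event n i j y h) \<omega> \<partial>M)"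
    using jump_event_events ij by (simp)
  also have "\<dots> = (\<integral>\<^sup>+\<omega>. emeasure (\<psi> \<omega>) (Pair \<omega> -` window_marks n i j y h) \<partial>M)"
    using psi_window_marks[OF ij] by (intro nn_integral_cong) auto
  also have "\<dots> = (\<integral>\<^sup>+\<omega>. ?S \<omega> \<partial>M)" by (rule compensation[OF window_marks_Pred[OF sp]])
  finally have eq: "emeasure M (jump_event n i j y h) = (\<integral>\<^sup>+\<omega>. ?S \<omega> \<partial>M)" .
  have "(\<integral>\<^sup>+\<omega>. ?S \<omega> \<partial>M) \<le> (\<integral>\<^sup>+\<omega>. ennreal I * indicator ?A \<omega> \<partial>M)"
    using window_marks_bounds(1)[OF ij y, where n=n and h=h, unfolded I(1)] by (intro nn_integral_mono)
  also have "\<dots> = ennreal (I * prob ?A)" using I(2) by (simp add: nn_integral_cmult_indicator emeasure_eq_measure ennreal_mult')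
  finally show "prob (jump_event n i j y h) \<le> I * prob ?A"
    using I(2) unfolding eq[symmetric] emeasure_eq_measure by (subst (asm) ennreal_le_iff) auto
  have "ennreal (I * prob ?B) = (\<integral>\<^sup>+\<omega>. ennreal I * indicator ?B \<omega> \<partial>M)"
    using I(2) by (simp add: nn_integral_cmult_indicator emeasure_eq_measure ennreal_mult')
  also have "\<dots> \<le> (\<integral>\<^sup>+\<omega>. ?S \<omega> \<partial>M)"
    using window_marks_bounds(2)[OF ij y, where n=n and h=h, unfolded I(1)] by (intro nn_integral_mono)
  finally show "I * prob ?B \<le> prob (jump_event n i j y h)"
    unfolding eq[symmetric] emeasure_eq_measure by (subst (asm) ennreal_le_iff) auto
qed

text \<open>The events increase as h decreases, and they exhaust the conditioning event because its
  inequality y < holding time is strict: it leaves room for some 1 / (k + 1).\<close>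

lemma at_age_continuous:
  assumes i: "i \<in> states"
  shows "((\<lambda>h. prob (surviving n i y (y + h))) \<longlongrightarrow>
    prob (aged n i y)) (at_right 0)" (is "((\<lambda>h. prob (?B h)) \<longlongrightarrow> prob ?A) _")
proof (rule order_tendstoI)
  have [measurable]: "?A \<in> events" "?B h \<in> events" for h using conditions_measurable[OF i] by auto
  have le: "prob (?B h) \<le> prob ?A" for h by (rule finite_measure_mono) auto
  have anti: "prob (?B h) \<le> prob (?B k)" if "k \<le> h" for h k
  proof (rule finite_measure_mono)
    have "ereal (y + k) \<le> ereal (y + h)" using that by simp
    then show "?B h \<subseteq> ?B k" using order_trans by blast
  qed simp
  show "\<forall>\<^sub>F h in at_right 0. prob (?B h) < c" if "prob ?A < c" for c
    using le that by (intro always_eventually allI) (rule le_less_trans)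
  fix c assume c: "c < prob ?A"
  have "(\<lambda>k. prob (?B (1 / real (Suc k)))) \<longlonglongrightarrow> prob (\<Union>k. ?B (1 / real (Suc k)))"
  proof (rule finite_Lim_measure_incseq)
    show "incseq (\<lambda>k. ?B (1 / real (Suc k)))"
    proof (rule incseq_SucI)
      fix k
      have "ereal (y + 1 / real (Suc (Suc k))) \<le> ereal (y + 1 / real (Suc k))" by (simp add: frac_le)
      then show "?B (1 / real (Suc k)) \<subseteq> ?B (1 / real (Suc (Suc k)))" using order_trans by blast
    qed
  qed auto
  moreover have "(\<Union>k. ?B (1 / real (Suc k))) = ?A"
  proof -
    have "\<exists>k. ereal (y + 1 / real (Suc k)) \<le> x" if "ereal y < x" for x
    proof -
      obtain r where r: "ereal y < ereal r" "ereal r < x" using \<open>ereal y < x\<close> ereal_dense2 by blast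
      then obtain k where "1 / real (Suc k) < r - y" using nat_approx_posE[of "r - y"] by auto
      then have "ereal (y + 1 / real (Suc k)) \<le> ereal r" by simp
      then show ?thesis using r(2) by (meson less_imp_le order_trans)
    qed
    then show ?thesis by (auto simp: at_age_def)
  qed
  ultimately have "\<forall>\<^sub>F k in sequentially. c < prob (?B (1 / real (Suc k)))" using c by (auto dest: order_tendstoD(1))
  then obtain k where k: "c < prob (?B (1 / real (Suc k)))" by (auto simp: eventually_sequentially)
  then have "c < prob (?B h)" if "h < 1 / real (Suc k)" for h using anti[of h "1 / real (Suc k)"] that by simp
  then show "\<forall>\<^sub>F h in at_right 0. c < prob (?B h)"
    by (auto simp: eventually_at_right_field intro!: exI[of _ "1 / real (Suc k)"])
qed

text \<open>The events in the definition of the rate are controlled only on \<open>K\<close>.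
  Completeness makes their parts outside \<open>K\<close> null sets, hence measurable.\<close>

lemma complete_prob:
  assumes "complete_measure M" "S \<subseteq> space M" "S \<inter> K \<in> events"
  shows "prob S = prob (S \<inter> K)"
proof -
  interpret complete_measure M by fact
  have "prob (space M - K) = 0" using K_event K_prob by (simp add: prob_compl)
  then have null: "space M - K \<in> null_sets M" using K_event by (auto simp: null_sets_def emeasure_eq_measure)
  have "S - K \<in> null_sets M"
    by (intro null_sets_subset[OF null] complete[OF _ null]) (use assms(2) in auto)
  then have "emeasure M ((S \<inter> K) \<union> (S - K)) = emeasure M (S \<inter> K)" using assms by (intro emeasure_Un_null_set)
  moreover have "(S \<inter> K) \<union> (S - K) = S" by auto
  ultimately show ?thesis by (simp add: measure_def)
qed

theorem transition_rate:
  assumes compl: "complete_measure M" and ij: "i \<in> states" "j \<in> states - {i}" and y: "0 \<le> y"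
    and bd: "\<forall>z\<ge>0. lam i j z n \<le> B"
    and avg: "((\<lambda>h. (LINT z:{y<..y+h}|lborel. rate i j n z) / h) \<longlongrightarrow> r) (at_right 0)"
  shows "has_transition_rate M X Y0 n i j y r"
  unfolding has_transition_rate_def
proof
  let ?A = "aged n i y"
  let ?B = "\<lambda>h. surviving n i y (y + h)"
  let ?I = "\<lambda>h. LINT z:{y<..y+h}|lborel. rate i j n z"
  let ?E = "jump_event n i j y"
  have pA: "\<P>(\<omega> in M. at_age X Y0 n i y \<omega>) = prob ?A"
  proof -
    have "{\<omega> \<in> space M. at_age X Y0 n i y \<omega>} \<inter> K = ?A" using K_space by auto
    then show ?thesis using complete_prob[OF compl, of "{\<omega> \<in> space M. at_age X Y0 n i y \<omega>}"] conditions_measurable(1)[OF ij(1)] by simp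
  qed
  have pE: "\<P>(\<omega> in M. (state_at_jump X Y0 (Suc n) j \<omega> \<and> ereal y < holding_time X Y0 n \<omega> \<and>
      holding_time X Y0 n \<omega> \<le> ereal (y + h)) \<and> at_age X Y0 n i y \<omega>) = prob (?E h)" (is "prob ?S = _") for h
  proof -
    have "?S \<inter> K = ?E h" using K_space by (auto simp: jump_event_def)
    then show ?thesis using complete_prob[OF compl, of ?S] jump_event_events[of i j n y h] ij by simp
  qed
  assume "0 < \<P>(\<omega> in M. at_age X Y0 n i y \<omega>)"
  then have pos: "0 < prob ?A" by (simp add: pA)
  note b = jump_event_bounds[OF ij y bd]
  have "((\<lambda>h. prob (?E h) / prob ?A / h) \<longlongrightarrow> r) (at_right 0)"
  proof (rule tendsto_sandwich[OF _ _ _ avg])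
    have "((\<lambda>h. (?I h / h) * (prob (?B h) / prob ?A)) \<longlongrightarrow> r * (prob ?A / prob ?A)) (at_right 0)"
      using pos by (intro tendsto_mult avg tendsto_divide at_age_continuous ij(1) tendsto_const) auto
    then show "((\<lambda>h. (?I h / h) * (prob (?B h) / prob ?A)) \<longlongrightarrow> r) (at_right 0)" using pos by simp
    show "\<forall>\<^sub>F h in at_right 0. (?I h / h) * (prob (?B h) / prob ?A) \<le> prob (?E h) / prob ?A / h"
      using eventually_at_right_less
    proof eventually_elim
      case (elim h)
      have "?I h * prob (?B h) / (prob ?A * h) \<le> prob (?E h) / (prob ?A * h)"
        using b(2)[of h] pos elim by (intro divide_right_mono) auto
      then show ?case by (simp add: mult_ac)
    qed
    show "\<forall>\<^sub>F h in at_right 0. prob (?E h) / prob ?A / h \<le> ?I h / h"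
      using eventually_at_right_less
    proof eventually_elim
      case (elim h)
      have "prob (?E h) / prob ?A \<le> ?I h" using b(1)[of h] pos by (simp add: divide_le_eq)
      then show ?case using elim by (intro divide_right_mono) auto
    qed
  qed
  then show "((\<lambda>h. 1 / h * \<P>(\<omega> in M. state_at_jump X Y0 (Suc n) j \<omega> \<and> ereal y < holding_time X Y0 n \<omega> \<and>
      holding_time X Y0 n \<omega> \<le> ereal (y + h) \<bar> at_age X Y0 n i y \<omega>)) \<longlongrightarrow> r) (at_right 0)"
    unfolding cond_prob_def pE pA by (simp add: mult.commute)
qed

end

theorem proposition3p6:
  fixes M :: "'a measure" and F :: "real \<Rightarrow> 'a measure"
    and prec :: "nat rel" and lam lamt :: "nat \<Rightarrow> nat \<Rightarrow> real \<Rightarrow> nat \<Rightarrow> real"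
    and \<phi> :: "'a \<Rightarrow> (real \<times> real) measure"
    and X0 :: "'a \<Rightarrow> nat" and Y0 :: "'a \<Rightarrow> real"
    and X :: "real \<Rightarrow> 'a \<Rightarrow> nat" and Y :: "real \<Rightarrow> 'a \<Rightarrow> real" and N :: "real \<Rightarrow> 'a \<Rightarrow> nat"
  assumes "prob_space M" and "usual_filtration M F"
    and "strict_linear_order_on states prec"
    and lam_measurable: "\<And>i j. (i, j) \<in> state_pairs \<Longrightarrow>
          (\<lambda>(y, n). lam i j y n) \<in> borel_measurable age_count"
    and lam_nonneg: "\<And>i j y n. (i, j) \<in> state_pairs \<Longrightarrow> 0 \<le> y \<Longrightarrow> 0 \<le> lam i j y n"
    and lam_bounded: "\<And>i j. (i, j) \<in> state_pairs \<Longrightarrow> \<exists>B. \<forall>y\<ge>0. \<forall>n. lam i j y n \<le> B"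
    and A1: "(SUP i\<in>states. exit_bound lam i) < \<infinity>"
    and A2: "\<And>i n. i \<in> states \<Longrightarrow>
          filterlim (\<lambda>y. cumulative_exit_rate lam i y n) at_top at_top"
    and lamt_measurable: "\<And>i j. (i, j) \<in> state_pairs \<Longrightarrow>
          (\<lambda>(y, n). lamt i j y n) \<in> borel_measurable age_count"
    and lam_le_lamt: "\<And>i j y n. (i, j) \<in> state_pairs \<Longrightarrow> 0 \<le> y \<Longrightarrow> lam i j y n \<le> lamt i j y n"
    and lamt_le: "\<And>i j. (i, j) \<in> state_pairs \<Longrightarrow>
          AE (y, n) in age_count. ennreal (lamt i j y n) \<le> Linf_norm (lam i j)"
    and Lam_well_defined: "\<And>i j y n. (i, j) \<in> state_pairs \<Longrightarrow> 0 \<le> y \<Longrightarrow>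
          (\<lambda>(i', j'). lamt i' j' y n) summable_on pair_predecessors prec i j"
    and poisson: "poisson_random_measure M half_plane \<phi>"
    and poisson_adapted: "\<And>t B. 0 \<le> t \<Longrightarrow> B \<in> sets borel \<Longrightarrow>
          (\<lambda>\<omega>. emeasure (\<phi> \<omega>) ({0<..t} \<times> B)) \<in> borel_measurable (F t)"
    and X0: "X0 \<in> F 0 \<rightarrow>\<^sub>M count_space UNIV" "\<And>\<omega>. \<omega> \<in> space M \<Longrightarrow> X0 \<omega> \<in> states"
    and Y0: "Y0 \<in> borel_measurable (F 0)" "\<And>\<omega>. \<omega> \<in> space M \<Longrightarrow> 0 \<le> Y0 \<omega>"
    and initial_indep: "prob_space.indep_set M
          (sets (vimage_algebra (space M) (\<lambda>\<omega>. (X0 \<omega>, Y0 \<omega>)) (count_space UNIV \<Otimes>\<^sub>M borel)))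
          (random_measure_events M half_plane \<phi>)"
    and solution: "strong_solution M F prec lam lamt \<phi> X0 Y0 X Y N"
  shows "\<forall>n. \<forall>i\<in>states. \<forall>j\<in>states - {i}.
           (AE y in lborel. 0 \<le> y \<longrightarrow>
              has_transition_rate M X Y0 n i j y (rate_matrix lam y n i j)) \<and>
           (\<forall>y\<ge>0. continuous (at_right y) (\<lambda>u. lam i j u n) \<longrightarrow>
              has_transition_rate M X Y0 n i j y (rate_matrix lam y n i j))"
proof -
  interpret prob_space M by fact
  interpret P: poisson_half_plane M \<phi> by unfold_locales (rule poisson)
  interpret R: measurable_rates prec lam lamt
    by unfold_locales (fact assms(3) lam_nonneg lam_le_lamt Lam_well_defined lam_measurable lamt_measurable)+
  let ?V = "vimage_algebra (space M) (\<lambda>\<omega>. (X0 \<omega>, Y0 \<omega>)) (count_space UNIV \<Otimes>\<^sub>M borel)"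
  have compl: "complete_measure M" using assms(2) by (simp add: usual_filtration_def)
  let ?P = "\<lambda>\<omega>. path_solution prec lam lamt (\<phi> \<omega>) (X0 \<omega>) (Y0 \<omega>) (\<lambda>t. X t \<omega>) (\<lambda>t. Y t \<omega>) (\<lambda>t. N t \<omega>)"
  have "AE \<omega> in M. ?P \<omega>"
    using solution[unfolded strong_solution_def, THEN conjunct2] P.line_atoms AE_space
  proof eventually_elim
    case (elim \<omega>)
    then show ?case
      using P.sets_phi[of \<omega>] Y0(2)[of \<omega>]
      by (intro path_solution.intro R.interval_rates_axioms path_solution_axioms.intro) auto
  qed
  moreover have "AE \<omega> in M. \<forall>k::nat. emeasure (\<phi> \<omega>) ({0<..real k} \<times> {- real k..real k}) < \<infinity>"
    unfolding AE_all_countable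
  proof
    fix k :: nat
    have "{0<..real k} \<times> {- real k..real k} \<in> sets half_plane" by (auto simp: sets_half_plane_iff)
    then show "AE \<omega> in M. emeasure (\<phi> \<omega>) ({0<..real k} \<times> {- real k..real k}) < \<infinity>"
      by (intro P.phi_finite emeasure_half_plane_finite bounded_Times) auto
  qed
  ultimately have "AE \<omega> in M. ?P \<omega> \<and>
    (\<forall>k::nat. emeasure (\<phi> \<omega>) ({0<..real k} \<times> {- real k..real k}) < \<infinity>)" by eventually_elim simp
  then obtain L where L: "L \<in> null_sets M" "\<And>\<omega>. \<omega> \<in> space M - L \<Longrightarrow>
      ?P \<omega> \<and>
      (\<forall>k::nat. emeasure (\<phi> \<omega>) ({0<..real k} \<times> {- real k..real k}) < \<infinity>)"
    by (auto elim!: AE_E3)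
  \<comment> \<open>The null set \<open>L\<close> covers the exceptional outcomes but may be larger
    than they are; its complement is an event of probability 1 on which all pathwise facts
    hold.\<close>
  define K where "K = space M - L"
  have K: "K \<in> events" "prob K = 1" using prob_compl[OF null_setsD2[OF L(1)]] null_setsD2[OF L(1)] measure_eq_0_null_sets[OF L(1)]
    by (auto simp: K_def)
  have Vm: "(\<lambda>\<omega>. (X0 \<omega>, Y0 \<omega>)) \<in> ?V \<rightarrow>\<^sub>M count_space UNIV \<Otimes>\<^sub>M borel"
    by (rule measurable_vimage_algebra1) (auto simp: space_pair_measure)
  interpret S: semi_markov M \<phi> "sets ?V" K prec lam lamt X0 Y0 X Y N
  proof (intro semi_markov.intro poisson_filtration.intro poisson_filtration_axioms.intro
      semi_markov_axioms.intro P.poisson_half_plane_axioms R.measurable_rates_axioms)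
    show "sigma_algebra (space M) (sets ?V)" using sets.sigma_algebra_axioms[of ?V] by simp
    show "indep_set (sets ?V) (random_measure_events M half_plane \<phi>)" by (rule initial_indep)
    show "K \<in> events" "prob K = 1" by fact+
    show "emeasure (\<phi> \<omega>) ({0<..real k} \<times> {- real k..real k}) < \<infinity>" if "\<omega> \<in> K" for \<omega> k
      using L(2) that by (auto simp: K_def)
    show "?P \<omega>" if "\<omega> \<in> K" for \<omega>
      using L(2) that by (auto simp: K_def)
    have [measurable]: "X0 \<in> ?V \<rightarrow>\<^sub>M count_space UNIV" "Y0 \<in> borel_measurable ?V"
      using measurable_compose[OF Vm measurable_fst] measurable_compose[OF Vm measurable_snd] by simp_all
    have "{\<omega> \<in> space ?V. X0 \<omega> = i} \<in> sets ?V" for i by measurable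
    then show "{\<omega> \<in> space M. X0 \<omega> = i} \<in> sets ?V" for i by simp
    have "{\<omega> \<in> space ?V. a < Y0 \<omega>} \<in> sets ?V" for a by measurable
    then show "{\<omega> \<in> space M. a < Y0 \<omega>} \<in> sets ?V" for a by simp
  qed
  show ?thesis
  proof (intro allI ballI conjI impI)
    fix n i j assume ij: "i \<in> states" "j \<in> states - {i}"
    then have sp: "(i, j) \<in> state_pairs" by (auto simp: state_pairs_def)
    obtain B where B: "\<forall>z\<ge>0. lam i j z n \<le> B" using lam_bounded[OF sp] by blast
    have rb: "\<bar>R.rate i j n z\<bar> \<le> max B 0" for z
      using B R.rate_nonneg[OF sp, of n z] by (auto simp: R.rate_def)
    have rm: "rate_matrix lam y n i j = R.rate i j n y" if "0 \<le> y" for y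
      using ij that by (auto simp: rate_matrix_def R.rate_def)
    note tr = S.transition_rate[OF compl ij _ B]
    show "AE y in lborel. 0 \<le> y \<longrightarrow> has_transition_rate M X Y0 n i j y (rate_matrix lam y n i j)"
      using Lebesgue_differentiation_right[OF R.rate_measurable[OF sp] rb]
      by eventually_elim (auto simp: rm intro: tr)
    fix y :: real assume y: "0 \<le> y" and cont: "continuous (at_right y) (\<lambda>u. lam i j u n)"
    have "((\<lambda>u. lam i j u n) \<longlongrightarrow> lam i j y n) (at_right y)"
      using cont by (simp add: continuous_within)
    \<comment> \<open>The punctured right neighbourhood of y contains only positive ages, where the
      extension of the rate by 0 agrees with the rate.\<close>
    moreover have "\<forall>\<^sub>F u in at_right y. lam i j u n = R.rate i j n u"
      using eventually_at_right_less[of y] by eventually_elim (use y in \<open>simp add: R.rate_def\<close>)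
    ultimately have "(R.rate i j n \<longlongrightarrow> R.rate i j n y) (at_right y)"
      using y by (auto simp: R.rate_def elim: Lim_transform_eventually)
    from right_average_tendsto[OF R.rate_measurable[OF sp] rb this]
    show "has_transition_rate M X Y0 n i j y (rate_matrix lam y n i j)"
      unfolding rm[OF y] by (intro tr y)
  qed
qed

end
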